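(* Let $\mathfrak{gim}(B_4^{\diamond})(\mathbb{C})$ be the GIM-Lie algebra over $\mathbb{C}$ associated to the generalised intersection matrix $B_4^{\diamond}$ (via a free realisation of $B_4^{\diamond}$), and denote its Chevalley generators by $E_0,\dots,E_4$, $F_0,\dots,F_4$ and $H_{\gamma_0},\dots,H_{\gamma_4}$. There exists a surjective homomorphism of Lie algebras $\phi:\mathfrak{gim}(B_4^{\diamond})(\mathbb{C})\to\mathfrak{k}(E_9)(\mathbb{C})$ that is given on the level of generators via $$\phi(E_0)=x_{+},\quad \phi(F_0)=x_{-},\quad \phi(H_{\gamma_0})=2H_2=2h_2+2h_3+h_4,$$ $$\phi(E_i)=e_i,\quad \phi(F_i)=f_i,\quad \phi(H_{\gamma_i})=h_i\qquad (i=1,2,3,4).$$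
   Context: **The target.** $E_9$ is the affine extension of $E_8$, its Dynkin diagram labelled so that nodes $1,\dots,8$ form a chain (in this order, type $A_8$) and node $9$ is attached to node $3$. Let $\hat e_i,\hat f_i$ ($i=1,\dots,9$) be the Chevalley generators of the complex Kac--Moody algebra $\mathfrak{e}_9(\mathbb{C})$, and $\mathfrak{k}(E_9)(\mathbb{C})$ the fixed-point subalgebra of the linear Cartan--Chevalley involution ($\hat e_i\mapsto-\hat f_i$, $\hat f_i\mapsto-\hat e_i$, $h\mapsto-h$). The Berman generators are $x_i=\hat e_i-\hat f_i$. For an ordered sum put $x_{\alpha_{i_1}+\dots+\alpha_{i_k}}=[x_{i_1},[x_{i_2},[\dots,[x_{i_{k-1}},x_{i_k}]]]]$. Write $\mathrm{i}=\sqrt{-1}$. For $1\le i<j\le4$ let $\beta^{(1)}_{i,j}=\alpha_{2i}+\dots+\alpha_{2j-1}$, $\beta^{(2)}_{i,j}=\alpha_{2i}+\dots+\alpha_{2j-2}$, $\beta^{(3)}_{i,j}=\alpha_{2i-1}+\dots+\alpha_{2j-1}$, $\beta^{(4)}_{i,j}=\alpha_{2i-1}+\dots+\alpha_{2j-2}$ (indices increasing by one), and for $\varepsilon_1,\varepsilon_2\in\{\pm1\}$ $$e_{\varepsilon_1L_i+\varepsilon_2L_j}=\tfrac{\mathrm{i}}{2}\big(x_{\beta^{(1)}_{i,j}}-\mathrm{i}\varepsilon_2x_{\beta^{(2)}_{i,j}}-\mathrm{i}\varepsilon_1x_{\beta^{(3)}_{i,j}}-\varepsilon_1\varepsilon_2x_{\beta^{(4)}_{i,j}}\big),$$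 $$H_j=-\mathrm{i}\,x_{2j-1},\qquad e_{\pm L_j}=\mathrm{i}\big(x_{\alpha_{2j}+\dots+\alpha_8}\mp\mathrm{i}\,x_{\alpha_{2j-1}+\dots+\alpha_8}\big)\qquad(j=1,\dots,4),$$ where $L_1,\dots,L_4$ are the linear functionals on $\mathrm{span}_{\mathbb{C}}\{H_1,\dots,H_4\}$ with $L_i(H_j)=\delta_{ij}$. Put $e_i=e_{L_i-L_{i+1}}$, $f_i=e_{-L_i+L_{i+1}}$, $h_i=H_i-H_{i+1}$ for $i=1,2,3$, and $e_4=e_{+L_4}$, $f_4=e_{-L_4}$, $h_4=2H_4$. Finally $x_{\pm}=\mathrm{i}\,(x_9\mp\mathrm{i}\,[x_3,x_9])$. **The source.** A generalised intersection matrix (GIM) is a square integer matrix $A$ with $A_{ii}=2$ and, for $i\neq j$, $A_{ij}<0\Leftrightarrow A_{ji}<0$ and $A_{ij}>0\Leftrightarrow A_{ji}>0$. A root basis $(\mathfrak{h},\Delta^\vee,\Delta)$ consists of a finite-dimensional complex vector space $\mathfrak{h}$ and families $\Delta^\vee=\{h_{\alpha_i}\mid i\in I\}\subset\mathfrak{h}$, $\Delta=\{\alpha_i\mid i\in I\}\subset\mathfrak{h}^*$, with $I$ finite; its structure matrix is $A_{ij}=\alpha_j(h_{\alpha_i})$, and it is free if both $\Delta^\vee$ and $\Delta$ are linearly independent. Every GIM $A$ has a free realisation, i.e. is the structure matrix of a free root basis, taken to be unique up to isomorphism. The GIM-Lie algebra $\mathfrak{gim}(A)$ is the quotient of the free complex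 Lie algebra generated by $\mathfrak{h}$ and elements $e_\alpha,e_{-\alpha}$ ($\alpha\in\Delta$), for such a free realisation, by the ideal generated by the relations (with $h_{-\alpha}=-h_\alpha$) $$[h,h']=0,\qquad [h,e_\alpha]=\alpha(h)e_\alpha\qquad(h,h'\in\mathfrak{h},\ \alpha\in\pm\Delta),$$ $$[e_\alpha,e_{-\alpha}]=h_\alpha,\qquad \mathrm{ad}(e_\alpha)^{\max(1,\,1-\beta(h_\alpha))}(e_\beta)=0\qquad(\alpha,\beta\in\pm\Delta,\ \alpha\neq-\beta).$$ Here, with rows and columns indexed by $0,\dots,4$, $$B_4^{\diamond}=\begin{pmatrix}2&-2&2&0&0\\-1&2&-1&0&0\\1&-1&2&-1&0\\0&0&-1&2&-1\\0&0&0&-2&2\end{pmatrix}.$$ Writing $\Delta=\{\gamma_0,\dots,\gamma_4\}$ for the free realisation of $B_4^\diamond$, the Chevalley generators are $E_i=e_{\gamma_i}$, $F_i=e_{-\gamma_i}$ and $H_{\gamma_i}=h_{\gamma_i}\in\mathfrak{h}$.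
   Formalization: The domain of φ is the subalgebra of gim(B_4^⋄)(C) generated by the E_i, F_i, H_{γ_i}, not the whole algebra: there no such φ exists, since some d in h with γ_0(d)=1 and γ_i(d)=0 for i=1,…,4 would have to act on x_- both as 1 and as -1. *)

theory Defs
  imports Complex_Main "HOL-Library.FuncSet"
begin

section \<open>Complex Lie algebras with explicit carriers\<close>

record 'a lie_struct =
  lcarrier :: "'a set"
  lzero :: "'a"  (\<open>\<zero>\<index>\<close>)
  ladd :: "'a \<Rightarrow> 'a \<Rightarrow> 'a"  (infixl \<open>\<oplus>\<index>\<close> 65)
  lscale :: "complex \<Rightarrow> 'a \<Rightarrow> 'a"  (infixr \<open>\<odot>\<index>\<close> 75)
  lbr :: "'a \<Rightarrow> 'a \<Rightarrow> 'a"

definition lminus :: "('a, 'm) lie_struct_scheme \<Rightarrow> 'a \<Rightarrow> 'a \<Rightarrow> 'a"  (infixl \<open>\<ominus>\<index>\<close> 65) where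
  "lminus L x y = x \<oplus>\<^bsub>L\<^esub> (-1) \<odot>\<^bsub>L\<^esub> y"

locale lie_algebra =
  fixes L :: "('a, 'm) lie_struct_scheme" (structure)
  assumes zero_closed: "\<zero> \<in> lcarrier L"
    and add_closed: "\<lbrakk>x \<in> lcarrier L; y \<in> lcarrier L\<rbrakk> \<Longrightarrow> x \<oplus> y \<in> lcarrier L"
    and scale_closed: "x \<in> lcarrier L \<Longrightarrow> c \<odot> x \<in> lcarrier L"
    and bracket_closed: "\<lbrakk>x \<in> lcarrier L; y \<in> lcarrier L\<rbrakk> \<Longrightarrow> lbr L x y \<in> lcarrier L"
    and add_assoc: "\<lbrakk>x \<in> lcarrier L; y \<in> lcarrier L; z \<in> lcarrier L\<rbrakk>
      \<Longrightarrow> (x \<oplus> y) \<oplus> z = x \<oplus> (y \<oplus> z)"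
    and add_commute: "\<lbrakk>x \<in> lcarrier L; y \<in> lcarrier L\<rbrakk> \<Longrightarrow> x \<oplus> y = y \<oplus> x"
    and add_zero: "x \<in> lcarrier L \<Longrightarrow> x \<oplus> \<zero> = x"
    and add_inverse: "x \<in> lcarrier L \<Longrightarrow> x \<ominus> x = \<zero>"
    and scale_add_right: "\<lbrakk>x \<in> lcarrier L; y \<in> lcarrier L\<rbrakk> \<Longrightarrow> c \<odot> (x \<oplus> y) = c \<odot> x \<oplus> c \<odot> y"
    and scale_add_left: "x \<in> lcarrier L \<Longrightarrow> (c + d) \<odot> x = c \<odot> x \<oplus> d \<odot> x"
    and scale_scale: "x \<in> lcarrier L \<Longrightarrow> c \<odot> d \<odot> x = (c * d) \<odot> x"
    and scale_one: "x \<in> lcarrier L \<Longrightarrow> 1 \<odot> x = x"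
    and bracket_add_left: "\<lbrakk>x \<in> lcarrier L; y \<in> lcarrier L; z \<in> lcarrier L\<rbrakk>
      \<Longrightarrow> lbr L (x \<oplus> y) z = lbr L x z \<oplus> lbr L y z"
    and bracket_add_right: "\<lbrakk>x \<in> lcarrier L; y \<in> lcarrier L; z \<in> lcarrier L\<rbrakk>
      \<Longrightarrow> lbr L x (y \<oplus> z) = lbr L x y \<oplus> lbr L x z"
    and bracket_scale_left: "\<lbrakk>x \<in> lcarrier L; y \<in> lcarrier L\<rbrakk> \<Longrightarrow> lbr L (c \<odot> x) y = c \<odot> lbr L x y"
    and bracket_scale_right: "\<lbrakk>x \<in> lcarrier L; y \<in> lcarrier L\<rbrakk> \<Longrightarrow> lbr L x (c \<odot> y) = c \<odot> lbr L x y"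
    and bracket_self: "x \<in> lcarrier L \<Longrightarrow> lbr L x x = \<zero>"
    and jacobi: "\<lbrakk>x \<in> lcarrier L; y \<in> lcarrier L; z \<in> lcarrier L\<rbrakk>
      \<Longrightarrow> lbr L x (lbr L y z) \<oplus> (lbr L y (lbr L z x) \<oplus> lbr L z (lbr L x y)) = \<zero>"

locale lie_hom = L: lie_algebra L + M: lie_algebra M
  for L :: "('a, 'm) lie_struct_scheme" and M :: "('b, 'n) lie_struct_scheme" +
  fixes \<phi> :: "'a \<Rightarrow> 'b"
  assumes hom_closed: "\<phi> \<in> lcarrier L \<rightarrow> lcarrier M"
    and hom_add: "\<lbrakk>x \<in> lcarrier L; y \<in> lcarrier L\<rbrakk> \<Longrightarrow> \<phi> (x \<oplus>\<^bsub>L\<^esub> y) = \<phi> x \<oplus>\<^bsub>M\<^esub> \<phi> y"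
    and hom_scale: "x \<in> lcarrier L \<Longrightarrow> \<phi> (c \<odot>\<^bsub>L\<^esub> x) = c \<odot>\<^bsub>M\<^esub> \<phi> x"
    and hom_bracket: "\<lbrakk>x \<in> lcarrier L; y \<in> lcarrier L\<rbrakk> \<Longrightarrow> \<phi> (lbr L x y) = lbr M (\<phi> x) (\<phi> y)"

definition lie_subspace :: "('a, 'm) lie_struct_scheme \<Rightarrow> 'a set \<Rightarrow> bool" where
  "lie_subspace L S \<longleftrightarrow> S \<subseteq> lcarrier L \<and> \<zero>\<^bsub>L\<^esub> \<in> S \<and>
    (\<forall>x\<in>S. \<forall>y\<in>S. x \<oplus>\<^bsub>L\<^esub> y \<in> S) \<and> (\<forall>c. \<forall>x\<in>S. c \<odot>\<^bsub>L\<^esub> x \<in> S)"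

definition lie_subalgebra :: "('a, 'm) lie_struct_scheme \<Rightarrow> 'a set \<Rightarrow> bool" where
  "lie_subalgebra L S \<longleftrightarrow> lie_subspace L S \<and> (\<forall>x\<in>S. \<forall>y\<in>S. lbr L x y \<in> S)"

definition lie_ideal :: "('a, 'm) lie_struct_scheme \<Rightarrow> 'a set \<Rightarrow> bool" where
  "lie_ideal L S \<longleftrightarrow> lie_subspace L S \<and> (\<forall>x\<in>lcarrier L. \<forall>y\<in>S. lbr L x y \<in> S)"

definition subalgebra_generated :: "('a, 'm) lie_struct_scheme \<Rightarrow> 'a set \<Rightarrow> 'a set" where
  "subalgebra_generated L X = \<Inter>{S. lie_subalgebra L S \<and> X \<subseteq> S}"

definition ideal_generated :: "('a, 'm) lie_struct_scheme \<Rightarrow> 'a set \<Rightarrow> 'a set" where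
  "ideal_generated L X = \<Inter>{S. lie_ideal L S \<and> X \<subseteq> S}"

definition lie_restrict :: "'a lie_struct \<Rightarrow> 'a set \<Rightarrow> 'a lie_struct" where
  "lie_restrict L S = L\<lparr>lcarrier := S\<rparr>"

text \<open>Quotient by a congruence \<open>r\<close>; as for \<open>UN_equiv_class\<close>, the unions are over equal sets when
  \<open>r\<close> is compatible with the operations.\<close>

definition lie_quotient :: "'a lie_struct \<Rightarrow> ('a \<times> 'a) set \<Rightarrow> 'a set lie_struct" where
  "lie_quotient L r = \<lparr>lcarrier = lcarrier L // r,
     lzero = r `` {\<zero>\<^bsub>L\<^esub>},
     ladd = (\<lambda>X Y. \<Union>x\<in>X. \<Union>y\<in>Y. r `` {x \<oplus>\<^bsub>L\<^esub> y}),
     lscale = (\<lambda>c X. \<Union>x\<in>X. r `` {c \<odot>\<^bsub>L\<^esub> x}),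
     lbr = (\<lambda>X Y. \<Union>x\<in>X. \<Union>y\<in>Y. r `` {lbr L x y})\<rparr>"

definition ideal_cong :: "'a lie_struct \<Rightarrow> 'a set \<Rightarrow> ('a \<times> 'a) set" where
  "ideal_cong L I = {(x, y). x \<in> lcarrier L \<and> y \<in> lcarrier L \<and> x \<ominus>\<^bsub>L\<^esub> y \<in> I}"


section \<open>Free Lie algebras and presentations\<close>

datatype (gens: 'x) lie_term =
    Gen 'x
  | Zero
  | Add "'x lie_term" "'x lie_term"
  | Scale complex "'x lie_term"
  | Br "'x lie_term" "'x lie_term"

inductive lie_eq :: "'x lie_term \<Rightarrow> 'x lie_term \<Rightarrow> bool" where
  refl: "lie_eq s s"
| sym: "lie_eq s t \<Longrightarrow> lie_eq t s"
| trans: "lie_eq s t \<Longrightarrow> lie_eq t u \<Longrightarrow> lie_eq s u"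
| cong_Add: "lie_eq s s' \<Longrightarrow> lie_eq t t' \<Longrightarrow> lie_eq (Add s t) (Add s' t')"
| cong_Scale: "lie_eq s s' \<Longrightarrow> lie_eq (Scale c s) (Scale c s')"
| cong_Br: "lie_eq s s' \<Longrightarrow> lie_eq t t' \<Longrightarrow> lie_eq (Br s t) (Br s' t')"
| add_assoc: "lie_eq (Add (Add s t) u) (Add s (Add t u))"
| add_commute: "lie_eq (Add s t) (Add t s)"
| add_zero: "lie_eq (Add s Zero) s"
| add_inverse: "lie_eq (Add s (Scale (-1) s)) Zero"
| scale_add_right: "lie_eq (Scale c (Add s t)) (Add (Scale c s) (Scale c t))"
| scale_add_left: "lie_eq (Scale (c + d) s) (Add (Scale c s) (Scale d s))"
| scale_scale: "lie_eq (Scale c (Scale d s)) (Scale (c * d) s)"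
| scale_one: "lie_eq (Scale 1 s) s"
| br_add_left: "lie_eq (Br (Add s t) u) (Add (Br s u) (Br t u))"
| br_add_right: "lie_eq (Br s (Add t u)) (Add (Br s t) (Br s u))"
| br_scale_left: "lie_eq (Br (Scale c s) t) (Scale c (Br s t))"
| br_scale_right: "lie_eq (Br s (Scale c t)) (Scale c (Br s t))"
| br_self: "lie_eq (Br s s) Zero"
| jacobi: "lie_eq (Add (Br s (Br t u)) (Add (Br t (Br u s)) (Br u (Br s t)))) Zero"

definition term_struct :: "'x set \<Rightarrow> 'x lie_term lie_struct" where
  "term_struct X =
    \<lparr>lcarrier = {t. gens t \<subseteq> X}, lzero = Zero, ladd = Add, lscale = Scale, lbr = Br\<rparr>"

definition lie_rel :: "'x set \<Rightarrow> ('x lie_term \<times> 'x lie_term) set" where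
  "lie_rel X = {(s, t). gens s \<subseteq> X \<and> gens t \<subseteq> X \<and> lie_eq s t}"

definition free_lie :: "'x set \<Rightarrow> 'x lie_term set lie_struct" where
  "free_lie X = lie_quotient (term_struct X) (lie_rel X)"

definition free_gen :: "'x set \<Rightarrow> 'x \<Rightarrow> 'x lie_term set" where
  "free_gen X x = lie_rel X `` {Gen x}"

definition presented_lie ::
    "'x set \<Rightarrow> 'x lie_term set set \<Rightarrow> 'x lie_term set set lie_struct" where
  "presented_lie X rels =
    lie_quotient (free_lie X) (ideal_cong (free_lie X) (ideal_generated (free_lie X) rels))"

definition presented_gen ::
    "'x set \<Rightarrow> 'x lie_term set set \<Rightarrow> 'x \<Rightarrow> 'x lie_term set set" where
  "presented_gen X rels x =
    ideal_cong (free_lie X) (ideal_generated (free_lie X) rels) `` {free_gen X x}"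


section \<open>Root bases and free realisations\<close>

text \<open>The vector space \<open>\<hh>\<close> is the whole type \<open>'h\<close> with scalar multiplication \<open>rb_scale\<close>.\<close>

record 'h root_basis =
  rb_index :: "nat set"
  rb_scale :: "complex \<Rightarrow> 'h \<Rightarrow> 'h"
  rb_coroot :: "nat \<Rightarrow> 'h"
  rb_root :: "nat \<Rightarrow> 'h \<Rightarrow> complex"

definition is_root_basis :: "'h::ab_group_add root_basis \<Rightarrow> bool" where
  "is_root_basis R \<longleftrightarrow> finite (rb_index R) \<and>
    (\<exists>Basis. finite_dimensional_vector_space (rb_scale R) Basis) \<and>
    (\<forall>i\<in>rb_index R. Vector_Spaces.linear (rb_scale R) (*) (rb_root R i))"

definition is_free_root_basis :: "'h::ab_group_add root_basis \<Rightarrow> bool" where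
  "is_free_root_basis R \<longleftrightarrow> is_root_basis R \<and>
    (\<forall>c. (\<Sum>i\<in>rb_index R. rb_scale R (c i) (rb_coroot R i)) = 0 \<longrightarrow> (\<forall>i\<in>rb_index R. c i = 0)) \<and>
    (\<forall>c. (\<forall>h. (\<Sum>i\<in>rb_index R. c i * rb_root R i h) = 0) \<longrightarrow> (\<forall>i\<in>rb_index R. c i = 0))"

text \<open>Matrices are functions of row and column index, only considered on an index set.\<close>

definition is_gim :: "nat set \<Rightarrow> (nat \<Rightarrow> nat \<Rightarrow> int) \<Rightarrow> bool" where
  "is_gim I A \<longleftrightarrow> (\<forall>i\<in>I. A i i = 2) \<and>
    (\<forall>i\<in>I. \<forall>j\<in>I. i \<noteq> j \<longrightarrow> (A i j < 0 \<longleftrightarrow> A j i < 0) \<and> (A i j > 0 \<longleftrightarrow> A j i > 0))"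

definition is_free_realisation ::
    "nat set \<Rightarrow> (nat \<Rightarrow> nat \<Rightarrow> int) \<Rightarrow> 'h::ab_group_add root_basis \<Rightarrow> bool" where
  "is_free_realisation I A R \<longleftrightarrow> is_free_root_basis R \<and> rb_index R = I \<and>
    (\<forall>i\<in>I. \<forall>j\<in>I. rb_root R j (rb_coroot R i) = of_int (A i j))"


section \<open>GIM-Lie algebras and Kac--Moody algebras\<close>

text \<open>\<open>Root s i\<close>, for a sign \<open>s\<close>, stands for \<open>e\<^sub>\<alpha>\<close> with \<open>\<alpha> = s \<alpha>\<^sub>i \<in> \<plusminus>\<Delta>\<close>.\<close>

datatype 'h rb_gen = Cart 'h | Root int nat

definition rb_gens :: "'h root_basis \<Rightarrow> 'h rb_gen set" where
  "rb_gens R = range Cart \<union> {Root s i | s i. s \<in> {1, -1} \<and> i \<in> rb_index R}"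

text \<open>These relations turn the free Lie algebra on the set \<open>\<hh> \<union> {e\<^sub>\<alpha> | \<alpha> \<in> \<plusminus>\<Delta>}\<close> into the free Lie
  algebra generated by the vector space \<open>\<hh>\<close> and the elements \<open>e\<^sub>\<alpha>\<close>.\<close>

definition cart_linear_relations ::
    "'h::ab_group_add root_basis \<Rightarrow> 'h rb_gen lie_term set set" where
  "cart_linear_relations R =
    (let L = free_lie (rb_gens R); \<iota> = (\<lambda>h. free_gen (rb_gens R) (Cart h)) in
      {\<iota> (h + h') \<ominus>\<^bsub>L\<^esub> (\<iota> h \<oplus>\<^bsub>L\<^esub> \<iota> h') | h h'. True} \<union>
      {\<iota> (rb_scale R c h) \<ominus>\<^bsub>L\<^esub> c \<odot>\<^bsub>L\<^esub> \<iota> h | c h. True})"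

text \<open>For \<open>\<alpha> = s \<alpha>\<^sub>i\<close> and \<open>\<beta> = t \<alpha>\<^sub>j\<close> one has \<open>h\<^sub>\<alpha> = s h\<^bsub>\<alpha>\<^sub>i\<^esub>\<close>, \<open>\<beta>(h\<^sub>\<alpha>) = s t A\<^sub>i\<^sub>j\<close>, and \<open>\<alpha> \<noteq> -\<beta>\<close> iff
  \<open>(t, j) \<noteq> (-s, i)\<close> because \<open>\<Delta>\<close> is linearly independent.\<close>

definition gim_relations ::
    "(nat \<Rightarrow> nat \<Rightarrow> int) \<Rightarrow> 'h::ab_group_add root_basis \<Rightarrow> 'h rb_gen lie_term set set" where
  "gim_relations A R =
    (let L = free_lie (rb_gens R); I = rb_index R;
         \<iota> = (\<lambda>h. free_gen (rb_gens R) (Cart h));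
         e = (\<lambda>s i. free_gen (rb_gens R) (Root s i)) in
      cart_linear_relations R \<union>
      {lbr L (\<iota> h) (\<iota> h') | h h'. True} \<union>
      {lbr L (\<iota> h) (e s i) \<ominus>\<^bsub>L\<^esub> (of_int s * rb_root R i h) \<odot>\<^bsub>L\<^esub> e s i
         | h s i. s \<in> {1, -1} \<and> i \<in> I} \<union>
      {lbr L (e s i) (e (- s) i) \<ominus>\<^bsub>L\<^esub> \<iota> (rb_scale R (of_int s) (rb_coroot R i))
         | s i. s \<in> {1, -1} \<and> i \<in> I} \<union>
      {(lbr L (e s i) ^^ nat (max 1 (1 - s * t * A i j))) (e t j)
         | s i t j. s \<in> {1, -1} \<and> i \<in> I \<and> t \<in> {1, -1} \<and> j \<in> I \<and> (t, j) \<noteq> (- s, i)})"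

definition gim ::
    "(nat \<Rightarrow> nat \<Rightarrow> int) \<Rightarrow> 'h::ab_group_add root_basis \<Rightarrow> 'h rb_gen lie_term set set lie_struct" where
  "gim A R = presented_lie (rb_gens R) (gim_relations A R)"

definition gim_E where "gim_E A R i = presented_gen (rb_gens R) (gim_relations A R) (Root 1 i)"
definition gim_F where "gim_F A R i = presented_gen (rb_gens R) (gim_relations A R) (Root (-1) i)"
definition gim_H where
  "gim_H A R i = presented_gen (rb_gens R) (gim_relations A R) (Cart (rb_coroot R i))"

text \<open>The subalgebra generated by the Chevalley generators. It is a proper subalgebra of \<open>gim A R\<close> when
  the coroots do not span \<open>\<hh>\<close>, i.e. for every free realisation of a singular \<open>A\<close>. For
  \<open>A = B4_diamond\<close>, a homomorphism with \<open>E\<^sub>0 \<mapsto> x\<^sub>+\<close>, \<open>F\<^sub>0 \<mapsto> x\<^sub>-\<close>, \<open>E\<^sub>i \<mapsto> e\<^sub>i\<close>, \<open>F\<^sub>i \<mapsto> f\<^sub>i\<close> into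
  \<open>\<kk>(E\<^sub>9)\<close> exists on this subalgebra but does not extend to \<open>gim A R\<close>: take \<open>d \<in> \<hh>\<close> with \<open>\<gamma>\<^sub>0(d) = 1\<close> and
  \<open>\<gamma>\<^sub>i(d) = 0\<close> for \<open>i = 1, \<dots>, 4\<close>. Since \<open>[f\<^sub>2,[f\<^sub>3,[f\<^sub>4,[f\<^sub>4,[f\<^sub>3,[f\<^sub>2,x\<^sub>+]]]]]] = -2 x\<^sub>-\<close>, the image of \<open>d\<close>
  would have to act on \<open>x\<^sub>-\<close> both as \<open>1\<close> and as \<open>-1\<close>.\<close>

definition gim_chevalley ::
    "(nat \<Rightarrow> nat \<Rightarrow> int) \<Rightarrow> 'h::ab_group_add root_basis \<Rightarrow> 'h rb_gen lie_term set set lie_struct" where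
  "gim_chevalley A R = lie_restrict (gim A R)
    (subalgebra_generated (gim A R)
      (gim_E A R ` rb_index R \<union> gim_F A R ` rb_index R \<union> gim_H A R ` rb_index R))"

definition km_relations ::
    "(nat \<Rightarrow> nat \<Rightarrow> int) \<Rightarrow> 'h::ab_group_add root_basis \<Rightarrow> 'h rb_gen lie_term set set" where
  "km_relations A R =
    (let L = free_lie (rb_gens R); I = rb_index R;
         \<iota> = (\<lambda>h. free_gen (rb_gens R) (Cart h));
         e = (\<lambda>i. free_gen (rb_gens R) (Root 1 i));
         f = (\<lambda>i. free_gen (rb_gens R) (Root (-1) i)) in
      cart_linear_relations R \<union>
      {lbr L (\<iota> h) (\<iota> h') | h h'. True} \<union>
      {lbr L (\<iota> h) (e i) \<ominus>\<^bsub>L\<^esub> rb_root R i h \<odot>\<^bsub>L\<^esub> e i | h i. i \<in> I} \<union>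
      {lbr L (\<iota> h) (f i) \<ominus>\<^bsub>L\<^esub> (- rb_root R i h) \<odot>\<^bsub>L\<^esub> f i | h i. i \<in> I} \<union>
      {lbr L (e i) (f i) \<ominus>\<^bsub>L\<^esub> \<iota> (rb_coroot R i) | i. i \<in> I} \<union>
      {lbr L (e i) (f j) | i j. i \<in> I \<and> j \<in> I \<and> i \<noteq> j} \<union>
      {(lbr L (e i) ^^ nat (1 - A i j)) (e j) | i j. i \<in> I \<and> j \<in> I \<and> i \<noteq> j} \<union>
      {(lbr L (f i) ^^ nat (1 - A i j)) (f j) | i j. i \<in> I \<and> j \<in> I \<and> i \<noteq> j})"

definition kac_moody ::
    "(nat \<Rightarrow> nat \<Rightarrow> int) \<Rightarrow> 'h::ab_group_add root_basis \<Rightarrow> 'h rb_gen lie_term set set lie_struct" where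
  "kac_moody A R = presented_lie (rb_gens R) (km_relations A R)"

definition km_e where "km_e A R i = presented_gen (rb_gens R) (km_relations A R) (Root 1 i)"
definition km_f where "km_f A R i = presented_gen (rb_gens R) (km_relations A R) (Root (-1) i)"
definition km_h where "km_h A R h = presented_gen (rb_gens R) (km_relations A R) (Cart h)"

definition cartan_chevalley_involution ::
    "(nat \<Rightarrow> nat \<Rightarrow> int) \<Rightarrow> 'h::ab_group_add root_basis \<Rightarrow>
      'h rb_gen lie_term set set \<Rightarrow> 'h rb_gen lie_term set set" where
  "cartan_chevalley_involution A R =
    (let G = kac_moody A R in
      (THE \<omega>. \<omega> \<in> extensional (lcarrier G) \<and> lie_hom G G \<omega> \<and>
        (\<forall>i\<in>rb_index R. \<omega> (km_e A R i) = (-1) \<odot>\<^bsub>G\<^esub> km_f A R i \<and>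
                        \<omega> (km_f A R i) = (-1) \<odot>\<^bsub>G\<^esub> km_e A R i) \<and>
        (\<forall>h. \<omega> (km_h A R h) = (-1) \<odot>\<^bsub>G\<^esub> km_h A R h)))"

definition km_fixed ::
    "(nat \<Rightarrow> nat \<Rightarrow> int) \<Rightarrow> 'h::ab_group_add root_basis \<Rightarrow> 'h rb_gen lie_term set set lie_struct" where
  "km_fixed A R = lie_restrict (kac_moody A R)
    {x \<in> lcarrier (kac_moody A R). cartan_chevalley_involution A R x = x}"

definition berman :: "(nat \<Rightarrow> nat \<Rightarrow> int) \<Rightarrow> 'h::ab_group_add root_basis \<Rightarrow> nat \<Rightarrow> 'h rb_gen lie_term set set"
  where "berman A R i = km_e A R i \<ominus>\<^bsub>kac_moody A R\<^esub> km_f A R i"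


section \<open>The matrices\<close>

definition B4_diamond :: "nat \<Rightarrow> nat \<Rightarrow> int" where
  "B4_diamond i j =
    [[ 2, -2,  2,  0,  0],
     [-1,  2, -1,  0,  0],
     [ 1, -1,  2, -1,  0],
     [ 0,  0, -1,  2, -1],
     [ 0,  0,  0, -2,  2]] ! i ! j"

lemma is_gim_B4_diamond: "is_gim {0..4} B4_diamond"
proof -
  have "{0..4::nat} = {0, 1, 2, 3, 4}" by auto
  then show ?thesis by (simp add: is_gim_def B4_diamond_def)
qed

definition E9_edges :: "nat set set" where
  "E9_edges = insert {3, 9} {{i, i + 1} | i. i \<in> {1..7}}"

definition E9_cartan :: "nat \<Rightarrow> nat \<Rightarrow> int" where
  "E9_cartan i j = (if i = j then 2 else if {i, j} \<in> E9_edges then -1 else 0)"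


section \<open>Elements built from the Berman generators\<close>

context
  fixes L :: "('a, 'm) lie_struct_scheme" (structure) and x :: "nat \<Rightarrow> 'a"
begin

text \<open>\<open>x_sum [i\<^sub>1, \<dots>, i\<^sub>k]\<close> is \<open>x\<close> indexed by the ordered sum \<open>\<alpha>\<^bsub>i\<^sub>1\<^esub> + \<dots> + \<alpha>\<^bsub>i\<^sub>k\<^esub>\<close>; the value on the empty
  list is irrelevant.\<close>

fun x_sum :: "nat list \<Rightarrow> 'a" where
  "x_sum [] = \<zero>"
| "x_sum [i] = x i"
| "x_sum (i # j # is) = lbr L (x i) (x_sum (j # is))"

text \<open>\<open>e_LL i j \<epsilon>\<^sub>1 \<epsilon>\<^sub>2\<close> is \<open>e\<close> indexed by \<open>\<epsilon>\<^sub>1 L\<^sub>i + \<epsilon>\<^sub>2 L\<^sub>j\<close>, and \<open>e_L \<epsilon> j\<close> is \<open>e\<close> indexed by \<open>\<epsilon> L\<^sub>j\<close>. Note that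
  \<open>[a..<b]\<close> excludes \<open>b\<close>.\<close>

definition e_LL :: "nat \<Rightarrow> nat \<Rightarrow> complex \<Rightarrow> complex \<Rightarrow> 'a" where
  "e_LL i j \<epsilon>1 \<epsilon>2 = (\<i> / 2) \<odot>
    (x_sum [2 * i..<2 * j]
      \<ominus> (\<i> * \<epsilon>2) \<odot> x_sum [2 * i..<2 * j - 1]
      \<ominus> (\<i> * \<epsilon>1) \<odot> x_sum [2 * i - 1..<2 * j]
      \<ominus> (\<epsilon>1 * \<epsilon>2) \<odot> x_sum [2 * i - 1..<2 * j - 1])"

definition H_L :: "nat \<Rightarrow> 'a" where
  "H_L j = (- \<i>) \<odot> x (2 * j - 1)"

definition e_L :: "complex \<Rightarrow> nat \<Rightarrow> 'a" where
  "e_L \<epsilon> j = \<i> \<odot> (x_sum [2 * j..<9] \<ominus> (\<epsilon> * \<i>) \<odot> x_sum [2 * j - 1..<9])"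

definition B4_e :: "nat \<Rightarrow> 'a" where
  "B4_e i = (if i = 4 then e_L 1 4 else e_LL i (i + 1) 1 (-1))"

definition B4_f :: "nat \<Rightarrow> 'a" where
  "B4_f i = (if i = 4 then e_L (-1) 4 else e_LL i (i + 1) (-1) 1)"

definition B4_h :: "nat \<Rightarrow> 'a" where
  "B4_h i = (if i = 4 then 2 \<odot> H_L 4 else H_L i \<ominus> H_L (i + 1))"

definition x_plus :: 'a where
  "x_plus = \<i> \<odot> (x 9 \<ominus> \<i> \<odot> lbr L (x 3) (x 9))"

definition x_minus :: 'a where
  "x_minus = \<i> \<odot> (x 9 \<oplus> \<i> \<odot> lbr L (x 3) (x 9))"

end

end

theory Submission
  imports Defs
begin

text \<open>
  Let \<open>B\<close> be the complex Lie algebra presented by generators \<open>x\<^sub>1, \<dots>, x\<^sub>9\<close> and Berman's relations for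
  \<open>E\<^sub>9\<close>: \<open>[x\<^sub>i, [x\<^sub>i, x\<^sub>j]] = -x\<^sub>j\<close> for adjacent nodes, \<open>[x\<^sub>i, x\<^sub>j] = 0\<close> for all others. The elements
  \<open>\<ee>\<^sub>i - \<ff>\<^sub>i\<close> of \<open>\<ee>\<^sub>9\<close> satisfy these relations, so \<open>B\<close> maps to \<open>\<kk>(E\<^sub>9)\<close> (\<open>berman_to_fixed\<close>). This map is
  onto because the fixed points of the involution \<open>\<omega>\<close> are generated by the Berman elements
  (\<open>fixed_points_generated\<close>): by the triangular decomposition every fixed point is a sum of elements
  \<open>u + \<omega>(u)\<close> with \<open>u\<close> a combination of brackets of the \<open>\<ee>\<^sub>i\<close>, and
  \<open>[\<ee>\<^sub>i, u] + \<omega>([\<ee>\<^sub>i, u]) = [x\<^sub>i, u + \<omega>(u)] + ([\<ff>\<^sub>i, u] + \<omega>([\<ff>\<^sub>i, u]))\<close>, where \<open>[\<ff>\<^sub>i, u]\<close> has smaller height up to an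
  element of the Cartan subalgebra, on which \<open>1 + \<omega>\<close> vanishes.

  The computation takes place in \<open>B\<close>: the proposed images of the Chevalley generators satisfy the
  relations of \<open>B\<^sub>4\<^sup>\<diamond>\<close>. On an element \<open>z\<close> with \<open>[y, [y, z]] = -z\<close> the two vectors \<open>z \<mp> \<i>[y, z]\<close> are
  eigenvectors of \<open>ad y\<close>, and the images of all \<open>E\<^sub>i\<close> and \<open>F\<^sub>i\<close> are, up to scalars, obtained from one Berman element by one or
  two such projections. Up to symmetry only two kinds of interacting pairs occur: a long and a short
  root vector on a path of four nodes, and two long root vectors on a path of five nodes; the second reduces to
  the first. For \<open>x\<^sub>\<plusminus>\<close> the paths are \<open>1, 2, 3, 9\<close> and \<open>5, 4, 3, 9\<close>. The second is traversed against the
  direction in which \<open>e\<^sub>2\<close> is defined, which exchanges \<open>e\<^sub>2\<close> and \<open>f\<^sub>2\<close> and thereby produces the positive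
  off-diagonal entries of \<open>B\<^sub>4\<^sup>\<diamond>\<close>.

  It remains to pass from the Chevalley subalgebra of \<open>\<gg>\<ii>\<mm>(B\<^sub>4\<^sup>\<diamond>)\<close>, which is only given as a
  subalgebra of a presented algebra, to \<open>B\<close>. Let \<open>P\<close> be presented like \<open>\<gg>\<ii>\<mm>(B\<^sub>4\<^sup>\<diamond>)\<close>, but with the
  Cartan subalgebra \<open>\<hh>\<close> replaced by the span of \<open>H\<^sub>1, \<dots>, H\<^sub>4\<close>; by the computation, \<open>P\<close> maps to \<open>B\<close>. Its relations are
  homogeneous when \<open>E\<^sub>0\<close>, \<open>F\<^sub>0\<close> have the degrees \<open>1\<close>, \<open>-1\<close> and all other generators the degree \<open>0\<close>, so \<open>P\<close> has
  a derivation \<open>D\<close> multiplying by the degree. The functional \<open>\<gamma>\<^sub>0 - \<gamma>\<^sub>2 - \<gamma>\<^sub>3 - \<gamma>\<^sub>4\<close> measures how \<open>h \<in> \<hh>\<close> fails to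
  act like an element of the torus, and it vanishes on all coroots. Hence the whole of
  \<open>\<gg>\<ii>\<mm>(B\<^sub>4\<^sup>\<diamond>)\<close> maps to the semidirect product of \<open>P\<close> and \<open>\<complex> D\<close> in such a way that the Chevalley
  subalgebra lands in \<open>P\<close> (\<open>gim_chevalley_to_berman\<close>).

  Surjectivity onto \<open>\<kk>(E\<^sub>9)\<close> follows since already in \<open>B\<close> every \<open>x\<^sub>k\<close> lies in the subalgebra generated
  by the images (\<open>node_in_subalgebra\<close>).
\<close>


section \<open>Complex Lie algebras as a type class\<close>

text \<open>Computations are done in types of this class, where additive normalisation needs no membership
  side conditions; homomorphisms out of such types then carry the results to Lie algebras with a carrier.\<close>

class complex_lie = ab_group_add +
  fixes scl :: "complex \<Rightarrow> 'a \<Rightarrow> 'a"  (infixr \<open>*\<^sub>C\<close> 75)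
    and brk :: "'a \<Rightarrow> 'a \<Rightarrow> 'a"
  assumes scl_add_right: "c *\<^sub>C (x + y) = c *\<^sub>C x + c *\<^sub>C y"
    and scl_add_left: "(c + d) *\<^sub>C x = c *\<^sub>C x + d *\<^sub>C x"
    and scl_scl [simp]: "c *\<^sub>C d *\<^sub>C x = (c * d) *\<^sub>C x"
    and scl_one [simp]: "1 *\<^sub>C x = x"
    and brk_add_left: "brk (x + y) z = brk x z + brk y z"
    and brk_add_right: "brk x (y + z) = brk x y + brk x z"
    and brk_scl_left: "brk (c *\<^sub>C x) y = c *\<^sub>C brk x y"
    and brk_scl_right: "brk x (c *\<^sub>C y) = c *\<^sub>C brk x y"
    and brk_self [simp]: "brk x x = 0"
    and brk_jacobi: "brk x (brk y z) + (brk y (brk z x) + brk z (brk x y)) = 0"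
begin

lemma scl_zero_right [simp]: "c *\<^sub>C 0 = 0"
  using scl_add_right[of c 0 0] by simp

lemma scl_zero_left [simp]: "0 *\<^sub>C x = 0"
  using scl_add_left[of 0 0 x] by simp

lemma scl_minus_left [simp]: "(- c) *\<^sub>C x = - (c *\<^sub>C x)"
  using scl_add_left[of "- c" c x] by (simp add: eq_neg_iff_add_eq_0)

lemma scl_minus_right [simp]: "c *\<^sub>C (- x) = - (c *\<^sub>C x)"
  using scl_add_right[of c "- x" x] by (simp add: eq_neg_iff_add_eq_0)

lemma scl_diff_right: "c *\<^sub>C (x - y) = c *\<^sub>C x - c *\<^sub>C y"
  using scl_add_right[of c x "- y"] by simp

lemma scl_eq_0_iff [simp]: "c *\<^sub>C x = 0 \<longleftrightarrow> c = 0 \<or> x = 0"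
proof
  assume "c *\<^sub>C x = 0"
  then have "inverse c *\<^sub>C c *\<^sub>C x = 0" by (simp del: scl_scl)
  then show "c = 0 \<or> x = 0" by (cases "c = 0") auto
qed auto

lemma brk_zero_left [simp]: "brk 0 x = 0"
  using brk_add_left[of 0 0 x] by simp

lemma brk_zero_right [simp]: "brk x 0 = 0"
  using brk_add_right[of x 0 0] by simp

lemma brk_minus_left [simp]: "brk (- x) y = - brk x y"
  using brk_add_left[of "- x" x y] by (simp add: eq_neg_iff_add_eq_0)

lemma brk_minus_right [simp]: "brk x (- y) = - brk x y"
  using brk_add_right[of x "- y" y] by (simp add: eq_neg_iff_add_eq_0)

lemma brk_diff_left: "brk (x - y) z = brk x z - brk y z"
  using brk_add_left[of x "- y" z] by simp

lemma brk_diff_right: "brk x (y - z) = brk x y - brk x z"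
  using brk_add_right[of x y "- z"] by simp

lemma brk_anticomm: "brk x y = - brk y x"
  using brk_self[of "x + y"] by (simp add: brk_add_left brk_add_right eq_neg_iff_add_eq_0 del: brk_self) (simp add: add.commute)

lemma brk_leibniz: "brk x (brk y z) = brk (brk x y) z + brk y (brk x z)"
  using brk_jacobi[of x y z] brk_anticomm[of z "brk x y"] brk_anticomm[of z x]
  by (simp add: algebra_simps eq_neg_iff_add_eq_0)

lemmas brk_linear = brk_add_left brk_add_right brk_diff_left brk_diff_right brk_scl_left brk_scl_right
lemmas scl_linear = scl_add_right scl_diff_right

end

definition type_lie :: "'a::complex_lie lie_struct" where
  "type_lie = \<lparr>lcarrier = UNIV, lzero = 0, ladd = (+), lscale = scl, lbr = brk\<rparr>"

lemma type_lie_simps [simp]: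
  "lcarrier (type_lie :: 'a::complex_lie lie_struct) = UNIV"
  "lzero (type_lie :: 'a lie_struct) = 0"
  "ladd (type_lie :: 'a lie_struct) = (+)"
  "lscale (type_lie :: 'a lie_struct) = scl"
  "lbr (type_lie :: 'a lie_struct) = brk"
  "lminus (type_lie :: 'a lie_struct) = (-)"
  by (auto simp: type_lie_def lminus_def fun_eq_iff)

lemma lie_algebra_type_lie: "lie_algebra (type_lie :: 'a::complex_lie lie_struct)"
  by unfold_locales
    (simp_all add: add.assoc scl_linear scl_add_left brk_linear brk_jacobi add.commute)


section \<open>Evaluation of Lie terms\<close>

fun leval :: "('a, 'm) lie_struct_scheme \<Rightarrow> ('x \<Rightarrow> 'a) \<Rightarrow> 'x lie_term \<Rightarrow> 'a" where
  "leval M g (Gen x) = g x"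
| "leval M g Zero = lzero M"
| "leval M g (Add s t) = ladd M (leval M g s) (leval M g t)"
| "leval M g (Scale c s) = lscale M c (leval M g s)"
| "leval M g (Br s t) = lbr M (leval M g s) (leval M g t)"

lemma (in lie_algebra) leval_closed:
  "\<lbrakk>\<And>x. x \<in> gens t \<Longrightarrow> g x \<in> lcarrier L\<rbrakk> \<Longrightarrow> leval L g t \<in> lcarrier L"
  by (induction t) (auto simp: zero_closed add_closed scale_closed bracket_closed)

text \<open>All values \<open>g x\<close> have to lie in the carrier, because a derivation of \<open>lie_eq s t\<close> may pass through
  terms containing generators that occur neither in \<open>s\<close> nor in \<open>t\<close>.\<close>

lemma (in lie_algebra) leval_lie_eq:
  assumes "lie_eq s t" and g: "\<And>x. g x \<in> lcarrier L"
  shows "leval L g s = leval L g t"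
proof -
  note [simp] = leval_closed[OF g] zero_closed add_closed scale_closed bracket_closed
  show ?thesis
    using assms(1)
  proof (induction rule: lie_eq.induct)
    case (add_commute s t)
    then show ?case by (simp add: lie_algebra.add_commute[OF lie_algebra_axioms])
  next
    case (add_inverse s)
    then show ?case using lie_algebra.add_inverse[OF lie_algebra_axioms, of "leval L g s"] by (simp add: lminus_def)
  qed (simp_all add: add_assoc add_zero scale_add_right scale_add_left scale_scale scale_one
      bracket_add_left bracket_add_right bracket_scale_left bracket_scale_right bracket_self jacobi)
qed

lemma leval_cong: "(\<And>x. x \<in> gens t \<Longrightarrow> g x = g' x) \<Longrightarrow> leval M g t = leval M g' t"
  by (induction t) auto



section \<open>Arithmetic in Lie algebras with a carrier\<close>

context lie_algebra
begin

lemmas closed [simp, intro] = zero_closed add_closed scale_closed bracket_closed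

lemma minus_closed [simp, intro]: "\<lbrakk>x \<in> lcarrier L; y \<in> lcarrier L\<rbrakk> \<Longrightarrow> x \<ominus> y \<in> lcarrier L"
  by (simp add: lminus_def)

lemma add_left_commute:
  "\<lbrakk>x \<in> lcarrier L; y \<in> lcarrier L; z \<in> lcarrier L\<rbrakk> \<Longrightarrow> x \<oplus> (y \<oplus> z) = y \<oplus> (x \<oplus> z)"
  by (metis add_assoc add_commute)

lemma zero_add: "x \<in> lcarrier L \<Longrightarrow> \<zero> \<oplus> x = x"
  by (metis add_commute add_zero zero_closed)

lemma add_neg: "x \<in> lcarrier L \<Longrightarrow> x \<oplus> (-1) \<odot> x = \<zero>"
  using add_inverse by (simp add: lminus_def)

lemma add_neg_left: "x \<in> lcarrier L \<Longrightarrow> (-1) \<odot> x \<oplus> x = \<zero>"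
  using add_neg add_commute by simp

lemma add_neg_cancel:
  "\<lbrakk>x \<in> lcarrier L; y \<in> lcarrier L\<rbrakk> \<Longrightarrow> x \<oplus> ((-1) \<odot> x \<oplus> y) = y"
  "\<lbrakk>x \<in> lcarrier L; y \<in> lcarrier L\<rbrakk> \<Longrightarrow> (-1) \<odot> x \<oplus> (x \<oplus> y) = y"
  by (simp_all add: add_assoc[symmetric] add_neg add_neg_left zero_add)

lemma scale_zero_left: "x \<in> lcarrier L \<Longrightarrow> 0 \<odot> x = \<zero>"
  using scale_add_left[of x 1 "-1"] by (simp add: scale_one add_neg)

lemma scale_zero_right: "c \<odot> \<zero> = \<zero>"
  using scale_scale[of \<zero> c 0] by (simp add: scale_zero_left)

lemma bracket_zero_left: "x \<in> lcarrier L \<Longrightarrow> lbr L \<zero> x = \<zero>"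
  using bracket_scale_left[of \<zero> x 0] by (simp add: scale_zero_left scale_zero_right)

lemma bracket_zero_right: "x \<in> lcarrier L \<Longrightarrow> lbr L x \<zero> = \<zero>"
  using bracket_scale_right[of x \<zero> 0] by (simp add: scale_zero_left scale_zero_right)

lemma eq_iff_minus: "\<lbrakk>x \<in> lcarrier L; y \<in> lcarrier L\<rbrakk> \<Longrightarrow> x \<ominus> y = \<zero> \<longleftrightarrow> x = y"
proof
  assume *: "x \<in> lcarrier L" "y \<in> lcarrier L" "x \<ominus> y = \<zero>"
  have "x = (x \<ominus> y) \<oplus> y" using *(1,2) by (simp add: lminus_def add_assoc add_neg_left add_zero)
  then show "x = y" using * by (simp add: zero_add)
qed (simp add: add_inverse)

lemma add_eq_zero_iff:
  "\<lbrakk>x \<in> lcarrier L; y \<in> lcarrier L\<rbrakk> \<Longrightarrow> x \<oplus> y = \<zero> \<longleftrightarrow> y = (-1) \<odot> x"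
  by (metis add_neg add_neg_cancel(2) add_zero scale_closed)

lemma bracket_anticomm:
  "\<lbrakk>x \<in> lcarrier L; y \<in> lcarrier L\<rbrakk> \<Longrightarrow> lbr L y x = (-1) \<odot> lbr L x y"
proof -
  assume *: "x \<in> lcarrier L" "y \<in> lcarrier L"
  have "\<zero> = lbr L (x \<oplus> y) (x \<oplus> y)" using * by (simp add: bracket_self)
  also have "\<dots> = lbr L x y \<oplus> lbr L y x"
    using * by (subst bracket_add_left) (simp_all add: bracket_add_right bracket_self zero_add add_zero)
  finally show ?thesis using * by (metis add_eq_zero_iff bracket_closed)
qed

lemma bracket_leibniz:
  assumes "x \<in> lcarrier L" "y \<in> lcarrier L" "z \<in> lcarrier L"
  shows "lbr L x (lbr L y z) = lbr L (lbr L x y) z \<oplus> lbr L y (lbr L x z)"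
proof -
  have eq: "lbr L y (lbr L z x) = (-1) \<odot> lbr L y (lbr L x z)" "lbr L z (lbr L x y) = (-1) \<odot> lbr L (lbr L x y) z"
    using assms by (simp_all add: bracket_anticomm[of x z] bracket_scale_right bracket_anticomm[of "lbr L x y" z])
  have "lbr L x (lbr L y z) = (-1) \<odot> ((-1) \<odot> lbr L y (lbr L x z) \<oplus> (-1) \<odot> lbr L (lbr L x y) z)"
    using jacobi[OF assms] assms unfolding eq
    by (subst (asm) add_commute) (simp_all add: add_eq_zero_iff)
  also have "\<dots> = lbr L (lbr L x y) z \<oplus> lbr L y (lbr L x z)"
    using assms by (simp add: scale_add_right scale_scale scale_one add_commute)
  finally show ?thesis .
qed

lemmas bracket_linear = bracket_add_left bracket_add_right bracket_scale_left bracket_scale_right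
lemmas ac = add_assoc add_commute add_left_commute

end

lemma (in lie_hom) hom_closed' [simp, intro]: "x \<in> lcarrier L \<Longrightarrow> \<phi> x \<in> lcarrier M"
  using hom_closed by auto

lemma (in lie_hom) hom_zero: "\<phi> \<zero>\<^bsub>L\<^esub> = \<zero>\<^bsub>M\<^esub>"
  using hom_scale[of "\<zero>\<^bsub>L\<^esub>" 0] by (simp add: L.scale_zero_left M.scale_zero_left)

lemma (in lie_hom) hom_minus:
  "\<lbrakk>x \<in> lcarrier L; y \<in> lcarrier L\<rbrakk> \<Longrightarrow> \<phi> (x \<ominus>\<^bsub>L\<^esub> y) = \<phi> x \<ominus>\<^bsub>M\<^esub> \<phi> y"
  by (simp add: lminus_def hom_add hom_scale)

lemma (in lie_hom) hom_leval:
  "(\<And>x. x \<in> gens t \<Longrightarrow> g x \<in> lcarrier L) \<Longrightarrow> \<phi> (leval L g t) = leval M (\<lambda>x. \<phi> (g x)) t"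
  by (induction t) (auto simp: hom_zero hom_add hom_scale hom_bracket L.leval_closed)

lemma lie_hom_comp:
  assumes "lie_hom L M f" "lie_hom M N g"
  shows "lie_hom L N (g \<circ> f)"
proof -
  interpret f: lie_hom L M f by fact
  interpret g: lie_hom M N g by fact
  show ?thesis
    by unfold_locales
      (auto simp: f.hom_add g.hom_add f.hom_scale g.hom_scale f.hom_bracket g.hom_bracket)
qed


section \<open>Presented Lie algebras as types\<close>

text \<open>Attaching the relators to the type of generators makes the presented Lie algebra a type, and hence
  an instance of \<^class>\<open>complex_lie\<close>.\<close>

class lie_presentation =
  fixes relators :: "'a lie_term set"

inductive pres_eq :: "'a::lie_presentation lie_term \<Rightarrow> 'a lie_term \<Rightarrow> bool" where
  pres_lie: "lie_eq s t \<Longrightarrow> pres_eq s t"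
| pres_relator: "r \<in> relators \<Longrightarrow> pres_eq r Zero"
| pres_sym: "pres_eq s t \<Longrightarrow> pres_eq t s"
| pres_trans: "pres_eq s t \<Longrightarrow> pres_eq t u \<Longrightarrow> pres_eq s u"
| pres_Add: "pres_eq s s' \<Longrightarrow> pres_eq t t' \<Longrightarrow> pres_eq (Add s t) (Add s' t')"
| pres_Scale: "pres_eq s s' \<Longrightarrow> pres_eq (Scale c s) (Scale c s')"
| pres_Br: "pres_eq s s' \<Longrightarrow> pres_eq t t' \<Longrightarrow> pres_eq (Br s t) (Br s' t')"

quotient_type (overloaded) 'a plie = "'a::lie_presentation lie_term" / pres_eq
  by (intro equivpI reflpI sympI transpI) (blast intro: pres_eq.intros lie_eq.refl)+

instantiation plie :: (lie_presentation) complex_lie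
begin

lift_definition zero_plie :: "'a plie" is Zero .
lift_definition plus_plie :: "'a plie \<Rightarrow> 'a plie \<Rightarrow> 'a plie" is Add by (rule pres_Add)
lift_definition scl_plie :: "complex \<Rightarrow> 'a plie \<Rightarrow> 'a plie" is Scale by (rule pres_Scale)
lift_definition brk_plie :: "'a plie \<Rightarrow> 'a plie \<Rightarrow> 'a plie" is Br by (rule pres_Br)
lift_definition uminus_plie :: "'a plie \<Rightarrow> 'a plie" is "Scale (-1)" by (rule pres_Scale)
lift_definition minus_plie :: "'a plie \<Rightarrow> 'a plie \<Rightarrow> 'a plie" is "\<lambda>s t. Add s (Scale (-1) t)"
  by (intro pres_Add pres_Scale)

instance
proof
  fix a b c :: "'a plie" and k l :: complex
  show "a + b + c = a + (b + c)" by transfer (blast intro: pres_lie lie_eq.intros)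
  show "a + b = b + a" by transfer (blast intro: pres_lie lie_eq.intros)
  show "0 + a = a" by transfer (blast intro: pres_lie lie_eq.intros)
  show "- a + a = 0" by transfer (blast intro: pres_lie lie_eq.intros)
  show "a - b = a + - b" by transfer (blast intro: pres_lie lie_eq.intros)
  show "scl k (a + b) = scl k a + scl k b" by transfer (rule pres_lie, rule lie_eq.scale_add_right)
  show "scl (k + l) a = scl k a + scl l a" by transfer (rule pres_lie, rule lie_eq.scale_add_left)
  show "scl k (scl l a) = scl (k * l) a" by transfer (rule pres_lie, rule lie_eq.scale_scale)
  show "scl 1 a = a" by transfer (rule pres_lie, rule lie_eq.scale_one)
  show "brk (a + b) c = brk a c + brk b c" by transfer (rule pres_lie, rule lie_eq.br_add_left)
  show "brk a (b + c) = brk a b + brk a c" by transfer (rule pres_lie, rule lie_eq.br_add_right)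
  show "brk (scl k a) b = scl k (brk a b)" by transfer (rule pres_lie, rule lie_eq.br_scale_left)
  show "brk a (scl k b) = scl k (brk a b)" by transfer (rule pres_lie, rule lie_eq.br_scale_right)
  show "brk a a = 0" by transfer (rule pres_lie, rule lie_eq.br_self)
  show "brk a (brk b c) + (brk b (brk c a) + brk c (brk a b)) = 0"
    by transfer (rule pres_lie, rule lie_eq.jacobi)
qed

end

lift_definition pgen :: "'a::lie_presentation \<Rightarrow> 'a plie" is Gen .

lemma abs_plie_simps [simp]:
  "abs_plie (Gen x) = pgen x" "abs_plie Zero = 0"
  "abs_plie (Add s t) = abs_plie s + abs_plie t"
  "abs_plie (Scale c s) = scl c (abs_plie s)"
  "abs_plie (Br s t) = brk (abs_plie s) (abs_plie t)"
  by (simp_all add: pgen_def zero_plie_def plus_plie.abs_eq scl_plie.abs_eq brk_plie.abs_eq)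

lemma abs_plie_eq_leval: "abs_plie t = leval type_lie pgen t"
  by (induction t) simp_all

lemma leval_relator: "r \<in> relators \<Longrightarrow> leval type_lie pgen r = 0"
  unfolding abs_plie_eq_leval[symmetric] abs_plie_simps(2)[symmetric] plie.abs_eq_iff
  by (rule pres_relator)

text \<open>The value does not depend on the representative as soon as the relators evaluate to zero.\<close>

definition plie_eval ::
    "('b, 'm) lie_struct_scheme \<Rightarrow> ('a \<Rightarrow> 'b) \<Rightarrow> 'a::lie_presentation plie \<Rightarrow> 'b" where
  "plie_eval M g a = leval M g (rep_plie a)"

lemma plie_eval_hom:
  fixes g :: "'a::lie_presentation \<Rightarrow> 'b"
  assumes M: "lie_algebra M" and g: "\<And>x. g x \<in> lcarrier M"
    and rel: "\<And>r. r \<in> relators \<Longrightarrow> leval M g r = lzero M"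
  shows "lie_hom type_lie M (plie_eval M g)" and "plie_eval M g (pgen x) = g x"
proof -
  interpret M: lie_algebra M by fact
  note cl = M.leval_closed[OF g]
  have resp: "leval M g s = leval M g t" if "pres_eq s t" for s t
    using that by (induction rule: pres_eq.induct) (simp_all add: rel M.leval_lie_eq g)
  have abs: "plie_eval M g (abs_plie t) = leval M g t" for t
    unfolding plie_eval_def
    by (rule resp) (metis Quotient3_abs_rep Quotient3_plie plie.abs_eq_iff)
  have rep: "\<exists>t. a = abs_plie t" for a :: "'a plie"
    by (metis Quotient3_abs_rep Quotient3_plie)
  show "plie_eval M g (pgen x) = g x" using abs[of "Gen x"] by simp
  interpret T: lie_algebra "type_lie :: 'a plie lie_struct" by (rule lie_algebra_type_lie)
  show "lie_hom type_lie M (plie_eval M g)"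
  proof unfold_locales
    fix a b :: "'a plie" and c
    obtain s t where [simp]: "a = abs_plie s" "b = abs_plie t" using rep by metis
    show "plie_eval M g (ladd type_lie a b) = plie_eval M g a \<oplus>\<^bsub>M\<^esub> plie_eval M g b"
      using abs[of "Add s t"] by (simp add: abs)
    show "plie_eval M g (lscale type_lie c a) = c \<odot>\<^bsub>M\<^esub> plie_eval M g a"
      using abs[of "Scale c s"] by (simp add: abs)
    show "plie_eval M g (lbr type_lie a b) = lbr M (plie_eval M g a) (plie_eval M g b)"
      using abs[of "Br s t"] by (simp add: abs)
  qed (auto simp: plie_eval_def cl)
qed


section \<open>Root vectors in chains of Berman elements\<close>

text \<open>
  Elements \<open>y1, y2, \<dots>\<close> behave here like the Berman elements along a path in a simply laced diagram. If
  \<open>y1\<close> and \<open>y2\<close> are joined, then \<open>ad y1\<close> has square \<open>-1\<close> on \<open>y2\<close>; for \<open>\<iota>\<^sup>2 = -1\<close>, \<open>short_vec \<iota> y1 y2\<close> is twice the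
  component of \<open>y2\<close> with eigenvalue \<open>\<iota>\<close>. Likewise \<open>long_vec \<iota> y1 y2 y3\<close> is four times the component of \<open>y2\<close> with
  eigenvalues \<open>\<iota>\<close> for \<open>y1\<close> and \<open>-\<iota>\<close> for \<open>y3\<close>. In the orthogonal Lie algebra generated by the chain these are root vectors
  for a short root \<open>L\<^sub>1\<close> and a long root \<open>L\<^sub>1 - L\<^sub>2\<close>, or for their negatives.
\<close>

context complex_lie
begin

definition joined :: "'a \<Rightarrow> 'a \<Rightarrow> bool" where
  "joined y z \<longleftrightarrow> brk y (brk y z) = - z \<and> brk z (brk z y) = - y"

definition chain3 :: "'a \<Rightarrow> 'a \<Rightarrow> 'a \<Rightarrow> bool" where
  "chain3 y1 y2 y3 \<longleftrightarrow> joined y1 y2 \<and> joined y2 y3 \<and> brk y1 y3 = 0"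

definition chain4 :: "'a \<Rightarrow> 'a \<Rightarrow> 'a \<Rightarrow> 'a \<Rightarrow> bool" where
  "chain4 y1 y2 y3 y4 \<longleftrightarrow> chain3 y1 y2 y3 \<and> chain3 y2 y3 y4 \<and> brk y1 y4 = 0"

definition short_vec :: "complex \<Rightarrow> 'a \<Rightarrow> 'a \<Rightarrow> 'a" where
  "short_vec \<iota> y1 y2 = y2 - \<iota> *\<^sub>C brk y1 y2"

definition long_vec :: "complex \<Rightarrow> 'a \<Rightarrow> 'a \<Rightarrow> 'a \<Rightarrow> 'a" where
  "long_vec \<iota> y1 y2 y3 = short_vec \<iota> y1 (short_vec (- \<iota>) y3 y2)"

lemma scl_double: "2 *\<^sub>C x = x + x" "(c * 2) *\<^sub>C x = c *\<^sub>C x + c *\<^sub>C x"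
  using scl_add_left[of 1 1 x] scl_add_left[of c c x] by (simp_all add: mult_2_right)

lemma brk_zero_sym: "brk y z = 0 \<Longrightarrow> brk z y = 0"
  using brk_anticomm[of z y] by simp

lemma joined_sym: "joined y z \<Longrightarrow> joined z y"
  by (simp add: joined_def)

lemma joinedD: "joined y z \<Longrightarrow> brk y (brk y z) = - z" "joined y z \<Longrightarrow> brk y (brk z y) = z"
  using brk_anticomm[of z y] by (auto simp: joined_def)

lemma chain3_rev: "chain3 y1 y2 y3 \<Longrightarrow> chain3 y3 y2 y1"
  by (simp add: chain3_def joined_sym brk_zero_sym)

lemma brk_commuting: "brk u v = 0 \<Longrightarrow> brk u (brk v z) = brk v (brk u z)"
  by (simp add: brk_leibniz[of u v z])

lemma brk_short_vec_commuting:
  "brk u y1 = 0 \<Longrightarrow> brk u (short_vec \<iota> y1 y2) = short_vec \<iota> y1 (brk u y2)"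
  by (simp add: short_vec_def brk_linear brk_commuting[of u y1])

lemma short_vec_linear:
  "short_vec \<iota> y (u + v) = short_vec \<iota> y u + short_vec \<iota> y v"
  "short_vec \<iota> y (u - v) = short_vec \<iota> y u - short_vec \<iota> y v"
  "short_vec \<iota> y (c *\<^sub>C u) = c *\<^sub>C short_vec \<iota> y u"
  "short_vec \<iota> y (- u) = - short_vec \<iota> y u"
  "short_vec \<iota> y 0 = 0"
  by (simp_all add: short_vec_def brk_linear scl_linear algebra_simps)

lemma long_vec_rev:
  assumes "brk y1 y3 = 0"
  shows "long_vec \<iota> y1 y2 y3 = long_vec (- \<iota>) y3 y2 y1"
proof -
  have "brk y1 (brk y3 y2) = brk y3 (brk y1 y2)" by (rule brk_commuting) fact
  then show ?thesis
    by (simp add: long_vec_def short_vec_def brk_linear scl_linear algebra_simps)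
qed

lemma long_vec_eq:
  "long_vec \<iota> y1 y2 y3 = y2 - \<iota> *\<^sub>C brk y1 y2 + \<iota> *\<^sub>C brk y3 y2 - (\<iota> * \<iota>) *\<^sub>C brk y1 (brk y3 y2)"
  by (simp add: long_vec_def short_vec_def brk_linear scl_linear algebra_simps)

lemma short_vec_weight:
  assumes "brk y1 (brk y1 y2) = - y2" "\<iota> * \<iota> = -1"
  shows "brk y1 (short_vec \<iota> y1 y2) = \<iota> *\<^sub>C short_vec \<iota> y1 y2"
  using assms by (simp add: short_vec_def brk_linear scl_linear algebra_simps)

lemma long_vec_weight:
  assumes "chain3 y1 y2 y3" "\<iota> * \<iota> = -1"
  shows "brk y1 (long_vec \<iota> y1 y2 y3) = \<iota> *\<^sub>C long_vec \<iota> y1 y2 y3"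
    and "brk y3 (long_vec \<iota> y1 y2 y3) = (- \<iota>) *\<^sub>C long_vec \<iota> y1 y2 y3"
proof -
  have *: "brk y1 (long_vec \<iota> y1 y2 y3) = \<iota> *\<^sub>C long_vec \<iota> y1 y2 y3"
    if "chain3 y1 y2 y3" "\<iota> * \<iota> = -1" for \<iota> y1 y2 y3
    unfolding long_vec_def using that
    by (intro short_vec_weight) (auto simp: chain3_def brk_short_vec_commuting joinedD short_vec_linear)
  show "brk y1 (long_vec \<iota> y1 y2 y3) = \<iota> *\<^sub>C long_vec \<iota> y1 y2 y3" by (rule *) fact+
  show "brk y3 (long_vec \<iota> y1 y2 y3) = (- \<iota>) *\<^sub>C long_vec \<iota> y1 y2 y3"
    using *[OF chain3_rev[OF assms(1)], of "- \<iota>"] assms by (simp add: long_vec_rev chain3_def)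
qed

text \<open>On the spans of \<open>f, [y, f]\<close> and \<open>w, [y, w]\<close> the map \<open>ad y\<close> is a quarter turn, namely
  \<open>exp ((\<pi> / 2) ad y)\<close>. This automorphism fixes \<open>[f, w]\<close>, because \<open>y\<close> does. The proof applies the Leibniz
  rule once and twice to \<open>[y, [f, w]] = 0\<close>.\<close>

lemma brk_quarter_turn:
  assumes f: "brk y (brk y f) = - f" and w: "brk y (brk y w) = - w" and fw: "brk y (brk f w) = 0"
  shows "brk (brk y f) w = - brk f (brk y w)" and "brk (brk y f) (brk y w) = brk f w"
proof -
  show 1: "brk (brk y f) w = - brk f (brk y w)"
    using fw by (simp add: brk_leibniz[of y f w] eq_neg_iff_add_eq_0)
  have "brk y (brk (brk y f) w) = - brk y (brk f (brk y w))" by (simp add: 1)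
  then have "brk (brk y f) (brk y w) + brk (brk y f) (brk y w) = brk f w + brk f w"
    by (simp add: brk_leibniz[of y "brk y f" w] brk_leibniz[of y f "brk y w"] f w algebra_simps)
  then have "2 *\<^sub>C (brk (brk y f) (brk y w) - brk f w) = 0"
    using scl_add_left[of 1 1] by (simp add: algebra_simps)
  then show "brk (brk y f) (brk y w) = brk f w" by simp
qed

text \<open>The bracket of two vectors of weight \<open>\<iota>\<close> for \<open>y\<close> has weight \<open>2\<iota>\<close>, but \<open>y\<close> annihilates all brackets of
  \<open>f\<close>, \<open>[y, f]\<close> with \<open>w\<close>, \<open>[y, w]\<close>.\<close>

lemma brk_same_weight:
  assumes "brk y (brk y f) = - f" "brk y (brk y w) = - w" "brk y (brk f w) = 0" "\<iota> * \<iota> = -1"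
  shows "brk (short_vec \<iota> y f) (short_vec \<iota> y w) = 0"
  using brk_quarter_turn[OF assms(1-3)] assms(4)
  by (simp add: short_vec_def brk_linear scl_linear algebra_simps)

lemma brk_opposite_weight:
  assumes "brk y (brk y f) = - f" "brk y (brk y w) = - w" "brk y (brk f w) = 0" "\<iota> * \<iota> = -1"
  shows "brk (short_vec \<iota> y f) (short_vec (- \<iota>) y w) = 2 *\<^sub>C (brk f w + \<iota> *\<^sub>C brk f (brk y w))"
  using brk_quarter_turn[OF assms(1-3)] assms(4) scl_double
  by (simp add: short_vec_def brk_linear scl_linear algebra_simps)

text \<open>The Leibniz rule for \<open>[y2, [y1, [y2, y3]]]\<close> and the one for \<open>[y2, [[y1, y2], y3]]\<close> give the same bracket
  of \<open>[y1, y2]\<close> and \<open>[y2, y3]\<close> with opposite signs.\<close>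

lemma chain3_middle:
  assumes "chain3 y1 y2 y3"
  shows "brk y2 (brk y1 (brk y2 y3)) = 0"
proof -
  note c = assms[unfolded chain3_def]
  have "brk y2 (brk y1 (brk y2 y3)) = brk (brk y2 y1) (brk y2 y3)"
    using c by (simp add: brk_leibniz[of y2 y1] joinedD)
  moreover have "brk y1 (brk y2 y3) = brk (brk y1 y2) y3"
    using c by (simp add: brk_leibniz[of y1 y2 y3])
  then have "brk y2 (brk y1 (brk y2 y3)) = brk (brk y1 y2) (brk y2 y3)"
    using c by (simp add: brk_leibniz[of y2 "brk y1 y2"] joinedD joined_sym)
  ultimately have "brk y2 (brk y1 (brk y2 y3)) = - brk y2 (brk y1 (brk y2 y3))"
    using brk_anticomm[of y2 y1] by simp
  then have "2 *\<^sub>C brk y2 (brk y1 (brk y2 y3)) = 0"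
    using scl_add_left[of 1 1] by (simp add: eq_neg_iff_add_eq_0)
  then show ?thesis by simp
qed

lemma short_vec_opposite:
  assumes "joined y1 y2" "\<iota> * \<iota> = -1"
  shows "brk (short_vec \<iota> y1 y2) (short_vec (- \<iota>) y1 y2) = (2 * \<iota>) *\<^sub>C y1"
  using assms by (subst brk_opposite_weight) (auto simp: joinedD joined_sym)

text \<open>The vectors are obtained from \<open>f\<close> and \<open>g\<close>, the two eigenvectors for \<open>y3\<close>, by splitting with
  respect to \<open>y1\<close>; so two applications of \<open>brk_opposite_weight\<close>, for \<open>y1\<close> and for \<open>y3\<close>, suffice.\<close>

lemma long_vec_opposite:
  assumes "chain3 y1 y2 y3" "\<iota> * \<iota> = -1"
  shows "brk (long_vec \<iota> y1 y2 y3) (long_vec (- \<iota>) y1 y2 y3) = (4 * \<iota>) *\<^sub>C (y1 - y3)"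
proof -
  note c = assms(1)[unfolded chain3_def]
  have j: "joined y1 y2" "joined y2 y1" "joined y2 y3" "joined y3 y2" using c joined_sym by blast+
  have c13: "brk y1 y3 = 0" "brk y3 y1 = 0" using c brk_zero_sym by blast+
  define f where "f = short_vec (- \<iota>) y3 y2"
  define g where "g = short_vec \<iota> y3 y2"
  have fg: "brk f g = (- 2 * \<iota>) *\<^sub>C y3"
    unfolding f_def g_def using short_vec_opposite[of y3 y2 "- \<iota>"] j assms(2) by simp
  have y2g: "brk y2 (brk y1 y2) = y1" using j by (simp add: joinedD)
  \<comment> \<open>both sides of this bracket have opposite weights for \<open>y3\<close>\<close>
  have 1: "brk f (brk y1 g) = 2 *\<^sub>C (brk y2 (brk y1 y2) + (- \<iota>) *\<^sub>C brk y2 (brk y3 (brk y1 y2)))"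
    unfolding f_def g_def
    using c13 j assms(2) brk_opposite_weight[of y3 y2 "brk y1 y2" "- \<iota>"]
    by (simp add: brk_short_vec_commuting joinedD brk_commuting[of y3 y1])
  have 2: "brk y2 (brk y3 (brk y1 y2)) = 0"
    using chain3_middle[OF chain3_rev[OF assms(1)]] brk_anticomm[of y1 y2] by simp
  have y1: "brk y1 (brk y1 f) = - f" "brk y1 (brk y1 g) = - g" "brk y1 (brk f g) = 0"
    unfolding fg unfolding f_def g_def using c13 j
    by (simp_all add: brk_short_vec_commuting joinedD short_vec_linear brk_linear)
  show ?thesis
    unfolding long_vec_def
    using brk_opposite_weight[OF y1 assms(2)] assms(2)
    by (simp add: f_def[symmetric] g_def[symmetric] fg 1 2 y2g scl_linear mult.commute)
qed

text \<open>
  Four elements in a chain generate a Lie algebra of type \<open>B\<^sub>2\<close> with torus spanned by \<open>y1\<close> and \<open>y3\<close>. For \<open>\<iota> = \<i>\<close>,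
  \<open>long_vec \<iota> y1 y2 y3\<close> belongs to the root \<open>L\<^sub>1 - L\<^sub>2\<close> and \<open>short_vec \<iota> y3 y4\<close> to \<open>L\<^sub>2\<close>. The element \<open>w\<close> plays for
  \<open>y1\<close> the part that \<open>y4\<close> plays for \<open>y3\<close>: the vectors of weight \<open>\<plusminus>L\<^sub>1\<close> are \<open>w\<close> split along \<open>y1\<close>.
\<close>

context
  fixes y1 y2 y3 y4 w :: 'a and \<iota> :: complex
  assumes ch: "chain4 y1 y2 y3 y4" and i: "\<iota> * \<iota> = -1"
    and w_def: "w = brk y2 (brk y3 y4)"
begin

lemma chain4_brk:
  "joined y1 y2" "joined y2 y1" "joined y2 y3" "joined y3 y2" "joined y3 y4" "joined y4 y3"
  "brk y1 y3 = 0" "brk y3 y1 = 0" "brk y1 y4 = 0" "brk y4 y1 = 0" "brk y2 y4 = 0" "brk y4 y2 = 0"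
  using ch joined_sym brk_zero_sym unfolding chain4_def chain3_def by blast+

lemma brk_w:
  "brk y2 w = - brk y3 y4" "brk y3 w = 0" "brk y4 w = brk y2 y3" "brk (brk y3 y2) y4 = - w"
  "brk (brk y3 y4) w = y2"
proof -
  show 2: "brk y3 w = 0"
    using ch chain3_middle[of y2 y3 y4] by (simp add: chain4_def w_def)
  have "w = brk (brk y2 y3) y4" by (simp add: w_def brk_leibniz[of y2 y3] chain4_brk)
  then show "brk y2 w = - brk y3 y4" "brk (brk y3 y2) y4 = - w"
    using brk_anticomm[of y3 y2] by (simp_all add: brk_leibniz[of y2 "brk y2 y3"] chain4_brk joinedD)
  show 3: "brk y4 w = brk y2 y3"
    by (simp add: w_def brk_commuting[of y4 y2] chain4_brk joinedD)
  show "brk (brk y3 y4) w = y2"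
    using brk_leibniz[of y3 y4 w] by (simp add: 2 3 chain4_brk joinedD)
qed

lemma brk_upper_pair: "brk (brk y3 y4) (brk y2 y3) = 0"
proof -
  have q: "brk (brk y3 y4) y2 = - w" using brk_anticomm[of "brk y3 y4" y2] by (simp add: w_def)
  show ?thesis
    using brk_anticomm[of w y3] brk_anticomm[of "brk y3 y4" y3]
    by (simp add: brk_leibniz[of "brk y3 y4" y2 y3] q brk_w chain4_brk joinedD)
qed

text \<open>The sum of the long root vectors for \<open>\<iota>\<close> and \<open>-\<iota>\<close> is twice \<open>y2 + [y1, [y3, y2]]\<close>; bracketing with \<open>[y3, y4]\<close>
  kills the second summand, and a second bracket leads from the first back to \<open>y2\<close>.\<close>

lemma separate_middle:
  "brk (brk y3 y4) (brk (brk y3 y4) (y2 + brk y1 (brk y3 y2))) = - y2"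
proof -
  have 1: "brk (brk y3 y4) y2 = - w" using brk_anticomm[of "brk y3 y4" y2] by (simp add: w_def)
  have "brk y1 (brk y3 y4) = 0" by (simp add: brk_leibniz[of y1] chain4_brk)
  then have "brk (brk y3 y4) (brk y1 (brk y3 y2)) = brk y1 (brk (brk y3 y4) (brk y3 y2))"
    by (rule brk_commuting[OF brk_zero_sym])
  also have "\<dots> = 0" using brk_upper_pair brk_anticomm[of y3 y2] by simp
  finally show ?thesis by (simp add: brk_linear 1 brk_w)
qed

lemma long_brk_end: "brk (long_vec \<iota> y1 y2 y3) y4 = (- \<iota>) *\<^sub>C short_vec \<iota> y1 w"
proof -
  have "brk (short_vec \<iota> y1 u) y4 = short_vec \<iota> y1 (brk u y4)" for u
    using brk_short_vec_commuting[of y4 y1 \<iota> u] chain4_brk brk_anticomm[of _ y4] by (simp add: short_vec_linear)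
  then show ?thesis
    by (simp add: long_vec_def short_vec_def[of "- \<iota>"] brk_linear brk_w short_vec_linear chain4_brk)
qed

text \<open>Since \<open>[U, y4]\<close> is annihilated by \<open>y3\<close> and \<open>U\<close> is an eigenvector of \<open>ad y3\<close>, the bracket
  \<open>[U, [y3, y4]]\<close> is a multiple of \<open>[U, y4]\<close>. According to the sign in the short vector the two
  contributions cancel or add up.\<close>

lemma long_brk_short:
  "brk (long_vec \<iota> y1 y2 y3) (short_vec (- \<iota>) y3 y4) = 0"
  "brk (long_vec \<iota> y1 y2 y3) (short_vec \<iota> y3 y4) = (- 2 * \<iota>) *\<^sub>C short_vec \<iota> y1 w"
proof -
  let ?U = "long_vec \<iota> y1 y2 y3"
  have "brk y3 (brk ?U y4) = 0"
    by (simp add: long_brk_end brk_linear brk_short_vec_commuting chain4_brk brk_w short_vec_linear)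
  moreover have "brk ?U y3 = \<iota> *\<^sub>C ?U"
    using long_vec_weight(2)[of y1 y2 y3 \<iota>] ch i brk_anticomm[of ?U y3] by (simp add: chain4_def)
  ultimately have *: "brk ?U (brk y3 y4) = \<iota> *\<^sub>C brk ?U y4"
    by (simp add: brk_leibniz[of ?U y3] brk_linear)
  show "brk ?U (short_vec (- \<iota>) y3 y4) = 0"
    using i by (simp add: short_vec_def[of _ y3] brk_linear *)
  show "brk ?U (short_vec \<iota> y3 y4) = (- 2 * \<iota>) *\<^sub>C short_vec \<iota> y1 w"
    using i by (simp add: short_vec_def[of _ y3] brk_linear * long_brk_end mult.commute[of 2] scl_double)
qed

text \<open>One bracket yields the short vector for \<open>L\<^sub>1\<close>. It has the same weight for \<open>y1\<close> as the long vector, so a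
  second one vanishes by \<open>brk_same_weight\<close>.\<close>

lemma serre_long_short:
  "brk (long_vec \<iota> y1 y2 y3) (brk (long_vec \<iota> y1 y2 y3) (short_vec \<iota> y3 y4)) = 0"
proof -
  have w1: "brk y1 (brk y1 w) = - w"
  proof -
    have "w = - brk (brk y3 y4) y2" using brk_anticomm[of "brk y3 y4" y2] by (simp add: w_def)
    moreover have "brk y1 (brk y3 y4) = 0" using chain4_brk by (simp add: brk_leibniz[of y1])
    ultimately show ?thesis by (simp add: brk_leibniz[of y1 "brk y3 y4"] chain4_brk joinedD)
  qed
  let ?f = "short_vec (- \<iota>) y3 y2"
  have f1: "brk y1 (brk y1 ?f) = - ?f"
    by (simp add: brk_short_vec_commuting chain4_brk joinedD short_vec_linear)
  have "brk (brk y3 y2) w = y4"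
    using brk_leibniz[of y3 y2 w] by (simp add: brk_w chain4_brk joinedD)
  then have "brk y1 (brk (brk y3 y2) w) = 0" "brk y1 (brk y2 w) = 0"
    by (simp_all add: brk_w brk_leibniz[of y1 y3] chain4_brk)
  then have "brk y1 (brk ?f w) = 0"
    by (simp add: short_vec_def brk_linear)
  then show ?thesis
    using brk_same_weight[OF f1 w1 _ i]
    unfolding long_brk_short(2) brk_scl_right by (simp add: long_vec_def)
qed

text \<open>The root string is \<open>L\<^sub>1 - L\<^sub>2, L\<^sub>1, L\<^sub>1 + L\<^sub>2\<close>. After the first bracket it is traced by \<open>w\<close> alone, since \<open>s\<close>
  commutes with \<open>y1\<close>.\<close>

lemma serre_short_long:
  fixes s defines "s \<equiv> short_vec \<iota> y3 y4"
  shows "brk s (brk s (brk s (long_vec \<iota> y1 y2 y3))) = 0"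
proof -
  have sy1: "brk s y1 = 0"
    using brk_short_vec_commuting[of y1 y3 \<iota> y4] brk_anticomm[of s y1] by (simp add: s_def chain4_brk short_vec_linear)
  have 1: "brk s w = brk y2 y3 - \<iota> *\<^sub>C y2"
    by (simp add: s_def short_vec_def brk_linear brk_w)
  have "brk y4 (brk y2 y3) = - w"
    using brk_anticomm[of y4 y3] by (simp add: brk_commuting[of y4 y2] chain4_brk w_def)
  moreover have "brk (brk y3 y4) y2 = - w" using brk_anticomm[of "brk y3 y4" y2] by (simp add: w_def)
  ultimately have "brk s (brk s w) = 0"
    unfolding 1 using i by (simp add: s_def short_vec_def brk_linear chain4_brk brk_upper_pair scl_linear)
  moreover have "brk s (long_vec \<iota> y1 y2 y3) = (2 * \<iota>) *\<^sub>C short_vec \<iota> y1 w"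
    using long_brk_short(2) brk_anticomm[of s] by (simp add: s_def)
  ultimately show ?thesis
    using sy1 by (simp add: brk_linear brk_short_vec_commuting short_vec_linear)
qed

end

lemma long_vec_commuting_ends:
  assumes "brk y3 y5 = 0"
  shows "long_vec \<kappa> y3 y4 y5 = short_vec (- \<kappa>) y5 (short_vec \<kappa> y3 y4)"
  using long_vec_rev[OF assms] by (simp add: long_vec_def)

text \<open>The second long vector is a short vector on \<open>y3, y4\<close> split along \<open>y5\<close>, and \<open>y5\<close> commutes with the
  first one. The relations of type \<open>A\<^sub>2\<close> thus follow from those of type \<open>B\<^sub>2\<close>.\<close>

lemma long_brk_long:
  assumes ch: "chain4 y1 y2 y3 y4" and "brk y3 y5 = 0" "brk y1 y5 = 0" "brk y2 y5 = 0"
    and i: "\<iota> * \<iota> = -1"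
  shows "brk (long_vec \<iota> y1 y2 y3) (long_vec (- \<iota>) y3 y4 y5) = 0"
    and "brk (long_vec \<iota> y1 y2 y3) (brk (long_vec \<iota> y1 y2 y3) (long_vec \<iota> y3 y4 y5)) = 0"
proof -
  let ?U = "long_vec \<iota> y1 y2 y3"
  have "brk y5 ?U = 0"
    using assms brk_zero_sym by (simp add: long_vec_def brk_short_vec_commuting short_vec_linear)
  then have U5: "brk ?U y5 = 0" by (rule brk_zero_sym)
  show "brk ?U (long_vec (- \<iota>) y3 y4 y5) = 0"
    using long_brk_short(1)[OF ch i HOL.refl]
    by (simp add: long_vec_commuting_ends[OF assms(2)] brk_short_vec_commuting[OF U5] short_vec_linear)
  show "brk ?U (brk ?U (long_vec \<iota> y3 y4 y5)) = 0"
    using serre_long_short[OF ch i HOL.refl]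
    by (simp add: long_vec_commuting_ends[OF assms(2)] brk_short_vec_commuting[OF U5] short_vec_linear)
qed

end


section \<open>The Lie algebra on the Berman relations\<close>

datatype berman_gen = Node nat

instantiation berman_gen :: lie_presentation
begin

definition relators_berman_gen :: "berman_gen lie_term set" where
  "relators_berman_gen =
    {Br (Gen (Node i)) (Gen (Node j)) | i j. i \<in> {1..9} \<and> j \<in> {1..9} \<and> i \<noteq> j \<and> {i, j} \<notin> E9_edges} \<union>
    {Add (Br (Gen (Node i)) (Br (Gen (Node i)) (Gen (Node j)))) (Gen (Node j))
      | i j. i \<in> {1..9} \<and> j \<in> {1..9} \<and> {i, j} \<in> E9_edges}"

instance ..

end

definition node :: "nat \<Rightarrow> berman_gen plie" where
  "node i = pgen (Node i)"

lemma E9_edges_iff: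
  "{i, j} \<in> E9_edges \<longleftrightarrow> i = 3 \<and> j = 9 \<or> i = 9 \<and> j = 3 \<or>
    j = Suc i \<and> 1 \<le> i \<and> i \<le> 7 \<or> i = Suc j \<and> 1 \<le> j \<and> j \<le> 7"
  by (auto simp: E9_edges_def doubleton_eq_iff)

lemma node_commute: "\<lbrakk>i \<in> {1..9}; j \<in> {1..9}; {i, j} \<notin> E9_edges\<rbrakk> \<Longrightarrow> brk (node i) (node j) = 0"
  using leval_relator[of "Br (Gen (Node i)) (Gen (Node j))"]
  by (cases "i = j") (auto simp: relators_berman_gen_def node_def)

lemma node_joined: "\<lbrakk>i \<in> {1..9}; j \<in> {1..9}; {i, j} \<in> E9_edges\<rbrakk> \<Longrightarrow> joined (node i) (node j)"
  using leval_relator[of "Add (Br (Gen (Node i)) (Br (Gen (Node i)) (Gen (Node j)))) (Gen (Node j))"]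
    leval_relator[of "Add (Br (Gen (Node j)) (Br (Gen (Node j)) (Gen (Node i)))) (Gen (Node i))"]
  by (auto simp: relators_berman_gen_def node_def joined_def insert_commute eq_neg_iff_add_eq_0)

lemma node_chain4: "\<lbrakk>i \<in> {1..5}\<rbrakk> \<Longrightarrow> chain4 (node i) (node (i+1)) (node (i+2)) (node (i+3))"
  by (auto simp: chain4_def chain3_def node_joined node_commute E9_edges_iff)

lemma node_chain4_branch: "chain4 (node 1) (node 2) (node 3) (node 9)" "chain4 (node 5) (node 4) (node 3) (node 9)"
  by (auto simp: chain4_def chain3_def node_joined node_commute E9_edges_iff)

lemmas node_com = node_commute E9_edges_iff


section \<open>Chevalley generators built from Berman elements\<close>

text \<open>The images of \<open>E\<^sub>i\<close> (for \<open>\<iota> = \<i>\<close>) and \<open>F\<^sub>i\<close> (for \<open>\<iota> = -\<i>\<close>) up to scalars.\<close>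

definition root_line :: "complex \<Rightarrow> nat \<Rightarrow> berman_gen plie" where
  "root_line \<iota> i =
    (if i = 0 then short_vec \<iota> (node 3) (node 9)
     else if i = 4 then short_vec \<iota> (node 7) (node 8)
     else long_vec \<iota> (node (2 * i - 1)) (node (2 * i)) (node (2 * i + 1)))"

lemma root_line_simps:
  "root_line \<iota> 0 = short_vec \<iota> (node 3) (node 9)"
  "root_line \<iota> (Suc 0) = long_vec \<iota> (node 1) (node 2) (node 3)"
  "root_line \<iota> 2 = long_vec \<iota> (node 3) (node 4) (node 5)"
  "root_line \<iota> 3 = long_vec \<iota> (node 5) (node 6) (node 7)"
  "root_line \<iota> 4 = short_vec \<iota> (node 7) (node 8)"
  by (simp_all add: root_line_def)

lemma le_4_iff: "i \<le> 4 \<longleftrightarrow> i = 0 \<or> i = Suc 0 \<or> i = 2 \<or> i = 3 \<or> i = (4::nat)"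
  by auto

lemma brk_long_vec_commuting:
  fixes u :: "'a::complex_lie"
  assumes "brk u y1 = 0" "brk u y3 = 0"
  shows "brk u (long_vec \<iota> y1 y2 y3) = long_vec \<iota> y1 (brk u y2) y3"
  using assms by (simp add: long_vec_def brk_short_vec_commuting)

lemma long_vec_zero: "long_vec \<iota> y1 (0::'a::complex_lie) y3 = 0"
  by (simp add: long_vec_def short_vec_linear)

lemma brk_short_vec_eq_0:
  "brk u y1 = 0 \<Longrightarrow> brk u y2 = 0 \<Longrightarrow> brk u (short_vec \<kappa> y1 y2) = (0::'a::complex_lie)"
  by (simp add: brk_short_vec_commuting short_vec_linear)

lemma brk_long_vec_eq_0:
  "brk u y1 = 0 \<Longrightarrow> brk u y2 = 0 \<Longrightarrow> brk u y3 = 0 \<Longrightarrow> brk u (long_vec \<kappa> y1 y2 y3) = (0::'a::complex_lie)"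
  by (simp add: brk_long_vec_commuting long_vec_zero)

text \<open>The coefficient of \<open>L\<^sub>j\<close> in the weight of the image of \<open>E\<^sub>i\<close>. The vector \<open>x\<^sub>+\<close> has weight \<open>L\<^sub>2\<close>, as it is an
  eigenvector for \<open>x\<^sub>3\<close>. The value \<open>-1\<close> at \<open>(4, 5)\<close> is outside the range of \<open>j\<close>.\<close>

definition L_coeff :: "nat \<Rightarrow> nat \<Rightarrow> int" where
  "L_coeff i j = (if i = 0 then (if j = 2 then 1 else 0)
     else if j = i then 1 else if j = i + 1 then - 1 else 0)"

lemma root_line_weight:
  assumes "i \<le> 4" "j \<in> {1..4}" "\<iota> * \<iota> = -1"
  shows "brk (node (2 * j - 1)) (root_line \<iota> i) = (\<iota> * of_int (L_coeff i j)) *\<^sub>C root_line \<iota> i"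
proof -
  have ch: "chain3 (node 1) (node 2) (node 3)" "chain3 (node 3) (node 4) (node 5)" "chain3 (node 5) (node 6) (node 7)"
    "joined (node 3) (node 9)" "joined (node 7) (node 8)"
    by (auto simp: chain3_def node_joined node_com)
  have j: "j = Suc 0 \<or> j = 2 \<or> j = 3 \<or> j = 4" using assms(2) by auto
  note w = long_vec_weight[OF ch(1) assms(3)] long_vec_weight[OF ch(2) assms(3)]
    long_vec_weight[OF ch(3) assms(3)] short_vec_weight[OF joinedD(1)[OF ch(4)] assms(3)]
    short_vec_weight[OF joinedD(1)[OF ch(5)] assms(3)]
  note [simp] = brk_short_vec_eq_0 brk_long_vec_eq_0 node_com
  show ?thesis
    using assms(1)[unfolded le_4_iff]
  proof (elim disjE)
    assume "i = 0"
    then show ?thesis using j w(7) by (elim disjE) (simp_all add: root_line_simps L_coeff_def)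
  next
    assume "i = Suc 0"
    then show ?thesis using j w(1,2) by (elim disjE) (simp_all add: root_line_simps L_coeff_def)
  next
    assume "i = 2"
    then show ?thesis using j w(3,4) by (elim disjE) (simp_all add: root_line_simps L_coeff_def)
  next
    assume "i = 3"
    then show ?thesis using j w(5,6) by (elim disjE) (simp_all add: root_line_simps L_coeff_def)
  next
    assume "i = 4"
    then show ?thesis using j w(8) by (elim disjE) (simp_all add: root_line_simps L_coeff_def)
  qed
qed

context
  fixes \<iota> :: complex
  assumes i: "\<iota> * \<iota> = -1"
begin

lemma minus_square: "(- \<iota>) * (- \<iota>) = -1" using i by simp

text \<open>The relations for \<open>(i + 1, i)\<close> are those for \<open>(i, i + 1)\<close> read backwards: reversing the chain of five nodes
  exchanges the two long vectors and changes both signs (\<open>long_vec_rev\<close>).\<close>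

lemma root_line_serre_long_long:
  assumes "i \<in> {1, 2}"
  shows "brk (root_line \<iota> i) (root_line (- \<iota>) (i + 1)) = 0"
    and "brk (root_line \<iota> i) (brk (root_line \<iota> i) (root_line \<iota> (i + 1))) = 0"
    and "brk (root_line \<iota> (i + 1)) (root_line (- \<iota>) i) = 0"
    and "brk (root_line \<iota> (i + 1)) (brk (root_line \<iota> (i + 1)) (root_line \<iota> i)) = 0"
proof -
  have up: "chain4 (node (2 * i - 1)) (node (2 * i)) (node (2 * i + 1)) (node (2 * i + 2))"
    and down: "chain4 (node (2 * i + 3)) (node (2 * i + 2)) (node (2 * i + 1)) (node (2 * i))"
    using assms by (auto simp: chain4_def chain3_def node_joined node_com)
  have com: "brk (node (2 * i + 1)) (node (2 * i + 3)) = 0" "brk (node (2 * i - 1)) (node (2 * i + 3)) = 0"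
    "brk (node (2 * i)) (node (2 * i + 3)) = 0" "brk (node (2 * i + 1)) (node (2 * i - 1)) = 0"
    "brk (node (2 * i + 3)) (node (2 * i - 1)) = 0" "brk (node (2 * i + 2)) (node (2 * i - 1)) = 0"
    "brk (node (2 * i - 1)) (node (2 * i + 1)) = 0"
    using assms by (auto simp: node_com)
  have r: "root_line \<kappa> i = long_vec \<kappa> (node (2 * i - 1)) (node (2 * i)) (node (2 * i + 1))"
    "root_line \<kappa> (i + 1) = long_vec \<kappa> (node (2 * i + 1)) (node (2 * i + 2)) (node (2 * i + 3))" for \<kappa>
    using assms by (auto simp: root_line_simps numeral_2_eq_2[symmetric] numeral_3_eq_3[symmetric])
  have r': "root_line \<kappa> i = long_vec (- \<kappa>) (node (2 * i + 1)) (node (2 * i)) (node (2 * i - 1))"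
    "root_line \<kappa> (i + 1) = long_vec (- \<kappa>) (node (2 * i + 3)) (node (2 * i + 2)) (node (2 * i + 1))" for \<kappa>
    unfolding r by (rule long_vec_rev, fact com)+
  show "brk (root_line \<iota> i) (root_line (- \<iota>) (i + 1)) = 0"
    "brk (root_line \<iota> i) (brk (root_line \<iota> i) (root_line \<iota> (i + 1))) = 0"
    unfolding r by (rule long_brk_long[OF up com(1-3) i])+
  show "brk (root_line \<iota> (i + 1)) (root_line (- \<iota>) i) = 0"
    "brk (root_line \<iota> (i + 1)) (brk (root_line \<iota> (i + 1)) (root_line \<iota> i)) = 0"
    unfolding r' by (rule long_brk_long[OF down com(4-6) minus_square])+
qed

text \<open>Three chains of type \<open>B\<^sub>2\<close> occur: \<open>5, 6, 7, 8\<close> for \<open>(3, 4)\<close>, \<open>1, 2, 3, 9\<close> for \<open>(1, 0)\<close> and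
  \<open>5, 4, 3, 9\<close> for \<open>(2, 0)\<close>. In the last one the nodes of the long vector are traversed backwards, so that
  its sign is changed and the roles of equal and opposite signs are interchanged.\<close>

lemma root_line_serre_long_short:
  "brk (root_line \<iota> 3) (root_line (- \<iota>) 4) = 0" "brk (root_line \<iota> 4) (root_line (- \<iota>) 3) = 0"
  "brk (root_line \<iota> 3) (brk (root_line \<iota> 3) (root_line \<iota> 4)) = 0"
  "brk (root_line \<iota> 4) (brk (root_line \<iota> 4) (brk (root_line \<iota> 4) (root_line \<iota> 3))) = 0"
  "brk (root_line \<iota> (Suc 0)) (root_line (- \<iota>) 0) = 0" "brk (root_line \<iota> 0) (root_line (- \<iota>) (Suc 0)) = 0"
  "brk (root_line \<iota> (Suc 0)) (brk (root_line \<iota> (Suc 0)) (root_line \<iota> 0)) = 0"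
  "brk (root_line \<iota> 0) (brk (root_line \<iota> 0) (brk (root_line \<iota> 0) (root_line \<iota> (Suc 0)))) = 0"
  "brk (root_line \<iota> 2) (root_line \<iota> 0) = 0" "brk (root_line \<iota> 0) (root_line \<iota> 2) = 0"
  "brk (root_line \<iota> 2) (brk (root_line \<iota> 2) (root_line (- \<iota>) 0)) = 0"
  "brk (root_line \<iota> 0) (brk (root_line \<iota> 0) (brk (root_line \<iota> 0) (root_line (- \<iota>) 2))) = 0"
proof -
  have c: "chain4 (node 5) (node 6) (node 7) (node 8)" using node_chain4[of 5] by simp
  have rev: "root_line \<kappa> 2 = long_vec (- \<kappa>) (node 5) (node 4) (node 3)" for \<kappa>
    unfolding root_line_simps by (rule long_vec_rev) (simp add: node_com)
  note b1 = node_chain4_branch(1) and b2 = node_chain4_branch(2)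
  show "brk (root_line \<iota> 3) (root_line (- \<iota>) 4) = 0" "brk (root_line \<iota> 4) (root_line (- \<iota>) 3) = 0"
    "brk (root_line \<iota> 3) (brk (root_line \<iota> 3) (root_line \<iota> 4)) = 0"
    "brk (root_line \<iota> 4) (brk (root_line \<iota> 4) (brk (root_line \<iota> 4) (root_line \<iota> 3))) = 0"
    unfolding root_line_simps
    using long_brk_short(1)[OF c i HOL.refl] brk_zero_sym[OF long_brk_short(1)[OF c minus_square HOL.refl]]
      serre_long_short[OF c i HOL.refl] serre_short_long[OF c i HOL.refl]
    by simp_all
  show "brk (root_line \<iota> (Suc 0)) (root_line (- \<iota>) 0) = 0" "brk (root_line \<iota> 0) (root_line (- \<iota>) (Suc 0)) = 0"
    "brk (root_line \<iota> (Suc 0)) (brk (root_line \<iota> (Suc 0)) (root_line \<iota> 0)) = 0"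
    "brk (root_line \<iota> 0) (brk (root_line \<iota> 0) (brk (root_line \<iota> 0) (root_line \<iota> (Suc 0)))) = 0"
    unfolding root_line_simps
    using long_brk_short(1)[OF b1 i HOL.refl] brk_zero_sym[OF long_brk_short(1)[OF b1 minus_square HOL.refl]]
      serre_long_short[OF b1 i HOL.refl] serre_short_long[OF b1 i HOL.refl]
    by simp_all
  show "brk (root_line \<iota> 2) (root_line \<iota> 0) = 0" "brk (root_line \<iota> 0) (root_line \<iota> 2) = 0"
    "brk (root_line \<iota> 2) (brk (root_line \<iota> 2) (root_line (- \<iota>) 0)) = 0"
    "brk (root_line \<iota> 0) (brk (root_line \<iota> 0) (brk (root_line \<iota> 0) (root_line (- \<iota>) 2))) = 0"
    unfolding rev unfolding root_line_simps
    using long_brk_short(1)[OF b2 minus_square HOL.refl] brk_zero_sym[OF long_brk_short(1)[OF b2 minus_square HOL.refl]]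
      serre_long_short[OF b2 minus_square HOL.refl] serre_short_long[OF b2 i HOL.refl]
    by simp_all
qed

lemma root_line_far_apart:
  assumes "i \<le> 4" "j \<le> 4" "B4_diamond i j = 0"
  shows "brk (root_line \<iota> i) (root_line \<kappa> j) = 0"
proof -
  have com: "brk (node a) (root_line \<kappa> j) = 0"
    if "a \<in> (if i = 0 then {3, 9} else if i = 4 then {7, 8} else {2 * i - 1, 2 * i, 2 * i + 1})" for a
    using assms that unfolding le_4_iff
    by (elim disjE) (auto simp: B4_diamond_def root_line_simps brk_short_vec_eq_0 brk_long_vec_eq_0 node_com
        split: if_splits)
  have "brk (root_line \<kappa> j) (root_line \<iota> i) = 0"
    unfolding root_line_def[of _ i]
    by (auto intro!: brk_short_vec_eq_0 brk_long_vec_eq_0 brk_zero_sym[OF com])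
  then show ?thesis by (rule brk_zero_sym)
qed

text \<open>The first part concerns \<open>ad(e\<^sub>\<alpha>)\<close> on \<open>e\<^sub>\<beta>\<close> when \<open>\<alpha>\<close> and \<open>\<beta>\<close> carry the same sign, the second when the signs differ.\<close>

lemma root_line_serre:
  assumes "i \<le> 4" "j \<le> 4"
  shows "(brk (root_line \<iota> i) ^^ nat (max 1 (1 - B4_diamond i j))) (root_line \<iota> j) = 0"
    and "i \<noteq> j \<Longrightarrow> (brk (root_line \<iota> i) ^^ nat (max 1 (1 + B4_diamond i j))) (root_line (- \<iota>) j) = 0"
proof -
  note [simp] = root_line_serre_long_long[of "Suc 0", simplified, folded numeral_2_eq_2]
    root_line_serre_long_long[of 2, simplified, folded numeral_3_eq_3]
  note facts = root_line_serre_long_short root_line_far_apart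
  have p: "(f ^^ 2) x = f (f x)" "(f ^^ 3) x = f (f (f x))" for f and x :: "berman_gen plie"
    by (simp_all add: numeral_2_eq_2 numeral_3_eq_3)
  show "(brk (root_line \<iota> i) ^^ nat (max 1 (1 - B4_diamond i j))) (root_line \<iota> j) = 0"
    using assms unfolding le_4_iff
    by (elim disjE) (simp_all add: facts p B4_diamond_def)
  show "i \<noteq> j \<Longrightarrow> (brk (root_line \<iota> i) ^^ nat (max 1 (1 + B4_diamond i j))) (root_line (- \<iota>) j) = 0"
    using assms unfolding le_4_iff
    by (elim disjE) (simp_all add: facts p B4_diamond_def)
qed

end


text \<open>In \<^const>\<open>root_line\<close> the Berman element being projected has coefficient \<open>1\<close>; these are its coefficients in
  \<open>e\<^sub>i\<close>, \<open>f\<^sub>i\<close> and \<open>x\<^sub>\<plusminus>\<close>.\<close>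

definition root_factor :: "int \<Rightarrow> nat \<Rightarrow> complex" where
  "root_factor s i = (if i \<in> {1, 2, 3} then - of_int s / 2 else \<i>)"

definition root_vec :: "int \<Rightarrow> nat \<Rightarrow> berman_gen plie" where
  "root_vec s i = root_factor s i *\<^sub>C root_line (of_int s * \<i>) i"

definition torus :: "nat \<Rightarrow> berman_gen plie" where
  "torus j = (- \<i>) *\<^sub>C node (2 * j - 1)"

definition coroot :: "nat \<Rightarrow> berman_gen plie" where
  "coroot i = (if i = 0 then 2 *\<^sub>C torus 2 else if i = 4 then 2 *\<^sub>C torus 4 else torus i - torus (i + 1))"

lemma sign_square: "s \<in> {1, -1} \<Longrightarrow> (of_int s * \<i>) * (of_int s * \<i>) = -1"
  by auto

lemma torus_commute: "j \<in> {1..4} \<Longrightarrow> k \<in> {1..4} \<Longrightarrow> brk (torus j) (torus k) = 0"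
  unfolding torus_def brk_scl_left brk_scl_right
  by (subst node_commute) (auto simp: E9_edges_iff; presburger)+

lemma torus_root_vec:
  assumes "i \<le> 4" "j \<in> {1..4}" "s \<in> {1, -1}"
  shows "brk (torus j) (root_vec s i) = of_int (s * L_coeff i j) *\<^sub>C root_vec s i"
  using root_line_weight[OF assms(1,2) sign_square[OF assms(3)]] assms(3)
  by (auto simp: torus_def root_vec_def brk_linear mult.commute)

lemma root_vec_opposite:
  assumes "i \<le> 4" "s \<in> {1, -1}"
  shows "brk (root_vec s i) (root_vec (- s) i) = of_int s *\<^sub>C coroot i"
proof -
  have ch: "chain3 (node 1) (node 2) (node 3)" "chain3 (node 3) (node 4) (node 5)" "chain3 (node 5) (node 6) (node 7)"
    "joined (node 3) (node 9)" "joined (node 7) (node 8)"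
    by (auto simp: chain3_def node_joined node_com)
  note l = long_vec_opposite[OF ch(1) sign_square[OF assms(2)]] long_vec_opposite[OF ch(2) sign_square[OF assms(2)]]
    long_vec_opposite[OF ch(3) sign_square[OF assms(2)]] short_vec_opposite[OF ch(4) sign_square[OF assms(2)]]
    short_vec_opposite[OF ch(5) sign_square[OF assms(2)]]
  show ?thesis
    using assms(1) l assms(2) unfolding le_4_iff root_vec_def brk_scl_left brk_scl_right
    by (elim disjE) (auto simp: root_line_simps root_factor_def coroot_def torus_def scl_linear)
qed

lemma brk_pow_scl:
  fixes u :: "'a::complex_lie"
  shows "(brk (a *\<^sub>C u) ^^ n) (b *\<^sub>C v) = (a ^ n * b) *\<^sub>C (brk u ^^ n) v"
  by (induction n) (simp_all add: brk_linear mult.assoc)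

lemma root_vec_serre:
  assumes "i \<le> 4" "j \<le> 4" "s \<in> {1, -1}" "t \<in> {1, -1}" "(t, j) \<noteq> (- s, i)"
  shows "(brk (root_vec s i) ^^ nat (max 1 (1 - s * t * B4_diamond i j))) (root_vec t j) = 0"
proof (cases "t = s")
  case True
  then have "s * t = 1" using assms by auto
  then show ?thesis
    using root_line_serre(1)[OF sign_square[OF assms(3)] assms(1,2)] True
    by (simp add: root_vec_def brk_pow_scl)
next
  case False
  then have "t = - s" "i \<noteq> j" using assms by auto
  moreover have "s * t = -1" using assms False by auto
  ultimately show ?thesis
    using root_line_serre(2)[OF sign_square[OF assms(3)] assms(1,2)]
    by (simp add: root_vec_def brk_pow_scl)
qed

lemma x_plus_minus_eq:
  "x_plus type_lie node = root_vec 1 0" "x_minus type_lie node = root_vec (- 1) 0"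
  by (simp_all add: x_plus_def x_minus_def root_vec_def root_factor_def root_line_simps short_vec_def)

lemma B4_ef_eq:
  assumes "i \<in> {1..4}"
  shows "B4_e type_lie node i = root_vec 1 i" "B4_f type_lie node i = root_vec (- 1) i"
proof -
  have c: "brk (node 3) (node 2) = - brk (node 2) (node 3)" "brk (node 5) (node 4) = - brk (node 4) (node 5)"
    "brk (node 7) (node 6) = - brk (node 6) (node 7)" by (rule brk_anticomm)+
  have i: "i = 1 \<or> i = 2 \<or> i = 3 \<or> i = 4" using assms by auto
  show "B4_e type_lie node i = root_vec 1 i" "B4_f type_lie node i = root_vec (- 1) i"
    using i by (auto simp: B4_e_def B4_f_def root_vec_def root_factor_def e_L_def e_LL_def
        root_line_simps short_vec_def long_vec_eq scl_linear upt_conv_Cons c algebra_simps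
        numeral_2_eq_2[symmetric] numeral_3_eq_3[symmetric])
qed

lemma B4_h_eq: "i \<in> {1..4} \<Longrightarrow> B4_h type_lie node i = coroot i" "H_L type_lie node i = torus i"
  by (auto simp: B4_h_def coroot_def H_L_def torus_def)

lemma coroot_0_eq: "coroot 0 = 2 *\<^sub>C coroot 2 + 2 *\<^sub>C coroot 3 + coroot 4"
  by (simp add: coroot_def scl_linear)

text \<open>The nodes \<open>8\<close>, \<open>9\<close> are half the sums of opposite short vectors, and the odd nodes up to \<open>7\<close> are multiples
  of the \<open>H\<^sub>j\<close>, which are obtained from the coroots \<open>[e, f]\<close>. The long vectors contain \<open>x\<^sub>2\<^sub>i\<close> only together with a second summand;
  \<open>separate_middle\<close> removes it by means of \<open>x\<^sub>2\<^sub>i\<^sub>+\<^sub>1\<close> and \<open>x\<^sub>2\<^sub>i\<^sub>+\<^sub>2\<close>, so the nodes \<open>6, 4, 2\<close> are reached in this order.\<close>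

lemma node_in_subalgebra:
  assumes sub: "lie_subalgebra type_lie S" and S: "\<And>s i. s \<in> {1, -1} \<Longrightarrow> i \<le> 4 \<Longrightarrow> root_vec s i \<in> S"
    and k: "k \<in> {1..9}"
  shows "node k \<in> S"
proof -
  have add: "a + b \<in> S" and scl: "c *\<^sub>C a \<in> S" and brk: "brk a b \<in> S" if "a \<in> S" "b \<in> S" for a b c
    using sub that by (auto simp: lie_subalgebra_def lie_subspace_def)
  have unscl: "a \<in> S" if "c *\<^sub>C a \<in> S" "c \<noteq> 0" for a c
    using scl[OF that(1) that(1), of "inverse c"] that(2) by simp
  have line: "root_line \<i> i \<in> S" "root_line (- \<i>) i \<in> S" if "i \<le> 4" for i
    using unscl[of "root_factor 1 i" "root_line \<i> i"] unscl[of "root_factor (- 1) i" "root_line (- \<i>) i"]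
      S[OF _ that, of 1] S[OF _ that, of "-1"] by (auto simp: root_vec_def root_factor_def split: if_splits)
  have coroot: "coroot i \<in> S" if "i \<le> 4" for i
    using brk[OF S[of 1 i] S[of "-1" i]] root_vec_opposite[of i 1] that by simp
  have sum: "root_line \<i> i + root_line (- \<i>) i \<in> S" if "i \<le> 4" for i
    using add line that by simp
  have "2 *\<^sub>C node 9 \<in> S" "2 *\<^sub>C node 8 \<in> S"
    using sum[of 0] sum[of 4] by (simp_all add: root_line_simps short_vec_def scl_double)
  then have 98: "node 9 \<in> S" "node 8 \<in> S" using unscl[of 2] by simp_all
  have node_torus: "node (2 * j - 1) \<in> S" if "torus j \<in> S" for j
    using unscl[of "- \<i>" "node (2 * j - 1)"] that by (simp add: torus_def)
  have t4: "torus 4 \<in> S" using coroot[of 4] unscl[of 2 "torus 4"] by (simp add: coroot_def)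
  have tj: "torus i \<in> S" if "torus (i + 1) \<in> S" "i \<in> {1..3}" for i
    using add[OF coroot[of i] that(1)] that(2) by (auto simp: coroot_def split: if_splits)
  have t3: "torus 3 \<in> S" using tj[of 3] t4 by simp
  have t2: "torus 2 \<in> S" using tj[of 2] t3 by simp
  have t1: "torus 1 \<in> S" using tj[of 1] t2 by (simp add: numeral_2_eq_2)
  have odd: "node 1 \<in> S" "node 3 \<in> S" "node 5 \<in> S" "node 7 \<in> S"
    using node_torus[OF t1] node_torus[OF t2] node_torus[OF t3] node_torus[OF t4] by simp_all
  have even: "node (2 * i) \<in> S" if i: "i \<in> {1..3}" and node: "node (2 * i + 1) \<in> S" "node (2 * i + 2) \<in> S" for i
  proof -
    let ?y = "node (2 * i) + brk (node (2 * i - 1)) (brk (node (2 * i + 1)) (node (2 * i)))"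
    let ?w = "brk (node (2 * i + 1)) (node (2 * i + 2))"
    have "2 *\<^sub>C ?y = root_line \<i> i + root_line (- \<i>) i"
      using i by (simp add: root_line_def long_vec_eq scl_double algebra_simps)
    then have y: "?y \<in> S" using sum[of i] unscl[of 2 ?y] i by simp
    have "2 * i - 1 \<in> {1..5}" using i by auto
    from node_chain4[OF this] have "chain4 (node (2 * i - 1)) (node (2 * i)) (node (2 * i + 1)) (node (2 * i + 2))"
      using i by simp
    from separate_middle[OF this, of \<i>] have "- node (2 * i) = brk ?w (brk ?w ?y)" by simp
    also have "\<dots> \<in> S" using y node by (intro brk)
    finally show ?thesis using unscl[of "-1"] by simp
  qed
  have 6: "node 6 \<in> S" using even[of 3] odd 98 by simp
  have 4: "node 4 \<in> S" using even[of 2] odd 6 by simp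
  have 2: "node 2 \<in> S" using even[of 1] odd 4 by (simp add: numeral_eq_Suc)
  have "k \<in> {1, 2, 3, 4, 5, 6, 7, 8, 9}" using k by auto
  then show ?thesis using odd 98 6 4 2 by auto
qed


section \<open>The relations of \<open>B\<^sub>4\<^sup>\<diamond>\<close> over a four-dimensional torus\<close>

text \<open>\<open>Torus j\<close> for \<open>j = 1, \<dots>, 4\<close> stands for \<open>H\<^sub>j\<close>. The weights of the root vectors on this torus are those
  found in the Berman algebra, so that \<open>to_berman\<close> is well defined.\<close>

datatype b4_gen = Torus nat | RootVec int nat

definition coroot_term :: "nat \<Rightarrow> b4_gen lie_term" where
  "coroot_term i = (if i = 0 then Scale 2 (Gen (Torus 2)) else if i = 4 then Scale 2 (Gen (Torus 4))
     else Add (Gen (Torus i)) (Scale (-1) (Gen (Torus (i + 1)))))"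

instantiation b4_gen :: lie_presentation
begin

definition relators_b4_gen :: "b4_gen lie_term set" where
  "relators_b4_gen =
    {Br (Gen (Torus j)) (Gen (Torus k)) | j k. j \<in> {1..4} \<and> k \<in> {1..4}} \<union>
    {Add (Br (Gen (Torus j)) (Gen (RootVec s i))) (Scale (- of_int (s * L_coeff i j)) (Gen (RootVec s i)))
      | j s i. j \<in> {1..4} \<and> s \<in> {1, -1} \<and> i \<le> 4} \<union>
    {Add (Br (Gen (RootVec s i)) (Gen (RootVec (- s) i))) (Scale (- of_int s) (coroot_term i))
      | s i. s \<in> {1, -1} \<and> i \<le> 4} \<union>
    {(Br (Gen (RootVec s i)) ^^ nat (max 1 (1 - s * t * B4_diamond i j))) (Gen (RootVec t j))
      | s i t j. s \<in> {1, -1} \<and> i \<le> 4 \<and> t \<in> {1, -1} \<and> j \<le> 4 \<and> (t, j) \<noteq> (- s, i)}"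

instance ..

end

lemma leval_pow: "leval M g ((Br u ^^ n) v) = (lbr M (leval M g u) ^^ n) (leval M g v)"
  by (induction n) simp_all

definition ptorus :: "nat \<Rightarrow> b4_gen plie" where "ptorus j = pgen (Torus j)"
definition proot :: "int \<Rightarrow> nat \<Rightarrow> b4_gen plie" where "proot s i = pgen (RootVec s i)"
definition pcoroot :: "nat \<Rightarrow> b4_gen plie" where "pcoroot i = leval type_lie pgen (coroot_term i)"

lemma pcoroot_eq: "pcoroot i = (if i = 0 then 2 *\<^sub>C ptorus 2 else if i = 4 then 2 *\<^sub>C ptorus 4 else ptorus i - ptorus (i + 1))"
  by (simp add: pcoroot_def ptorus_def coroot_term_def)

lemma ptorus_commute: "\<lbrakk>j \<in> {1..4}; k \<in> {1..4}\<rbrakk> \<Longrightarrow> brk (ptorus j) (ptorus k) = 0"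
  using leval_relator[of "Br (Gen (Torus j)) (Gen (Torus k))"]
  by (auto simp: relators_b4_gen_def ptorus_def)

lemma ptorus_proot:
  assumes "j \<in> {1..4}" "s \<in> {1, -1}" "i \<le> 4"
  shows "brk (ptorus j) (proot s i) = of_int (s * L_coeff i j) *\<^sub>C proot s i"
proof -
  have "Add (Br (Gen (Torus j)) (Gen (RootVec s i))) (Scale (- of_int (s * L_coeff i j)) (Gen (RootVec s i)))
      \<in> relators"
    using assms unfolding relators_b4_gen_def by blast
  from leval_relator[OF this] show ?thesis by (simp add: ptorus_def proot_def)
qed

lemma proot_opposite:
  assumes "s \<in> {1, -1}" "i \<le> 4"
  shows "brk (proot s i) (proot (- s) i) = of_int s *\<^sub>C pcoroot i"
proof -
  have "Add (Br (Gen (RootVec s i)) (Gen (RootVec (- s) i))) (Scale (- of_int s) (coroot_term i))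
      \<in> relators"
    using assms unfolding relators_b4_gen_def by blast
  from leval_relator[OF this] show ?thesis by (simp add: pcoroot_def proot_def)
qed

lemma proot_serre:
  assumes "s \<in> {1, -1}" "i \<le> 4" "t \<in> {1, -1}" "j \<le> 4" "(t, j) \<noteq> (- s, i)"
  shows "(brk (proot s i) ^^ nat (max 1 (1 - s * t * B4_diamond i j))) (proot t j) = 0"
proof -
  have "(Br (Gen (RootVec s i)) ^^ nat (max 1 (1 - s * t * B4_diamond i j))) (Gen (RootVec t j)) \<in> relators"
    using assms unfolding relators_b4_gen_def by blast
  from leval_relator[OF this] show ?thesis by (simp add: leval_pow proot_def)
qed

definition to_berman :: "b4_gen plie \<Rightarrow> berman_gen plie" where
  "to_berman = plie_eval type_lie (\<lambda>g. case g of Torus j \<Rightarrow> torus j | RootVec s i \<Rightarrow> root_vec s i)"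

lemma to_berman:
  "lie_hom type_lie type_lie to_berman" "to_berman (ptorus j) = torus j" "to_berman (proot s i) = root_vec s i"
proof -
  have *: "leval type_lie (\<lambda>g. case g of Torus j \<Rightarrow> torus j | RootVec s i \<Rightarrow> root_vec s i) r = 0"
    if "r \<in> relators" for r
    using that unfolding relators_b4_gen_def
    by (elim UnE CollectE exE conjE)
      (simp_all add: torus_commute torus_root_vec root_vec_opposite coroot_def coroot_term_def leval_pow root_vec_serre)
  show "lie_hom type_lie type_lie to_berman" "to_berman (ptorus j) = torus j" "to_berman (proot s i) = root_vec s i"
    unfolding to_berman_def ptorus_def proot_def
    by (subst plie_eval_hom | simp add: lie_algebra_type_lie *)+
qed

section \<open>The grading derivation and its semidirect product\<close>

fun degree :: "b4_gen \<Rightarrow> complex" where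
  "degree (Torus j) = 0"
| "degree (RootVec s i) = (if i = 0 then of_int s else 0)"

fun grading_term :: "b4_gen lie_term \<Rightarrow> b4_gen lie_term" where
  "grading_term (Gen g) = Scale (degree g) (Gen g)"
| "grading_term Zero = Zero"
| "grading_term (Add s t) = Add (grading_term s) (grading_term t)"
| "grading_term (Scale c s) = Scale c (grading_term s)"
| "grading_term (Br s t) = Add (Br (grading_term s) t) (Br s (grading_term t))"

lemma abs_plie_eq: "lie_eq s t \<Longrightarrow> abs_plie s = abs_plie t"
  by (simp add: plie.abs_eq_iff pres_lie)

text \<open>Applying the Leibniz rule to an axiom of Lie algebras yields a sum of instances of axioms.\<close>

lemma grading_term_lie_eq: "lie_eq s t \<Longrightarrow> abs_plie (grading_term s) = abs_plie (grading_term t)"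
proof (induction rule: lie_eq.induct)
  case (jacobi s t u)
  let ?a = "abs_plie s" and ?b = "abs_plie t" and ?c = "abs_plie u"
  let ?a' = "abs_plie (grading_term s)" and ?b' = "abs_plie (grading_term t)" and ?c' = "abs_plie (grading_term u)"
  let ?J = "\<lambda>x y z. brk x (brk y z) + (brk y (brk z x) + brk z (brk x y))"
  have "abs_plie (grading_term (Add (Br s (Br t u)) (Add (Br t (Br u s)) (Br u (Br s t)))))
      = ?J ?a' ?b ?c + ?J ?a ?b' ?c + ?J ?a ?b ?c'"
    by (simp add: brk_add_right ac_simps)
  then show ?case by (simp add: brk_jacobi)
next
  case (br_self s)
  show ?case using brk_anticomm[of "abs_plie (grading_term s)" "abs_plie s"] by simp
qed (simp_all add: abs_plie_eq scl_linear scl_add_left brk_linear algebra_simps)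

text \<open>All relators are homogeneous; for the Serre relators this is the case \<open>u = e\<^sub>\<alpha>\<close>, \<open>v = e\<^sub>\<beta>\<close>.\<close>

lemma grading_term_homogeneous:
  assumes "abs_plie (grading_term u) = c *\<^sub>C abs_plie u" "abs_plie (grading_term v) = d *\<^sub>C abs_plie v"
  shows "abs_plie (grading_term ((Br u ^^ n) v)) = (of_nat n * c + d) *\<^sub>C abs_plie ((Br u ^^ n) v)"
  using assms by (induction n) (simp_all add: brk_linear scl_add_left algebra_simps)

lemma abs_relator: "r \<in> relators \<Longrightarrow> abs_plie r = 0"
  by (simp add: abs_plie_eq_leval leval_relator)

lemma grading_term_relator:
  assumes "r \<in> relators"
  shows "abs_plie (grading_term r) = (0 :: b4_gen plie)"
proof -
  have "\<exists>c. abs_plie (grading_term r) = c *\<^sub>C abs_plie r"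
    using assms[unfolded relators_b4_gen_def]
  proof (elim UnE CollectE exE conjE)
    fix s t :: int and i j :: nat
    let ?t = "(Br (Gen (RootVec s i)) ^^ nat (max 1 (1 - s * t * B4_diamond i j))) (Gen (RootVec t j))"
    assume r: "r = ?t"
    show ?thesis unfolding r
      by (rule exI, rule grading_term_homogeneous[of _ "degree (RootVec s i)" _ "degree (RootVec t j)"]) simp_all
  next
    fix j i :: nat and s :: int
    assume "r = Add (Br (Gen (Torus j)) (Gen (RootVec s i))) (Scale (- of_int (s * L_coeff i j)) (Gen (RootVec s i)))"
    then show ?thesis
      by (intro exI[of _ "degree (RootVec s i)"]) (simp add: brk_linear scl_linear mult.commute)
  qed (auto intro!: exI[of _ 0] simp: brk_linear coroot_term_def)
  then show ?thesis using abs_relator[OF assms] by auto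
qed

lift_definition grading :: "b4_gen plie \<Rightarrow> b4_gen plie" is grading_term
  unfolding plie.abs_eq_iff[symmetric]
proof -
  fix s t :: "b4_gen lie_term"
  assume "abs_plie s = abs_plie t"
  then have "pres_eq s t" by (simp add: plie.abs_eq_iff)
  then show "abs_plie (grading_term s) = abs_plie (grading_term t)"
  proof (induction rule: pres_eq.induct)
    case (pres_Br s s' t t')
    then show ?case by (simp add: plie.abs_eq_iff[symmetric])
  qed (simp_all add: grading_term_lie_eq grading_term_relator)
qed

lemma grading_abs: "grading (abs_plie t) = abs_plie (grading_term t)"
  by (simp add: grading.abs_eq)

lemma grading_ptorus: "grading (ptorus j) = 0"
  using grading_abs[of "Gen (Torus j)"] by (simp add: ptorus_def)

lemma grading_proot: "grading (proot s i) = degree (RootVec s i) *\<^sub>C proot s i"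
  using grading_abs[of "Gen (RootVec s i)"] by (simp add: proot_def)

lemma grading_derivation:
  "grading (a + b) = grading a + grading b" "grading (c *\<^sub>C a) = c *\<^sub>C grading a"
  "grading (brk a b) = brk (grading a) b + brk a (grading b)"
proof -
  obtain s t where [simp]: "a = abs_plie s" "b = abs_plie t"
    by (metis Quotient3_abs_rep Quotient3_plie)
  show "grading (a + b) = grading a + grading b" "grading (c *\<^sub>C a) = c *\<^sub>C grading a"
    "grading (brk a b) = brk (grading a) b + brk a (grading b)"
    using grading_abs[of "Add s t"] grading_abs[of "Scale c s"] grading_abs[of "Br s t"]
    by (simp_all add: grading_abs)
qed

text \<open>The pair \<open>(a, \<alpha>)\<close> stands for \<open>a + \<alpha> D\<close>, with \<open>[D, a] = D a\<close>.\<close>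

definition semidirect :: "('a::complex_lie \<Rightarrow> 'a) \<Rightarrow> ('a \<times> complex) lie_struct" where
  "semidirect D = \<lparr>lcarrier = UNIV, lzero = (0, 0),
     ladd = (\<lambda>(a, \<alpha>) (b, \<beta>). (a + b, \<alpha> + \<beta>)),
     lscale = (\<lambda>c (a, \<alpha>). (c *\<^sub>C a, c * \<alpha>)),
     lbr = (\<lambda>(a, \<alpha>) (b, \<beta>). (brk a b + \<alpha> *\<^sub>C D b - \<beta> *\<^sub>C D a, 0))\<rparr>"

lemma semidirect_simps [simp]:
  "lcarrier (semidirect D) = UNIV"
  "lzero (semidirect D) = (0, 0)"
  "ladd (semidirect D) (a, \<alpha>) (b, \<beta>) = (a + b, \<alpha> + \<beta>)"
  "lscale (semidirect D) c (a, \<alpha>) = (c *\<^sub>C a, c * \<alpha>)"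
  "lbr (semidirect D) (a, \<alpha>) (b, \<beta>) = (brk a b + \<alpha> *\<^sub>C D b - \<beta> *\<^sub>C D a, 0)"
  by (simp_all add: semidirect_def)

lemma lie_algebra_semidirect:
  assumes D: "\<And>a b. D (a + b) = D a + D b" "\<And>c a. D (c *\<^sub>C a) = c *\<^sub>C D a"
    "\<And>a b. D (brk a b) = brk (D a) b + brk a (D b)"
  shows "lie_algebra (semidirect D)"
proof -
  have minus: "D (- a) = - D a" for a using D(2)[of "-1" a] by simp
  have diff: "D (a - b) = D a - D b" for a b using D(1)[of a "- b"] minus by simp
  have zero: "D 0 = 0" using D(2)[of 0 0] by simp
  note lin = D(1,2) minus diff zero
  have jac: "lbr (semidirect D) x (lbr (semidirect D) y z) \<oplus>\<^bsub>semidirect D\<^esub>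
      (lbr (semidirect D) y (lbr (semidirect D) z x) \<oplus>\<^bsub>semidirect D\<^esub> lbr (semidirect D) z (lbr (semidirect D) x y))
      = \<zero>\<^bsub>semidirect D\<^esub>" for x y z
  proof -
    obtain a \<alpha> b \<beta> c \<gamma> where [simp]: "x = (a, \<alpha>)" "y = (b, \<beta>)" "z = (c, \<gamma>)"
      by (metis surj_pair)
    have flip: "brk (D u) v = - brk v (D u)" for u v by (rule brk_anticomm)
    have "brk a (brk b c) = - brk b (brk c a) - brk c (brk a b)"
      using brk_jacobi[of a b c] by (simp add: eq_neg_iff_add_eq_0 algebra_simps)
    then show ?thesis
      by (simp add: brk_linear scl_linear lin D(3) flip mult.commute)
  qed
  show ?thesis
    by unfold_locales
      (auto simp: lminus_def scl_linear scl_add_left brk_linear lin algebra_simps jac)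
qed


section \<open>Quotients and the universal property of presentations\<close>

text \<open>The axioms of a Lie algebra are equations between terms, so they pass to every structure that is the image
  of the terms under a map compatible with the operations and with \<^const>\<open>lie_eq\<close>.\<close>

lemma lie_algebra_of_terms:
  assumes car: "lcarrier M = q ` {t. gens t \<subseteq> V}"
    and zero: "lzero M = q Zero"
    and add: "\<And>s t. \<lbrakk>gens s \<subseteq> V; gens t \<subseteq> V\<rbrakk> \<Longrightarrow> ladd M (q s) (q t) = q (Add s t)"
    and scale: "\<And>c s. gens s \<subseteq> V \<Longrightarrow> lscale M c (q s) = q (Scale c s)"
    and br: "\<And>s t. \<lbrakk>gens s \<subseteq> V; gens t \<subseteq> V\<rbrakk> \<Longrightarrow> lbr M (q s) (q t) = q (Br s t)"
    and resp: "\<And>s t. lie_eq s t \<Longrightarrow> gens s \<subseteq> V \<Longrightarrow> gens t \<subseteq> V \<Longrightarrow> q s = q t"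
  shows "lie_algebra M"
proof -
  note ops = zero add scale br
  show ?thesis
    by (unfold_locales; clarsimp simp: car ops lminus_def;
        ((rule imageI; simp) | (rule resp; (rule lie_eq.add_assoc lie_eq.add_commute lie_eq.add_zero
          lie_eq.add_inverse lie_eq.scale_add_right lie_eq.scale_add_left lie_eq.scale_scale
          lie_eq.scale_one lie_eq.br_add_left lie_eq.br_add_right lie_eq.br_scale_left
          lie_eq.br_scale_right lie_eq.br_self lie_eq.jacobi | simp))))
qed

definition lie_congruence :: "'a lie_struct \<Rightarrow> ('a \<times> 'a) set \<Rightarrow> bool" where
  "lie_congruence L r \<longleftrightarrow> equiv (lcarrier L) r \<and>
    (\<forall>x x' y y'. (x, x') \<in> r \<longrightarrow> (y, y') \<in> r \<longrightarrow>
      (ladd L x y, ladd L x' y') \<in> r \<and> (lbr L x y, lbr L x' y') \<in> r) \<and>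
    (\<forall>c x x'. (x, x') \<in> r \<longrightarrow> (lscale L c x, lscale L c x') \<in> r)"

lemma lie_quotient_ops:
  assumes r: "lie_congruence L r" and xy: "x \<in> lcarrier L" "y \<in> lcarrier L"
  shows "ladd (lie_quotient L r) (r `` {x}) (r `` {y}) = r `` {ladd L x y}"
    and "lbr (lie_quotient L r) (r `` {x}) (r `` {y}) = r `` {lbr L x y}"
    and "lscale (lie_quotient L r) c (r `` {x}) = r `` {lscale L c x}"
proof -
  have eq: "equiv (lcarrier L) r" using r by (simp add: lie_congruence_def)
  have cl: "r `` {a} = r `` {b}" if "(a, b) \<in> r" for a b
    using equiv_class_eq[OF eq that] .
  have refl: "x \<in> r `` {x}" "y \<in> r `` {y}" using xy equiv_class_self[OF eq] by auto
  have add: "r `` {ladd L x' y'} = r `` {ladd L x y}" and br: "r `` {lbr L x' y'} = r `` {lbr L x y}"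
    if "x' \<in> r `` {x}" "y' \<in> r `` {y}" for x' y'
  proof -
    have "(ladd L x y, ladd L x' y') \<in> r" "(lbr L x y, lbr L x' y') \<in> r"
      using that r unfolding lie_congruence_def by blast+
    then show "r `` {ladd L x' y'} = r `` {ladd L x y}" "r `` {lbr L x' y'} = r `` {lbr L x y}"
      using cl by blast+
  qed
  have scale: "r `` {lscale L c x'} = r `` {lscale L c x}" if "x' \<in> r `` {x}" for x'
  proof -
    have "(lscale L c x, lscale L c x') \<in> r"
      using that r unfolding lie_congruence_def by blast
    then show ?thesis using cl by blast
  qed
  show "ladd (lie_quotient L r) (r `` {x}) (r `` {y}) = r `` {ladd L x y}"
    unfolding lie_quotient_def lie_struct.simps
    by (intro UN_constant_eq[OF refl(1)] ballI UN_constant_eq[OF refl(2)] add br)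
  show "lbr (lie_quotient L r) (r `` {x}) (r `` {y}) = r `` {lbr L x y}"
    unfolding lie_quotient_def lie_struct.simps
    by (intro UN_constant_eq[OF refl(1)] ballI UN_constant_eq[OF refl(2)] add br)
  show "lscale (lie_quotient L r) c (r `` {x}) = r `` {lscale L c x}"
    unfolding lie_quotient_def lie_struct.simps
    by (intro UN_constant_eq[OF refl(1)] ballI scale)
qed

definition fcls :: "'x set \<Rightarrow> 'x lie_term \<Rightarrow> 'x lie_term set" where
  "fcls V t = lie_rel V `` {t}"

lemma lie_congruence_lie_rel: "lie_congruence (term_struct V) (lie_rel V)"
  unfolding lie_congruence_def
proof (intro conjI allI impI)
  show "equiv (lcarrier (term_struct V)) (lie_rel V)"
    by (rule equivI)
      (auto simp: refl_on_def sym_def trans_def lie_rel_def term_struct_def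
        intro: lie_eq.refl lie_eq.sym lie_eq.trans)
qed (auto simp: lie_rel_def term_struct_def intro: lie_eq.cong_Add lie_eq.cong_Br lie_eq.cong_Scale)

lemma free_lie_ops:
  "lzero (free_lie V) = fcls V Zero"
  "\<lbrakk>gens s \<subseteq> V; gens t \<subseteq> V\<rbrakk> \<Longrightarrow> ladd (free_lie V) (fcls V s) (fcls V t) = fcls V (Add s t)"
  "gens s \<subseteq> V \<Longrightarrow> lscale (free_lie V) c (fcls V s) = fcls V (Scale c s)"
  "\<lbrakk>gens s \<subseteq> V; gens t \<subseteq> V\<rbrakk> \<Longrightarrow> lbr (free_lie V) (fcls V s) (fcls V t) = fcls V (Br s t)"
  using lie_quotient_ops[OF lie_congruence_lie_rel, of s V t] lie_quotient_ops(3)[OF lie_congruence_lie_rel, of s V s]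
  unfolding free_lie_def fcls_def by (simp_all add: term_struct_def) (simp add: lie_quotient_def)

lemma free_lie_carrier: "lcarrier (free_lie V) = fcls V ` {t. gens t \<subseteq> V}"
  by (auto simp: free_lie_def lie_quotient_def quotient_def fcls_def term_struct_def)

lemma fcls_eq: "\<lbrakk>lie_eq s t; gens s \<subseteq> V; gens t \<subseteq> V\<rbrakk> \<Longrightarrow> fcls V s = fcls V t"
  unfolding fcls_def lie_rel_def by (auto intro: lie_eq.trans lie_eq.sym)

lemma fcls_eqD: "fcls V s = fcls V t \<Longrightarrow> gens s \<subseteq> V \<Longrightarrow> lie_eq s t"
  using lie_eq.refl by (auto simp: fcls_def lie_rel_def intro: lie_eq.sym)

lemma lie_algebra_free_lie: "lie_algebra (free_lie V)"
  by (rule lie_algebra_of_terms[of _ "fcls V" V]) (auto simp: free_lie_ops free_lie_carrier fcls_eq)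

lemma free_gen_eq: "free_gen V x = fcls V (Gen x)"
  by (simp add: free_gen_def fcls_def)

lemma free_lie_pow:
  "\<lbrakk>gens s \<subseteq> V; gens t \<subseteq> V\<rbrakk> \<Longrightarrow>
    (lbr (free_lie V) (fcls V s) ^^ n) (fcls V t) = fcls V ((Br s ^^ n) t) \<and> gens ((Br s ^^ n) t) \<subseteq> V"
  by (induction n) (auto simp: free_lie_ops)

lemma free_lie_minus:
  "\<lbrakk>gens s \<subseteq> V; gens t \<subseteq> V\<rbrakk> \<Longrightarrow>
    lminus (free_lie V) (fcls V s) (fcls V t) = fcls V (Add s (Scale (-1) t))"
  by (simp add: lminus_def free_lie_ops)

lemma lie_congruence_ideal_cong:
  fixes L :: "'a lie_struct"
  assumes "lie_algebra L" and I: "lie_ideal L I"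
  shows "lie_congruence L (ideal_cong L I)"
proof -
  interpret lie_algebra L by fact
  have sub: "\<And>x. x \<in> I \<Longrightarrow> x \<in> lcarrier L" and zero: "\<zero>\<^bsub>L\<^esub> \<in> I"
    and add: "\<And>x y. x \<in> I \<Longrightarrow> y \<in> I \<Longrightarrow> x \<oplus>\<^bsub>L\<^esub> y \<in> I"
    and scale: "\<And>c x. x \<in> I \<Longrightarrow> c \<odot>\<^bsub>L\<^esub> x \<in> I"
    and br: "\<And>x y. x \<in> lcarrier L \<Longrightarrow> y \<in> I \<Longrightarrow> lbr L x y \<in> I"
    using I by (auto simp: lie_ideal_def lie_subspace_def)
  have br': "lbr L y x \<in> I" if "x \<in> lcarrier L" "y \<in> I" for x y
    using that scale[OF br[OF that], of "-1"] by (simp add: bracket_anticomm[of x y] sub)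
  have sym: "y \<ominus>\<^bsub>L\<^esub> x = (-1) \<odot>\<^bsub>L\<^esub> (x \<ominus>\<^bsub>L\<^esub> y)" if "x \<in> lcarrier L" "y \<in> lcarrier L" for x y
    using that by (simp add: lminus_def scale_add_right scale_scale scale_one add_commute)
  have trans: "x \<ominus>\<^bsub>L\<^esub> z = (x \<ominus>\<^bsub>L\<^esub> y) \<oplus>\<^bsub>L\<^esub> (y \<ominus>\<^bsub>L\<^esub> z)"
    if "x \<in> lcarrier L" "y \<in> lcarrier L" "z \<in> lcarrier L" for x y z
    using that by (simp add: lminus_def add_assoc add_neg_cancel)
  have diff_add: "(x \<oplus>\<^bsub>L\<^esub> y) \<ominus>\<^bsub>L\<^esub> (x' \<oplus>\<^bsub>L\<^esub> y') = (x \<ominus>\<^bsub>L\<^esub> x') \<oplus>\<^bsub>L\<^esub> (y \<ominus>\<^bsub>L\<^esub> y')"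
    if "x \<in> lcarrier L" "y \<in> lcarrier L" "x' \<in> lcarrier L" "y' \<in> lcarrier L" for x y x' y'
    using that by (simp add: lminus_def scale_add_right ac)
  have diff_scale: "c \<odot>\<^bsub>L\<^esub> x \<ominus>\<^bsub>L\<^esub> c \<odot>\<^bsub>L\<^esub> x' = c \<odot>\<^bsub>L\<^esub> (x \<ominus>\<^bsub>L\<^esub> x')"
    if "x \<in> lcarrier L" "x' \<in> lcarrier L" for c x x'
    using that by (simp add: lminus_def scale_add_right scale_scale)
  have diff_br: "lbr L x y \<ominus>\<^bsub>L\<^esub> lbr L x' y' = lbr L (x \<ominus>\<^bsub>L\<^esub> x') y \<oplus>\<^bsub>L\<^esub> lbr L x' (y \<ominus>\<^bsub>L\<^esub> y')"
    if "x \<in> lcarrier L" "y \<in> lcarrier L" "x' \<in> lcarrier L" "y' \<in> lcarrier L" for x y x' y'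
    using that by (simp add: lminus_def bracket_linear add_assoc add_neg_cancel)
  show ?thesis
    unfolding lie_congruence_def
  proof (intro conjI allI impI)
    show "equiv (lcarrier L) (ideal_cong L I)"
    proof (rule equivI)
      show "ideal_cong L I \<subseteq> lcarrier L \<times> lcarrier L" by (auto simp: ideal_cong_def)
      show "refl_on (lcarrier L) (ideal_cong L I)"
        by (auto simp: refl_on_def ideal_cong_def add_inverse zero)
      show "sym (ideal_cong L I)" 
        by (auto simp: sym_def ideal_cong_def) (subst sym, simp_all add: scale)
      show "Relation.trans (ideal_cong L I)"
        by (auto simp: trans_def ideal_cong_def intro: trans[THEN ssubst] add)
    qed
  next
    fix x x' y y' c
    assume *: "(x, x') \<in> ideal_cong L I" "(y, y') \<in> ideal_cong L I"
    show "(x \<oplus>\<^bsub>L\<^esub> y, x' \<oplus>\<^bsub>L\<^esub> y') \<in> ideal_cong L I"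
      using * by (auto simp: ideal_cong_def diff_add add)
    show "(lbr L x y, lbr L x' y') \<in> ideal_cong L I"
      using * by (auto simp: ideal_cong_def diff_br add br br')
  qed (auto simp: ideal_cong_def diff_scale scale)
qed

lemma lie_ideal_generated:
  assumes "lie_algebra L" "S \<subseteq> lcarrier L"
  shows "lie_ideal L (ideal_generated L S)" "S \<subseteq> ideal_generated L S"
    and "\<lbrakk>lie_ideal L J; S \<subseteq> J\<rbrakk> \<Longrightarrow> ideal_generated L S \<subseteq> J"
proof -
  interpret lie_algebra L by fact
  have top: "lie_ideal L (lcarrier L)"
    by (auto simp: lie_ideal_def lie_subspace_def)
  have "ideal_generated L S \<subseteq> lcarrier L"
    using top assms(2) unfolding ideal_generated_def by (intro Inter_lower) simp
  then show "lie_ideal L (ideal_generated L S)"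
    by (auto simp: ideal_generated_def lie_ideal_def lie_subspace_def)
qed (auto simp: ideal_generated_def)

lemma lie_subalgebra_generated:
  assumes "lie_algebra L" "S \<subseteq> lcarrier L"
  shows "lie_subalgebra L (subalgebra_generated L S)" "S \<subseteq> subalgebra_generated L S"
    and "\<lbrakk>lie_subalgebra L J; S \<subseteq> J\<rbrakk> \<Longrightarrow> subalgebra_generated L S \<subseteq> J"
proof -
  interpret lie_algebra L by fact
  have top: "lie_subalgebra L (lcarrier L)"
    by (auto simp: lie_subalgebra_def lie_subspace_def)
  have "subalgebra_generated L S \<subseteq> lcarrier L"
    using top assms(2) unfolding subalgebra_generated_def by (intro Inter_lower) simp
  then show "lie_subalgebra L (subalgebra_generated L S)"
    by (auto simp: subalgebra_generated_def lie_subalgebra_def lie_subspace_def)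
qed (auto simp: subalgebra_generated_def)

definition pcls :: "'x set \<Rightarrow> 'x lie_term set set \<Rightarrow> 'x lie_term \<Rightarrow> 'x lie_term set set" where
  "pcls V rels t = ideal_cong (free_lie V) (ideal_generated (free_lie V) rels) `` {fcls V t}"

lemma presented_gen_eq: "presented_gen V rels x = pcls V rels (Gen x)"
  by (simp add: presented_gen_def pcls_def free_gen_eq)

text \<open>Relators given by terms rather than by classes of terms, so that they can be evaluated.\<close>

locale lie_relations =
  fixes V :: "'x set" and R :: "'x lie_term set"
  assumes gens_relations: "r \<in> R \<Longrightarrow> gens r \<subseteq> V"
begin

abbreviation "P \<equiv> presented_lie V (fcls V ` R)"
abbreviation "cls \<equiv> pcls V (fcls V ` R)"

lemma ideal: "lie_ideal (free_lie V) (ideal_generated (free_lie V) (fcls V ` R))"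
  by (rule lie_ideal_generated[OF lie_algebra_free_lie])
    (auto simp: free_lie_carrier dest: gens_relations)

lemma congruence:
  "lie_congruence (free_lie V) (ideal_cong (free_lie V) (ideal_generated (free_lie V) (fcls V ` R)))"
  by (rule lie_congruence_ideal_cong[OF lie_algebra_free_lie ideal])

lemma carrier_P: "lcarrier P = cls ` {t. gens t \<subseteq> V}"
  by (auto simp: presented_lie_def lie_quotient_def quotient_def pcls_def free_lie_carrier)

lemma ops:
  "lzero P = cls Zero"
  "\<lbrakk>gens s \<subseteq> V; gens t \<subseteq> V\<rbrakk> \<Longrightarrow> ladd P (cls s) (cls t) = cls (Add s t)"
  "gens s \<subseteq> V \<Longrightarrow> lscale P c (cls s) = cls (Scale c s)"
  "\<lbrakk>gens s \<subseteq> V; gens t \<subseteq> V\<rbrakk> \<Longrightarrow> lbr P (cls s) (cls t) = cls (Br s t)"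
proof -
  show "lzero P = cls Zero"
    by (simp add: presented_lie_def lie_quotient_def pcls_def free_lie_ops)
  have mem: "gens u \<subseteq> V \<Longrightarrow> fcls V u \<in> lcarrier (free_lie V)" for u
    by (auto simp: free_lie_carrier)
  show "\<lbrakk>gens s \<subseteq> V; gens t \<subseteq> V\<rbrakk> \<Longrightarrow> ladd P (cls s) (cls t) = cls (Add s t)"
    "gens s \<subseteq> V \<Longrightarrow> lscale P c (cls s) = cls (Scale c s)"
    "\<lbrakk>gens s \<subseteq> V; gens t \<subseteq> V\<rbrakk> \<Longrightarrow> lbr P (cls s) (cls t) = cls (Br s t)"
    unfolding presented_lie_def pcls_def
    using lie_quotient_ops(3)[OF congruence, of "fcls V s" "fcls V s"]
    by (simp_all add: lie_quotient_ops(1,2)[OF congruence] mem free_lie_ops)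
qed

lemma cls_eq: "\<lbrakk>lie_eq s t; gens s \<subseteq> V; gens t \<subseteq> V\<rbrakk> \<Longrightarrow> cls s = cls t"
  using fcls_eq[of s t V] by (simp add: pcls_def)

lemma lie_algebra_P: "lie_algebra P"
  by (rule lie_algebra_of_terms[of _ cls V]) (simp_all add: ops carrier_P cls_eq)

lemma cls_eq_leval:
  "gens t \<subseteq> V \<Longrightarrow> cls t = leval P (\<lambda>x. cls (Gen x)) t"
  by (induction t) (auto simp: ops[symmetric])

lemma cls_relation: "r \<in> R \<Longrightarrow> cls r = lzero P"
proof -
  assume r: "r \<in> R"
  interpret F: lie_algebra "free_lie V" by (rule lie_algebra_free_lie)
  let ?I = "ideal_generated (free_lie V) (fcls V ` R)"
  have mem: "gens u \<subseteq> V \<Longrightarrow> fcls V u \<in> lcarrier (free_lie V)" for u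
    by (auto simp: free_lie_carrier)
  have "fcls V r \<in> ?I"
    using r lie_ideal_generated(2)[OF lie_algebra_free_lie, of "fcls V ` R" V] mem gens_relations by blast
  then have "(fcls V r, fcls V Zero) \<in> ideal_cong (free_lie V) ?I"
    using mem[of r] gens_relations[OF r] mem[of Zero] unfolding ideal_cong_def
    by (simp add: lminus_def free_lie_ops(1)[symmetric] F.scale_zero_right F.add_zero)
  then show ?thesis
    unfolding ops(1) pcls_def using congruence by (auto simp: lie_congruence_def intro!: equiv_class_eq)
qed

lemma gen_closed: "x \<in> V \<Longrightarrow> cls (Gen x) \<in> lcarrier P"
  by (auto simp: carrier_P)

text \<open>The terms that evaluate to zero form an ideal of the free Lie algebra containing the relators.\<close>

lemma universal:
  assumes M: "lie_algebra M" and g: "\<And>x. x \<in> V \<Longrightarrow> g x \<in> lcarrier M"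
    and rel: "\<And>r. r \<in> R \<Longrightarrow> leval M g r = lzero M"
  obtains \<phi> where "lie_hom P M \<phi>" "\<And>x. x \<in> V \<Longrightarrow> \<phi> (cls (Gen x)) = g x"
proof -
  interpret M: lie_algebra M by fact
  interpret F: lie_algebra "free_lie V" by (rule lie_algebra_free_lie)
  interpret P: lie_algebra P by (rule lie_algebra_P)
  \<comment> \<open>extended by zero, since a derivation of an equality may pass through other generators\<close>
  define g' where "g' x = (if x \<in> V then g x else lzero M)" for x
  have g': "g' x \<in> lcarrier M" for x by (simp add: g'_def g)
  note [simp] = M.leval_closed[OF g']
  have gg': "leval M g' t = leval M g t" if "gens t \<subseteq> V" for t
    using that by (intro leval_cong) (auto simp: g'_def)
  define J where "J = fcls V ` {t. gens t \<subseteq> V \<and> leval M g' t = lzero M}"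
  have J: "t \<in> J \<Longrightarrow> \<exists>s. t = fcls V s \<and> gens s \<subseteq> V \<and> leval M g' s = lzero M" for t
    by (auto simp: J_def)
  have fJ: "fcls V t \<in> J" if "gens t \<subseteq> V" "leval M g' t = lzero M" for t
    using that by (auto simp: J_def)
  have "lie_ideal (free_lie V) J"
    unfolding lie_ideal_def lie_subspace_def
  proof (intro conjI ballI allI)
    show "J \<subseteq> lcarrier (free_lie V)" by (auto simp: J_def free_lie_carrier)
    show "lzero (free_lie V) \<in> J" by (simp add: free_lie_ops fJ)
    show "ladd (free_lie V) x y \<in> J" if xy: "x \<in> J" "y \<in> J" for x y
      using J[OF xy(1)] J[OF xy(2)] by (elim exE conjE) (simp add: free_lie_ops M.add_zero fJ)
    show "lscale (free_lie V) c x \<in> J" if x: "x \<in> J" for c x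
      using J[OF x] by (elim exE conjE) (simp add: free_lie_ops M.scale_zero_right fJ)
    show "lbr (free_lie V) x y \<in> J" if xy: "x \<in> lcarrier (free_lie V)" "y \<in> J" for x y
      using J[OF xy(2)] xy(1) unfolding free_lie_carrier
      by (elim exE conjE imageE CollectE) (simp add: free_lie_ops M.bracket_zero_right fJ)
  qed
  moreover have "fcls V ` R \<subseteq> J"
    using rel gg' gens_relations by (auto intro!: fJ)
  ultimately have gen: "ideal_generated (free_lie V) (fcls V ` R) \<subseteq> J"
    by (intro lie_ideal_generated(3)[OF lie_algebra_free_lie]) (auto simp: free_lie_carrier dest: gens_relations)
  have resp: "leval M g' s = leval M g' t" if st: "gens s \<subseteq> V" "gens t \<subseteq> V" and eq: "cls s = cls t" for s t
  proof -
    have "(fcls V s, fcls V t) \<in> ideal_cong (free_lie V) (ideal_generated (free_lie V) (fcls V ` R))"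
      using eq congruence st unfolding pcls_def lie_congruence_def
      by (subst eq_equiv_class_iff[symmetric]) (auto simp: free_lie_carrier)
    then have "fcls V (Add s (Scale (-1) t)) \<in> J"
      using gen st by (auto simp: ideal_cong_def free_lie_minus)
    then obtain u where u: "fcls V (Add s (Scale (-1) t)) = fcls V u" "leval M g' u = lzero M"
      by (auto simp: J_def)
    then have "leval M g' (Add s (Scale (-1) t)) = lzero M"
      using M.leval_lie_eq[OF fcls_eqD[OF u(1)] g'] st by simp
    then show ?thesis
      using M.eq_iff_minus[of "leval M g' s" "leval M g' t"] by (simp add: lminus_def)
  qed
  define \<phi> where "\<phi> c = leval M g' (SOME t. gens t \<subseteq> V \<and> cls t = c)" for c
  have \<phi>: "\<phi> (cls t) = leval M g' t" if "gens t \<subseteq> V" for t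
  proof -
    have "gens (SOME u. gens u \<subseteq> V \<and> cls u = cls t) \<subseteq> V \<and> cls (SOME u. gens u \<subseteq> V \<and> cls u = cls t) = cls t"
      using that by (intro someI_ex[of "\<lambda>u. gens u \<subseteq> V \<and> cls u = cls t"]) auto
    then show ?thesis unfolding \<phi>_def using that by (intro resp) auto
  qed
  have "lie_hom P M \<phi>"
    by unfold_locales (auto simp: carrier_P ops \<phi>)
  then show ?thesis using that[of \<phi>] by (simp add: \<phi> g'_def)
qed

lemma hom_unique:
  assumes "lie_hom P M f" "lie_hom P M g" "\<And>x. x \<in> V \<Longrightarrow> f (cls (Gen x)) = g (cls (Gen x))"
    and a: "a \<in> lcarrier P"
  shows "f a = g a"
proof -
  interpret f: lie_hom P M f by fact
  interpret g: lie_hom P M g by fact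
  obtain t where t: "gens t \<subseteq> V" "a = leval P (\<lambda>x. cls (Gen x)) t"
    using a cls_eq_leval by (auto simp: carrier_P)
  then have "f a = leval M (\<lambda>x. f (cls (Gen x))) t"
    by (auto intro!: f.hom_leval gen_closed)
  also have "\<dots> = leval M (\<lambda>x. g (cls (Gen x))) t"
    using t(1) assms(3) by (intro leval_cong) auto
  also have "\<dots> = g a"
    using t by (auto intro!: g.hom_leval[symmetric] gen_closed)
  finally show ?thesis .
qed

end


section \<open>The Chevalley subalgebra of the GIM-Lie algebra\<close>

definition cart_linear_terms :: "'h::ab_group_add root_basis \<Rightarrow> 'h rb_gen lie_term set" where
  "cart_linear_terms R =
    {Add (Gen (Cart (h + h'))) (Scale (-1) (Add (Gen (Cart h)) (Gen (Cart h')))) | h h'. True} \<union>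
    {Add (Gen (Cart (rb_scale R c h))) (Scale (-1) (Scale c (Gen (Cart h)))) | c h. True}"

definition gim_terms :: "(nat \<Rightarrow> nat \<Rightarrow> int) \<Rightarrow> 'h::ab_group_add root_basis \<Rightarrow> 'h rb_gen lie_term set" where
  "gim_terms A R = (let I = rb_index R in
    cart_linear_terms R \<union>
    {Br (Gen (Cart h)) (Gen (Cart h')) | h h'. True} \<union>
    {Add (Br (Gen (Cart h)) (Gen (Root s i))) (Scale (-1) (Scale (of_int s * rb_root R i h) (Gen (Root s i))))
      | h s i. s \<in> {1, -1} \<and> i \<in> I} \<union>
    {Add (Br (Gen (Root s i)) (Gen (Root (- s) i))) (Scale (-1) (Gen (Cart (rb_scale R (of_int s) (rb_coroot R i)))))
      | s i. s \<in> {1, -1} \<and> i \<in> I} \<union>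
    {(Br (Gen (Root s i)) ^^ nat (max 1 (1 - s * t * A i j))) (Gen (Root t j))
      | s i t j. s \<in> {1, -1} \<and> i \<in> I \<and> t \<in> {1, -1} \<and> j \<in> I \<and> (t, j) \<noteq> (- s, i)})"

lemma image_setcompr:
  "q ` {f a b | a b. P a b} = {q (f a b) | a b. P a b}"
  "q ` {f' a b c | a b c. P' a b c} = {q (f' a b c) | a b c. P' a b c}"
  "q ` {f'' a b c d | a b c d. P'' a b c d} = {q (f'' a b c d) | a b c d. P'' a b c d}"
  by blast+

lemma rb_gens_iff [simp]:
  "Cart h \<in> rb_gens R" "Root s i \<in> rb_gens R \<longleftrightarrow> s \<in> {1, -1} \<and> i \<in> rb_index R"
  by (auto simp: rb_gens_def)

lemma cart_linear_relations_eq: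
  "cart_linear_relations R = fcls (rb_gens R) ` cart_linear_terms R"
  unfolding cart_linear_relations_def cart_linear_terms_def Let_def image_Un image_setcompr
  by (simp add: free_gen_eq free_lie_ops free_lie_minus)

lemma gim_relations_eq: "gim_relations A R = fcls (rb_gens R) ` gim_terms A R"
proof -
  let ?V = "rb_gens R"
  have g: "gens (Gen (Root s i)) \<subseteq> ?V" if "s \<in> {1, -1} \<and> i \<in> rb_index R" for s i
    using that by simp
  show ?thesis
    unfolding gim_relations_def gim_terms_def Let_def image_Un image_setcompr cart_linear_relations_eq
      free_gen_eq
    by (intro arg_cong2[of _ _ _ _ "(\<union>)"] HOL.refl Collect_cong ex_cong1 rev_conj_cong)
      (auto simp: free_lie_ops free_lie_minus free_lie_pow)
qed

lemma gens_pow: "gens s \<subseteq> V \<Longrightarrow> gens t \<subseteq> V \<Longrightarrow> gens ((Br s ^^ n) t) \<subseteq> V"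
  by (induction n) auto

lemma gens_gim_terms: "r \<in> gim_terms A R \<Longrightarrow> gens r \<subseteq> rb_gens R"
  unfolding gim_terms_def cart_linear_terms_def Let_def
  by (elim UnE CollectE exE conjE) (simp_all add: gens_pow, auto)

interpretation gim: lie_relations "rb_gens R" "gim_terms A R" for A R
  by unfold_locales (rule gens_gim_terms)

lemma gim_eq: "gim A R = presented_lie (rb_gens R) (fcls (rb_gens R) ` gim_terms A R)"
  by (simp add: gim_def gim_relations_eq)

lemma gim_gens_eq:
  "gim_E A R i = pcls (rb_gens R) (fcls (rb_gens R) ` gim_terms A R) (Gen (Root 1 i))"
  "gim_F A R i = pcls (rb_gens R) (fcls (rb_gens R) ` gim_terms A R) (Gen (Root (- 1) i))"
  "gim_H A R i = pcls (rb_gens R) (fcls (rb_gens R) ` gim_terms A R) (Gen (Cart (rb_coroot R i)))"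
  by (simp_all add: gim_E_def gim_F_def gim_H_def presented_gen_eq gim_relations_eq)

lemma lie_algebra_restrict:
  assumes "lie_algebra L" "lie_subalgebra L S"
  shows "lie_algebra (lie_restrict L S)"
proof -
  interpret lie_algebra L by fact
  have sub: "\<And>x. x \<in> S \<Longrightarrow> x \<in> lcarrier L" and "\<zero>\<^bsub>L\<^esub> \<in> S"
    "\<And>x y. x \<in> S \<Longrightarrow> y \<in> S \<Longrightarrow> x \<oplus>\<^bsub>L\<^esub> y \<in> S" "\<And>c x. x \<in> S \<Longrightarrow> c \<odot>\<^bsub>L\<^esub> x \<in> S"
    "\<And>x y. x \<in> S \<Longrightarrow> y \<in> S \<Longrightarrow> lbr L x y \<in> S"
    using assms(2) by (auto simp: lie_subalgebra_def lie_subspace_def)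
  moreover have "x \<oplus>\<^bsub>L\<^esub> (-1) \<odot>\<^bsub>L\<^esub> x = \<zero>\<^bsub>L\<^esub>" if "x \<in> S" for x
    using that by (simp add: add_neg sub)
  ultimately show ?thesis
    by unfold_locales
      (simp_all add: lie_restrict_def lminus_def ac add_zero scale_add_right scale_add_left
        scale_scale scale_one bracket_linear bracket_self jacobi)
qed

lemma lie_restrict_simps [simp]:
  "lcarrier (lie_restrict L S) = S" "lzero (lie_restrict L S) = lzero L"
  "ladd (lie_restrict L S) = ladd L" "lscale (lie_restrict L S) = lscale L"
  "lbr (lie_restrict L S) = lbr L" "lminus (lie_restrict L S) = lminus L"
  by (simp_all add: lie_restrict_def lminus_def fun_eq_iff)

lemma lie_subalgebra_image:
  assumes "lie_hom L M f"
  shows "lie_subalgebra M (f ` lcarrier L)"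
proof -
  interpret lie_hom L M f by fact
  show ?thesis
    unfolding lie_subalgebra_def lie_subspace_def
    by (auto simp: hom_zero[symmetric] hom_add[symmetric] hom_scale[symmetric] hom_bracket[symmetric])
qed

context
  fixes R :: "'h::ab_group_add root_basis"
  assumes R: "is_free_realisation {0..4} B4_diamond R"
begin

lemma root_linear:
  assumes "i \<le> 4"
  shows "rb_root R i (h + h') = rb_root R i h + rb_root R i h'"
    and "rb_root R i (rb_scale R c h) = c * rb_root R i h"
proof -
  have "Vector_Spaces.linear (rb_scale R) (*) (rb_root R i)"
    using R assms by (auto simp: is_free_realisation_def is_free_root_basis_def is_root_basis_def)
  then interpret l: Vector_Spaces.linear "rb_scale R" "(*)" "rb_root R i" .
  show "rb_root R i (h + h') = rb_root R i h + rb_root R i h'" by (rule l.add)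
  show "rb_root R i (rb_scale R c h) = c * rb_root R i h" by (rule l.scale)
qed

lemma index_R: "rb_index R = {0..4}"
  using R by (simp add: is_free_realisation_def)

lemma root_coroot: "i \<le> 4 \<Longrightarrow> j \<le> 4 \<Longrightarrow> rb_root R j (rb_coroot R i) = of_int (B4_diamond i j)"
  using R by (simp add: is_free_realisation_def)

text \<open>The value of \<open>L\<^sub>j = \<gamma>\<^sub>j + \<dots> + \<gamma>\<^sub>4\<close>. An element \<open>h\<close> acts on the root vectors like \<open>\<Sum>\<^sub>j L\<^sub>j(h) H\<^sub>j\<close> plus a multiple of the
  grading; as \<open>E\<^sub>0\<close> has weight \<open>L\<^sub>2\<close>, the multiple is \<open>\<gamma>\<^sub>0(h) - L\<^sub>2(h)\<close>.\<close>

definition L_value :: "nat \<Rightarrow> 'h \<Rightarrow> complex" where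
  "L_value j h = (\<Sum>k=j..4. rb_root R k h)"

definition torus_part :: "'h \<Rightarrow> b4_gen plie" where
  "torus_part h = L_value 1 h *\<^sub>C ptorus 1 + L_value 2 h *\<^sub>C ptorus 2 + L_value 3 h *\<^sub>C ptorus 3 + L_value 4 h *\<^sub>C ptorus 4"

definition grading_part :: "'h \<Rightarrow> complex" where
  "grading_part h = rb_root R 0 h - L_value 2 h"

lemma L_value_simps:
  "L_value (Suc 0) h = rb_root R 1 h + rb_root R 2 h + rb_root R 3 h + rb_root R 4 h"
  "L_value 2 h = rb_root R 2 h + rb_root R 3 h + rb_root R 4 h"
  "L_value 3 h = rb_root R 3 h + rb_root R 4 h"
  "L_value 4 h = rb_root R 4 h"
proof -
  have "{1..4::nat} = {1, 2, 3, 4}" "{2..4::nat} = {2, 3, 4}" "{3..4::nat} = {3, 4}" by auto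
  then show "L_value (Suc 0) h = rb_root R 1 h + rb_root R 2 h + rb_root R 3 h + rb_root R 4 h"
    "L_value 2 h = rb_root R 2 h + rb_root R 3 h + rb_root R 4 h"
    "L_value 3 h = rb_root R 3 h + rb_root R 4 h"
    "L_value 4 h = rb_root R 4 h"
    by (simp_all add: L_value_def)
qed

lemma parts_linear:
  "torus_part (h + h') = torus_part h + torus_part h'"
  "torus_part (rb_scale R c h) = c *\<^sub>C torus_part h"
  "grading_part (h + h') = grading_part h + grading_part h'"
  "grading_part (rb_scale R c h) = c * grading_part h"
  by (simp_all add: torus_part_def grading_part_def L_value_simps root_linear scl_add_left scl_add_right
      algebra_simps)

text \<open>The grading part vanishes because column \<open>0\<close> of \<open>B\<^sub>4\<^sup>\<diamond>\<close> is the sum of the columns \<open>2\<close>, \<open>3\<close> and \<open>4\<close>.\<close>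

lemma parts_coroot:
  assumes "i \<le> 4"
  shows "torus_part (rb_coroot R i) = pcoroot i" "grading_part (rb_coroot R i) = 0"
  using assms unfolding le_4_iff
  by (auto simp: torus_part_def grading_part_def L_value_simps root_coroot B4_diamond_def pcoroot_eq
      numeral_2_eq_2[symmetric])

lemma grading_torus_part: "grading (torus_part h) = 0"
  by (simp add: torus_part_def grading_derivation grading_ptorus)

lemma torus_part_commute: "brk (torus_part h) (torus_part h') = 0"
  by (simp add: torus_part_def brk_linear ptorus_commute)

lemma torus_part_proot:
  assumes "s \<in> {1, -1}" "i \<le> 4"
  shows "brk (torus_part h) (proot s i) + grading_part h *\<^sub>C grading (proot s i) = (of_int s * rb_root R i h) *\<^sub>C proot s i"
proof -
  have "brk (torus_part h) (proot s i) + grading_part h *\<^sub>C grading (proot s i) =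
    (L_value 1 h * of_int (s * L_coeff i 1) + L_value 2 h * of_int (s * L_coeff i 2) +
     L_value 3 h * of_int (s * L_coeff i 3) + L_value 4 h * of_int (s * L_coeff i 4) +
     grading_part h * degree (RootVec s i)) *\<^sub>C proot s i"
    using assms by (simp add: torus_part_def brk_linear ptorus_proot grading_proot scl_add_left del: of_int_mult)
  also have "\<dots> = (of_int s * rb_root R i h) *\<^sub>C proot s i"
    using assms(2) unfolding le_4_iff
    by (elim disjE) (simp_all add: L_coeff_def L_value_simps grading_part_def algebra_simps)
  finally show ?thesis .
qed

lemma lie_algebra_target: "lie_algebra (semidirect grading)"
  by (rule lie_algebra_semidirect) (rule grading_derivation)+

lemma semidirect_pow:
  "(lbr (semidirect D) (a, 0) ^^ n) (b, 0) = ((brk a ^^ n) b, 0)"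
  by (induction n) simp_all

lemma gim_to_semidirect:
  obtains \<Phi> where "lie_hom (gim B4_diamond R) (semidirect grading) \<Phi>"
    "\<And>i. i \<le> 4 \<Longrightarrow> \<Phi> (gim_E B4_diamond R i) = (proot 1 i, 0)"
    "\<And>i. i \<le> 4 \<Longrightarrow> \<Phi> (gim_F B4_diamond R i) = (proot (- 1) i, 0)"
    "\<And>i. i \<le> 4 \<Longrightarrow> \<Phi> (gim_H B4_diamond R i) = (pcoroot i, 0)"
proof -
  define g where "g = case_rb_gen (\<lambda>h. (torus_part h, grading_part h)) (\<lambda>s i. (proot s i, 0))"
  have "leval (semidirect grading) g r = lzero (semidirect grading)"
    if "r \<in> gim_terms B4_diamond R" for r
    using that unfolding gim_terms_def cart_linear_terms_def Let_def index_R
    by (elim UnE CollectE exE conjE)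
      (simp_all add: g_def parts_linear torus_part_commute grading_torus_part torus_part_proot
        proot_opposite parts_coroot leval_pow semidirect_pow proot_serre)
  then obtain \<Phi> where "lie_hom (gim B4_diamond R) (semidirect grading) \<Phi>"
    "\<And>x. x \<in> rb_gens R \<Longrightarrow> \<Phi> (pcls (rb_gens R) (fcls (rb_gens R) ` gim_terms B4_diamond R) (Gen x)) = g x"
    using gim.universal[OF lie_algebra_target, of R g B4_diamond] by (auto simp: gim_eq)
  then show ?thesis
    using that[of \<Phi>] by (simp add: gim_gens_eq index_R g_def parts_coroot)
qed

text \<open>The Chevalley generators go to elements with second component zero, so the subalgebra they generate
  does, too; there the first projection respects the bracket.\<close>

lemma gim_chevalley_to_berman:
  obtains \<psi> where "lie_hom (gim_chevalley B4_diamond R) type_lie \<psi>"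
    "\<And>i. i \<le> 4 \<Longrightarrow> \<psi> (gim_E B4_diamond R i) = root_vec 1 i"
    "\<And>i. i \<le> 4 \<Longrightarrow> \<psi> (gim_F B4_diamond R i) = root_vec (- 1) i"
    "\<And>i. i \<le> 4 \<Longrightarrow> \<psi> (gim_H B4_diamond R i) = coroot i"
    "\<And>k. k \<in> {1..9} \<Longrightarrow> node k \<in> \<psi> ` lcarrier (gim_chevalley B4_diamond R)"
proof -
  let ?G = "gim B4_diamond R"
  let ?C = "gim_E B4_diamond R ` rb_index R \<union> gim_F B4_diamond R ` rb_index R \<union> gim_H B4_diamond R ` rb_index R"
  let ?S = "subalgebra_generated ?G ?C"
  obtain \<Phi> where \<Phi>: "lie_hom ?G (semidirect grading) \<Phi>"
    "\<And>i. i \<le> 4 \<Longrightarrow> \<Phi> (gim_E B4_diamond R i) = (proot 1 i, 0)"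
    "\<And>i. i \<le> 4 \<Longrightarrow> \<Phi> (gim_F B4_diamond R i) = (proot (- 1) i, 0)"
    "\<And>i. i \<le> 4 \<Longrightarrow> \<Phi> (gim_H B4_diamond R i) = (pcoroot i, 0)"
    using gim_to_semidirect by blast
  interpret \<Phi>: lie_hom ?G "semidirect grading" \<Phi> by fact
  have C: "?C \<subseteq> lcarrier ?G"
    by (auto simp: gim_eq gim_gens_eq intro!: gim.gen_closed)
  note S = lie_subalgebra_generated[OF \<Phi>.L.lie_algebra_axioms C]
  have sub: "\<And>x. x \<in> ?S \<Longrightarrow> x \<in> lcarrier ?G"
    using S(1) by (auto simp: lie_subalgebra_def lie_subspace_def)
  let ?J = "{x \<in> lcarrier ?G. snd (\<Phi> x) = 0}"
  have "lie_subalgebra ?G ?J"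
    unfolding lie_subalgebra_def lie_subspace_def
    by (auto simp: \<Phi>.hom_zero \<Phi>.hom_add \<Phi>.hom_scale \<Phi>.hom_bracket semidirect_def split: prod.splits)
  moreover have "?C \<subseteq> ?J" using C \<Phi>(2-4) by (auto simp: index_R)
  ultimately have "?S \<subseteq> ?J" by (rule S(3))
  then have \<Phi>_S: "\<Phi> x = (fst (\<Phi> x), 0)" if "x \<in> ?S" for x
    using that by (auto simp: prod_eq_iff)
  interpret t: lie_hom type_lie type_lie to_berman by (rule to_berman)
  define \<psi> where "\<psi> = to_berman \<circ> fst \<circ> \<Phi>"
  have hom: "lie_hom (gim_chevalley B4_diamond R) type_lie \<psi>"
    unfolding gim_chevalley_def
  proof (intro lie_hom.intro lie_hom_axioms.intro)
    show "lie_algebra (lie_restrict ?G ?S)"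
      by (rule lie_algebra_restrict[OF \<Phi>.L.lie_algebra_axioms S(1)])
    show "lie_algebra (type_lie :: berman_gen plie lie_struct)" by (rule lie_algebra_type_lie)
    fix x y c assume x: "x \<in> lcarrier (lie_restrict ?G ?S)"
    then show "\<psi> (c \<odot>\<^bsub>lie_restrict ?G ?S\<^esub> x) = c \<odot>\<^bsub>type_lie\<^esub> \<psi> x"
      using \<Phi>_S[of x] t.hom_scale[of _ c]
      by (simp add: \<psi>_def \<Phi>.hom_scale sub) (metis fst_conv semidirect_simps(4))
    assume y: "y \<in> lcarrier (lie_restrict ?G ?S)"
    show "\<psi> (x \<oplus>\<^bsub>lie_restrict ?G ?S\<^esub> y) = \<psi> x \<oplus>\<^bsub>type_lie\<^esub> \<psi> y"
      using x y \<Phi>_S[of x] \<Phi>_S[of y] t.hom_add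
      by (simp add: \<psi>_def \<Phi>.hom_add sub) (metis fst_conv semidirect_simps(3))
    show "\<psi> (lbr (lie_restrict ?G ?S) x y) = lbr type_lie (\<psi> x) (\<psi> y)"
      using x y \<Phi>_S[of x] \<Phi>_S[of y] t.hom_bracket semidirect_simps(5)[of grading "fst (\<Phi> x)" 0 "fst (\<Phi> y)" 0]
      by (simp add: \<psi>_def \<Phi>.hom_bracket sub)
  qed auto
  have pcoroot: "to_berman (pcoroot i) = coroot i" for i
    using t.hom_scale t.hom_minus by (simp add: pcoroot_eq coroot_def to_berman)
  have gens: "\<psi> (gim_E B4_diamond R i) = root_vec 1 i" "\<psi> (gim_F B4_diamond R i) = root_vec (- 1) i"
    "\<psi> (gim_H B4_diamond R i) = coroot i" if "i \<le> 4" for i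
    using that by (simp_all add: \<psi>_def \<Phi> to_berman pcoroot)
  have "node k \<in> \<psi> ` lcarrier (gim_chevalley B4_diamond R)" if "k \<in> {1..9}" for k
  proof (rule node_in_subalgebra[OF lie_subalgebra_image[OF hom] _ that])
    fix s :: int and i :: nat
    assume s: "s \<in> {1, -1}" and i: "i \<le> 4"
    have "gim_E B4_diamond R i \<in> ?S" "gim_F B4_diamond R i \<in> ?S"
      using S(2) i by (auto simp: index_R)
    then show "root_vec s i \<in> \<psi> ` lcarrier (gim_chevalley B4_diamond R)"
      using s gens(1,2)[OF i, symmetric] unfolding gim_chevalley_def by auto
  qed
  with hom gens show ?thesis by (rule that)
qed

end


section \<open>The fixed points of the Cartan-Chevalley involution\<close>

definition km_terms :: "(nat \<Rightarrow> nat \<Rightarrow> int) \<Rightarrow> 'h::ab_group_add root_basis \<Rightarrow> 'h rb_gen lie_term set" where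
  "km_terms A R = (let I = rb_index R; e = (\<lambda>i. Gen (Root 1 i)); f = (\<lambda>i. Gen (Root (-1) i)) in
    cart_linear_terms R \<union>
    {Br (Gen (Cart h)) (Gen (Cart h')) | h h'. True} \<union>
    {Add (Br (Gen (Cart h)) (e i)) (Scale (-1) (Scale (rb_root R i h) (e i))) | h i. i \<in> I} \<union>
    {Add (Br (Gen (Cart h)) (f i)) (Scale (-1) (Scale (- rb_root R i h) (f i))) | h i. i \<in> I} \<union>
    {Add (Br (e i) (f i)) (Scale (-1) (Gen (Cart (rb_coroot R i)))) | i. i \<in> I} \<union>
    {Br (e i) (f j) | i j. i \<in> I \<and> j \<in> I \<and> i \<noteq> j} \<union>
    {(Br (e i) ^^ nat (1 - A i j)) (e j) | i j. i \<in> I \<and> j \<in> I \<and> i \<noteq> j} \<union>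
    {(Br (f i) ^^ nat (1 - A i j)) (f j) | i j. i \<in> I \<and> j \<in> I \<and> i \<noteq> j})"

lemma km_relations_eq: "km_relations A R = fcls (rb_gens R) ` km_terms A R"
proof -
  have im1: "q ` {f a | a. P a} = {q (f a) | a. P a}" for q f P by auto
  show ?thesis
    unfolding km_relations_def km_terms_def Let_def image_Un image_setcompr im1 cart_linear_relations_eq
      free_gen_eq
    by (intro arg_cong2[of _ _ _ _ "(\<union>)"] HOL.refl Collect_cong ex_cong1 rev_conj_cong)
      (auto simp: free_lie_ops free_lie_minus free_lie_pow)
qed

lemma gens_km_terms: "r \<in> km_terms A R \<Longrightarrow> gens r \<subseteq> rb_gens R"
  unfolding km_terms_def cart_linear_terms_def Let_def
  by (elim UnE CollectE exE conjE) (simp_all add: gens_pow)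

interpretation km: lie_relations "rb_gens R" "km_terms A R" for A R
  by unfold_locales (rule gens_km_terms)

lemma km_eq: "kac_moody A R = presented_lie (rb_gens R) (fcls (rb_gens R) ` km_terms A R)"
  by (simp add: kac_moody_def km_relations_eq)

lemma km_gens_eq:
  "km_e A R i = pcls (rb_gens R) (fcls (rb_gens R) ` km_terms A R) (Gen (Root 1 i))"
  "km_f A R i = pcls (rb_gens R) (fcls (rb_gens R) ` km_terms A R) (Gen (Root (- 1) i))"
  "km_h A R h = pcls (rb_gens R) (fcls (rb_gens R) ` km_terms A R) (Gen (Cart h))"
  by (simp_all add: km_e_def km_f_def km_h_def presented_gen_eq km_relations_eq)

locale kac_moody_presentation =
  fixes A :: "nat \<Rightarrow> nat \<Rightarrow> int" and R :: "'h::ab_group_add root_basis"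
begin

abbreviation "G \<equiv> kac_moody A R"
abbreviation "I \<equiv> rb_index R"
abbreviation "e \<equiv> km_e A R"
abbreviation "f \<equiv> km_f A R"
abbreviation "h \<equiv> km_h A R"
abbreviation "\<omega> \<equiv> cartan_chevalley_involution A R"

lemma lie_algebra_km: "lie_algebra G"
  unfolding km_eq by (rule km.lie_algebra_P)

interpretation lie_algebra G by (rule lie_algebra_km)

lemma km_closed [simp]: "i \<in> I \<Longrightarrow> e i \<in> lcarrier G" "i \<in> I \<Longrightarrow> f i \<in> lcarrier G" "h c \<in> lcarrier G"
  by (simp_all add: km_eq km_gens_eq km.gen_closed)

lemma km_relation:
  "r \<in> km_terms A R \<Longrightarrow>
    leval G (\<lambda>x. pcls (rb_gens R) (fcls (rb_gens R) ` km_terms A R) (Gen x)) r = lzero G"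
  using km.cls_relation[of r A R] km.cls_eq_leval[of r R A] gens_km_terms[of r A R] by (simp add: km_eq)

lemma km_relation_minus:
  assumes "Add s (Scale (-1) t) \<in> km_terms A R"
  defines "g \<equiv> \<lambda>x. pcls (rb_gens R) (fcls (rb_gens R) ` km_terms A R) (Gen x)"
  shows "leval G g s = leval G g t"
proof -
  have "leval G g u \<in> lcarrier G" if "gens u \<subseteq> rb_gens R" for u
    using that by (intro leval_closed) (auto simp: g_def km_eq km.gen_closed)
  then show ?thesis
    using km_relation[OF assms(1)] gens_km_terms[OF assms(1)] eq_iff_minus[of "leval G g s" "leval G g t"]
    by (simp add: g_def lminus_def)
qed

lemma h_add: "h (a + b) = h a \<oplus>\<^bsub>G\<^esub> h b"
  and h_scale: "h (rb_scale R c a) = c \<odot>\<^bsub>G\<^esub> h a"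
proof -
  have "Add (Gen (Cart (a + b))) (Scale (-1) (Add (Gen (Cart a)) (Gen (Cart b)))) \<in> km_terms A R"
    "Add (Gen (Cart (rb_scale R c a))) (Scale (-1) (Scale c (Gen (Cart a)))) \<in> km_terms A R"
    unfolding km_terms_def cart_linear_terms_def Let_def by blast+
  from this[THEN km_relation_minus] show "h (a + b) = h a \<oplus>\<^bsub>G\<^esub> h b"
    "h (rb_scale R c a) = c \<odot>\<^bsub>G\<^esub> h a" by (simp_all add: km_gens_eq)
qed

lemma h_0: "h 0 = \<zero>\<^bsub>G\<^esub>"
  using h_add[of 0 0] add_eq_zero_iff[of "h 0" "h 0"] add_neg_cancel(2)[of "h 0" "h 0"] add_neg_left[of "h 0"]
  by simp

lemma hh: "lbr G (h a) (h b) = \<zero>\<^bsub>G\<^esub>"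
proof -
  have "Br (Gen (Cart a)) (Gen (Cart b)) \<in> km_terms A R"
    unfolding km_terms_def Let_def by blast
  from km_relation[OF this] show ?thesis by (simp add: km_gens_eq)
qed

lemma he: "i \<in> I \<Longrightarrow> lbr G (h a) (e i) = rb_root R i a \<odot>\<^bsub>G\<^esub> e i"
proof -
  assume "i \<in> I"
  then have "Add (Br (Gen (Cart a)) (Gen (Root 1 i))) (Scale (-1) (Scale (rb_root R i a) (Gen (Root 1 i)))) \<in> km_terms A R"
    unfolding km_terms_def Let_def by blast
  from km_relation_minus[OF this] show ?thesis by (simp add: km_gens_eq)
qed

lemma hf: "i \<in> I \<Longrightarrow> lbr G (h a) (f i) = (- rb_root R i a) \<odot>\<^bsub>G\<^esub> f i"
proof -
  assume "i \<in> I"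
  then have "Add (Br (Gen (Cart a)) (Gen (Root (-1) i))) (Scale (-1) (Scale (- rb_root R i a) (Gen (Root (-1) i)))) \<in> km_terms A R"
    unfolding km_terms_def Let_def by blast
  from km_relation_minus[OF this] show ?thesis by (simp add: km_gens_eq)
qed

lemma ef: "i \<in> I \<Longrightarrow> lbr G (e i) (f i) = h (rb_coroot R i)"
proof -
  assume "i \<in> I"
  then have "Add (Br (Gen (Root 1 i)) (Gen (Root (-1) i))) (Scale (-1) (Gen (Cart (rb_coroot R i)))) \<in> km_terms A R"
    unfolding km_terms_def Let_def by blast
  from km_relation_minus[OF this] show ?thesis by (simp add: km_gens_eq)
qed

lemma ef_zero: "\<lbrakk>i \<in> I; j \<in> I; i \<noteq> j\<rbrakk> \<Longrightarrow> lbr G (e i) (f j) = \<zero>\<^bsub>G\<^esub>"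
proof -
  assume "i \<in> I" "j \<in> I" "i \<noteq> j"
  then have "Br (Gen (Root 1 i)) (Gen (Root (-1) j)) \<in> km_terms A R"
    unfolding km_terms_def Let_def by blast
  from km_relation[OF this] show ?thesis by (simp add: km_gens_eq)
qed

lemma km_serre:
  assumes "i \<in> I" "j \<in> I" "i \<noteq> j"
  shows "(lbr G (e i) ^^ nat (1 - A i j)) (e j) = \<zero>\<^bsub>G\<^esub>"
    and "(lbr G (f i) ^^ nat (1 - A i j)) (f j) = \<zero>\<^bsub>G\<^esub>"
proof -
  have "(Br (Gen (Root 1 i)) ^^ nat (1 - A i j)) (Gen (Root 1 j)) \<in> km_terms A R"
    "(Br (Gen (Root (-1) i)) ^^ nat (1 - A i j)) (Gen (Root (-1) j)) \<in> km_terms A R"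
    using assms unfolding km_terms_def Let_def by blast+
  from this[THEN km_relation] show "(lbr G (e i) ^^ nat (1 - A i j)) (e j) = \<zero>\<^bsub>G\<^esub>"
    "(lbr G (f i) ^^ nat (1 - A i j)) (f j) = \<zero>\<^bsub>G\<^esub>" by (simp_all add: km_gens_eq leval_pow)
qed

lemma fe: "\<lbrakk>i \<in> I; j \<in> I\<rbrakk> \<Longrightarrow> lbr G (f i) (e j) = (if i = j then (-1) \<odot>\<^bsub>G\<^esub> h (rb_coroot R i) else \<zero>\<^bsub>G\<^esub>)"
  using bracket_anticomm[of "e j" "f i"] by (auto simp: ef ef_zero scale_zero_right)

lemma scale_neg: "x \<in> lcarrier G \<Longrightarrow> c \<odot>\<^bsub>G\<^esub> x \<oplus>\<^bsub>G\<^esub> (- c) \<odot>\<^bsub>G\<^esub> x = \<zero>\<^bsub>G\<^esub>"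
  "x \<in> lcarrier G \<Longrightarrow> (- c) \<odot>\<^bsub>G\<^esub> x \<oplus>\<^bsub>G\<^esub> c \<odot>\<^bsub>G\<^esub> x = \<zero>\<^bsub>G\<^esub>"
  by (simp_all add: scale_add_left[symmetric] scale_zero_left)

lemma pow_neg:
  assumes "u \<in> lcarrier G" "v \<in> lcarrier G"
  shows "(lbr G u ^^ n) v \<in> lcarrier G"
    and "(lbr G ((-1) \<odot>\<^bsub>G\<^esub> u) ^^ n) ((-1) \<odot>\<^bsub>G\<^esub> v) = (-1) ^ Suc n \<odot>\<^bsub>G\<^esub> (lbr G u ^^ n) v"
proof -
  show 1: "(lbr G u ^^ n) v \<in> lcarrier G" for n using assms by (induction n) auto
  show "(lbr G ((-1) \<odot>\<^bsub>G\<^esub> u) ^^ n) ((-1) \<odot>\<^bsub>G\<^esub> v) = (-1) ^ Suc n \<odot>\<^bsub>G\<^esub> (lbr G u ^^ n) v"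
    by (induction n) (simp_all add: assms 1 bracket_scale_left bracket_scale_right scale_scale)
qed

lemma involution_exists:
  "\<exists>\<phi>. lie_hom G G \<phi> \<and> (\<forall>i\<in>I. \<phi> (e i) = (-1) \<odot>\<^bsub>G\<^esub> f i \<and> \<phi> (f i) = (-1) \<odot>\<^bsub>G\<^esub> e i) \<and>
    (\<forall>a. \<phi> (h a) = (-1) \<odot>\<^bsub>G\<^esub> h a)"
proof -
  define g where "g = case_rb_gen (\<lambda>a. (-1) \<odot>\<^bsub>G\<^esub> h a)
    (\<lambda>s i. (-1) \<odot>\<^bsub>G\<^esub> (if s = 1 then f i else e i))"
  have rel: "leval G g r = \<zero>\<^bsub>G\<^esub>" if "r \<in> km_terms A R" for r
    using that unfolding km_terms_def cart_linear_terms_def Let_def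
    by (elim UnE CollectE exE conjE)
      (simp_all add: g_def leval_pow pow_neg km_serre h_add h_scale scale_add_right scale_scale scale_one
        bracket_scale_left bracket_scale_right hh he hf fe ef ef_zero scale_zero_right add_neg add_neg_left
        ac add_neg_cancel add_zero mult.commute scale_neg)
  have g: "g x \<in> lcarrier G" if "x \<in> rb_gens R" for x
    using that by (auto simp: g_def rb_gens_def)
  obtain \<phi> where "lie_hom G G \<phi>"
    "\<And>x. x \<in> rb_gens R \<Longrightarrow> \<phi> (pcls (rb_gens R) (fcls (rb_gens R) ` km_terms A R) (Gen x)) = g x"
    using km.universal[OF lie_algebra_km g rel, folded km_eq] by blast
  then show ?thesis by (intro exI[of _ \<phi>]) (simp add: km_gens_eq g_def)
qed

lemma km_hom_unique:
  assumes "lie_hom G M \<phi>" "lie_hom G M \<psi>"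
    and "\<And>i. i \<in> I \<Longrightarrow> \<phi> (e i) = \<psi> (e i)" "\<And>i. i \<in> I \<Longrightarrow> \<phi> (f i) = \<psi> (f i)" "\<And>a. \<phi> (h a) = \<psi> (h a)"
    and "x \<in> lcarrier G"
  shows "\<phi> x = \<psi> x"
proof (rule km.hom_unique[of R A M])
  show "lie_hom (presented_lie (rb_gens R) (fcls (rb_gens R) ` km_terms A R)) M \<phi>"
    "lie_hom (presented_lie (rb_gens R) (fcls (rb_gens R) ` km_terms A R)) M \<psi>"
    using assms(1,2) by (simp_all add: km_eq)
  fix y assume "y \<in> rb_gens R"
  then show "\<phi> (pcls (rb_gens R) (fcls (rb_gens R) ` km_terms A R) (Gen y)) =
      \<psi> (pcls (rb_gens R) (fcls (rb_gens R) ` km_terms A R) (Gen y))"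
    using assms(3-5) by (auto simp: rb_gens_def km_gens_eq)
qed (use assms(6) in \<open>simp add: km_eq\<close>)

text \<open>The defining conditions determine the involution, since the generators do; its existence comes from the
  universal property.\<close>

lemma involution:
  "lie_hom G G \<omega>" "i \<in> I \<Longrightarrow> \<omega> (e i) = (-1) \<odot>\<^bsub>G\<^esub> f i" "i \<in> I \<Longrightarrow> \<omega> (f i) = (-1) \<odot>\<^bsub>G\<^esub> e i"
  "\<omega> (h a) = (-1) \<odot>\<^bsub>G\<^esub> h a"
proof -
  let ?P = "\<lambda>\<omega>. \<omega> \<in> extensional (lcarrier G) \<and> lie_hom G G \<omega> \<and>
        (\<forall>i\<in>rb_index R. \<omega> (km_e A R i) = (-1) \<odot>\<^bsub>G\<^esub> km_f A R i \<and>
                        \<omega> (km_f A R i) = (-1) \<odot>\<^bsub>G\<^esub> km_e A R i) \<and>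
        (\<forall>h. \<omega> (km_h A R h) = (-1) \<odot>\<^bsub>G\<^esub> km_h A R h)"
  obtain \<phi> where \<phi>: "lie_hom G G \<phi>"
    "\<And>i. i \<in> I \<Longrightarrow> \<phi> (e i) = (-1) \<odot>\<^bsub>G\<^esub> f i" "\<And>i. i \<in> I \<Longrightarrow> \<phi> (f i) = (-1) \<odot>\<^bsub>G\<^esub> e i"
    "\<And>a. \<phi> (h a) = (-1) \<odot>\<^bsub>G\<^esub> h a"
    using involution_exists by blast
  interpret \<phi>: lie_hom G G \<phi> by fact
  have "lie_hom G G (restrict \<phi> (lcarrier G))"
    by unfold_locales (auto simp: \<phi>.hom_add \<phi>.hom_scale \<phi>.hom_bracket)
  then have ex: "?P (restrict \<phi> (lcarrier G))"
    using \<phi>(2-4) by simp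
  have unique: "\<psi> = \<psi>'" if "?P \<psi>" "?P \<psi>'" for \<psi> \<psi>'
  proof (rule extensionalityI[of _ "lcarrier G"])
    fix x assume "x \<in> lcarrier G"
    then show "\<psi> x = \<psi>' x"
      using that by (elim conjE) (rule km_hom_unique[of G \<psi> \<psi>'], simp_all)
  qed (use that in simp_all)
  have "?P \<omega>"
    unfolding cartan_chevalley_involution_def Let_def by (rule theI[of ?P, OF ex unique[OF _ ex]])
  then show "lie_hom G G \<omega>" "i \<in> I \<Longrightarrow> \<omega> (e i) = (-1) \<odot>\<^bsub>G\<^esub> f i" "i \<in> I \<Longrightarrow> \<omega> (f i) = (-1) \<odot>\<^bsub>G\<^esub> e i"
    "\<omega> (h a) = (-1) \<odot>\<^bsub>G\<^esub> h a" by blast+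
qed

interpretation \<omega>: lie_hom G G \<omega> by (rule involution(1))

lemma involution_involutive: "x \<in> lcarrier G \<Longrightarrow> \<omega> (\<omega> x) = x"
  using km_hom_unique[of G "\<omega> \<circ> \<omega>" "\<lambda>x. x" x]
  by (auto intro!: lie_hom_comp involution(1) lie_hom.intro lie_hom_axioms.intro lie_algebra_km
      simp: involution \<omega>.hom_scale scale_scale scale_one)

section \<open>Generators of the fixed-point subalgebra\<close>

text \<open>The number bounds the height. It serves as the induction measure in \<open>symmetrized_in_subalgebra\<close>, where
  \<open>ad \<ff>\<^sub>j\<close> has to be seen to lower it.\<close>

inductive nplus :: "nat \<Rightarrow> 'h rb_gen lie_term set set \<Rightarrow> bool" where
  zero: "nplus k \<zero>\<^bsub>G\<^esub>"
| gen: "i \<in> I \<Longrightarrow> nplus (Suc k) (e i)"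
| br: "i \<in> I \<Longrightarrow> nplus k x \<Longrightarrow> nplus (Suc k) (lbr G (e i) x)"
| add: "nplus k x \<Longrightarrow> nplus k y \<Longrightarrow> nplus k (x \<oplus>\<^bsub>G\<^esub> y)"
| scale: "nplus k x \<Longrightarrow> nplus k (c \<odot>\<^bsub>G\<^esub> x)"

lemma nplus_closed [simp, intro]: "nplus k x \<Longrightarrow> x \<in> lcarrier G"
  by (induction rule: nplus.induct) auto

lemma nplus_Suc: "nplus k x \<Longrightarrow> nplus (Suc k) x"
  by (induction rule: nplus.induct) (auto intro: nplus.intros)

lemma nplus_mono: "nplus k x \<Longrightarrow> k \<le> l \<Longrightarrow> nplus l x"
  by (induction l) (auto simp: le_Suc_eq intro: nplus_Suc)

lemma nplus_0: "nplus 0 x \<Longrightarrow> x = \<zero>\<^bsub>G\<^esub>"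
  by (induction "0::nat" x rule: nplus.induct) (auto simp: add_zero scale_zero_right)

lemma nplus_h: "nplus k x \<Longrightarrow> nplus k (lbr G (h a) x)"
proof (induction rule: nplus.induct)
  case (br i k x)
  have "lbr G (h a) (lbr G (e i) x) = rb_root R i a \<odot>\<^bsub>G\<^esub> lbr G (e i) x \<oplus>\<^bsub>G\<^esub> lbr G (e i) (lbr G (h a) x)"
    using br by (simp add: bracket_leibniz[of "h a" "e i" x] he bracket_scale_left nplus_closed)
  then show ?case using br by (auto intro: nplus.intros)
qed (auto simp: bracket_zero_right he bracket_add_right bracket_scale_right intro: nplus.intros)

lemma nplus_f:
  assumes "j \<in> I"
  shows "nplus k x \<Longrightarrow> \<exists>a y. nplus (k - 1) y \<and> lbr G (f j) x = h a \<oplus>\<^bsub>G\<^esub> y"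
proof (induction rule: nplus.induct)
  case (zero k)
  show ?case
    using assms by (intro exI[of _ 0] exI[of _ "\<zero>\<^bsub>G\<^esub>"]) (simp add: bracket_zero_right h_0 add_zero nplus.zero)
next
  case (gen i k)
  have "lbr G (f j) (e i) = h (rb_scale R (if i = j then -1 else 0) (rb_coroot R j)) \<oplus>\<^bsub>G\<^esub> \<zero>\<^bsub>G\<^esub>"
    using gen assms by (simp add: fe h_scale add_zero scale_zero_left)
  then show ?case using nplus.zero by blast
next
  case (br i k x)
  then obtain a y where y: "nplus (k - 1) y" "lbr G (f j) x = h a \<oplus>\<^bsub>G\<^esub> y" by blast
  have eq: "lbr G (f j) (lbr G (e i) x) =
      lbr G (lbr G (f j) (e i)) x \<oplus>\<^bsub>G\<^esub> (lbr G (e i) (h a) \<oplus>\<^bsub>G\<^esub> lbr G (e i) y)"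
    using br y assms by (simp add: bracket_leibniz[of "f j" "e i" x] bracket_add_right nplus_closed)
  show ?case
  proof (cases k)
    case 0
    then have "x = \<zero>\<^bsub>G\<^esub>" using nplus_0 br.hyps by simp
    then have "lbr G (f j) (lbr G (e i) x) = h 0 \<oplus>\<^bsub>G\<^esub> \<zero>\<^bsub>G\<^esub>"
      using assms br.hyps by (simp add: bracket_zero_right h_0 add_zero)
    then show ?thesis using nplus.zero by blast
  next
    case (Suc l)
    have "nplus k (lbr G (lbr G (f j) (e i)) x)"
      using br assms nplus_h[OF br.hyps(2)]
      by (auto simp: fe bracket_scale_left bracket_zero_left nplus_closed intro: nplus.zero nplus.scale)
    moreover have "nplus k (lbr G (e i) (h a))"
      using br.hyps(1) by (simp add: bracket_anticomm[of "h a" "e i"] he Suc nplus.gen nplus.scale)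
    moreover have "nplus k (lbr G (e i) y)"
      using br.hyps(1) y(1) by (simp add: Suc nplus.br)
    ultimately have "nplus k (lbr G (f j) (lbr G (e i) x))" unfolding eq by (intro nplus.add)
    moreover have "lbr G (f j) (lbr G (e i) x) = h 0 \<oplus>\<^bsub>G\<^esub> lbr G (f j) (lbr G (e i) x)"
      using calculation by (simp add: h_0 zero_add nplus_closed)
    ultimately show ?thesis by (metis diff_Suc_1)
  qed
next
  case (add k x y)
  then obtain a u b v where *: "nplus (k - 1) u" "lbr G (f j) x = h a \<oplus>\<^bsub>G\<^esub> u"
    "nplus (k - 1) v" "lbr G (f j) y = h b \<oplus>\<^bsub>G\<^esub> v" by blast
  have "lbr G (f j) (x \<oplus>\<^bsub>G\<^esub> y) = h (a + b) \<oplus>\<^bsub>G\<^esub> (u \<oplus>\<^bsub>G\<^esub> v)"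
    using add.hyps assms * by (simp add: bracket_add_right h_add ac nplus_closed)
  then show ?case using * by (blast intro: nplus.add)
next
  case (scale k x c)
  then obtain a u where *: "nplus (k - 1) u" "lbr G (f j) x = h a \<oplus>\<^bsub>G\<^esub> u" by blast
  have "lbr G (f j) (c \<odot>\<^bsub>G\<^esub> x) = h (rb_scale R c a) \<oplus>\<^bsub>G\<^esub> c \<odot>\<^bsub>G\<^esub> u"
    using scale.hyps assms * by (simp add: bracket_scale_right h_scale scale_add_right nplus_closed)
  then show ?case using * by (blast intro: nplus.scale)
qed

text \<open>The set \<open>\<nn>\<^sub>- + \<hh> + \<nn>\<^sub>+\<close>, with \<open>\<nn>\<^sub>-\<close> written as \<open>\<omega>(\<nn>\<^sub>+)\<close>; closure under \<open>ad \<ff>\<^sub>i\<close> then follows from closure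
  under \<open>ad \<ee>\<^sub>i\<close> by applying \<open>\<omega>\<close>.\<close>

definition triangular :: "'h rb_gen lie_term set set set" where
  "triangular = {\<omega> a \<oplus>\<^bsub>G\<^esub> (h c \<oplus>\<^bsub>G\<^esub> b) | a b c. (\<exists>k. nplus k a) \<and> (\<exists>k. nplus k b)}"

lemma triangularI: "\<lbrakk>nplus k a; nplus l b\<rbrakk> \<Longrightarrow> \<omega> a \<oplus>\<^bsub>G\<^esub> (h c \<oplus>\<^bsub>G\<^esub> b) \<in> triangular"
  by (auto simp: triangular_def)

lemma triangularE:
  assumes "x \<in> triangular"
  obtains a b c k where "nplus k a" "nplus k b" "x = \<omega> a \<oplus>\<^bsub>G\<^esub> (h c \<oplus>\<^bsub>G\<^esub> b)"
proof -
  obtain a b c k l where "nplus k a" "nplus l b" "x = \<omega> a \<oplus>\<^bsub>G\<^esub> (h c \<oplus>\<^bsub>G\<^esub> b)"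
    using assms by (auto simp: triangular_def)
  then show ?thesis using that[of "max k l" a b c] nplus_mono by auto
qed

lemma triangular_closed: "x \<in> triangular \<Longrightarrow> x \<in> lcarrier G"
  by (erule triangularE) (simp add: nplus_closed)

lemma triangular_pos: "nplus k b \<Longrightarrow> b \<in> triangular"
  using triangularI[OF nplus.zero, of k b 0] by (simp add: \<omega>.hom_zero h_0 zero_add nplus_closed)

lemma triangular_h: "h c \<in> triangular"
  using triangularI[OF nplus.zero nplus.zero, of c] by (simp add: \<omega>.hom_zero zero_add add_zero)

lemma triangular_add:
  assumes "x \<in> triangular" "y \<in> triangular" shows "x \<oplus>\<^bsub>G\<^esub> y \<in> triangular"
proof -
  from assms obtain a b c k a' b' c' k' where
    x: "nplus k a" "nplus k b" "x = \<omega> a \<oplus>\<^bsub>G\<^esub> (h c \<oplus>\<^bsub>G\<^esub> b)" and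
    y: "nplus k' a'" "nplus k' b'" "y = \<omega> a' \<oplus>\<^bsub>G\<^esub> (h c' \<oplus>\<^bsub>G\<^esub> b')"
    by (elim triangularE)
  have "x \<oplus>\<^bsub>G\<^esub> y = \<omega> (a \<oplus>\<^bsub>G\<^esub> a') \<oplus>\<^bsub>G\<^esub> (h (c + c') \<oplus>\<^bsub>G\<^esub> (b \<oplus>\<^bsub>G\<^esub> b'))"
    using x y by (simp add: \<omega>.hom_add h_add ac nplus_closed)
  moreover have "nplus (max k k') (a \<oplus>\<^bsub>G\<^esub> a')" "nplus (max k k') (b \<oplus>\<^bsub>G\<^esub> b')"
    using x y by (auto intro!: nplus.add intro: nplus_mono)
  ultimately show ?thesis using triangularI by metis
qed

lemma triangular_scale:
  assumes "x \<in> triangular" shows "d \<odot>\<^bsub>G\<^esub> x \<in> triangular"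
proof -
  from assms obtain a b c k where x: "nplus k a" "nplus k b" "x = \<omega> a \<oplus>\<^bsub>G\<^esub> (h c \<oplus>\<^bsub>G\<^esub> b)"
    by (elim triangularE)
  have "d \<odot>\<^bsub>G\<^esub> x = \<omega> (d \<odot>\<^bsub>G\<^esub> a) \<oplus>\<^bsub>G\<^esub> (h (rb_scale R d c) \<oplus>\<^bsub>G\<^esub> d \<odot>\<^bsub>G\<^esub> b)"
    using x by (simp add: \<omega>.hom_scale h_scale scale_add_right nplus_closed)
  then show ?thesis using x triangularI nplus.scale by metis
qed

lemma triangular_\<omega>:
  assumes "x \<in> triangular" shows "\<omega> x \<in> triangular"
proof -
  from assms obtain a b c k where x: "nplus k a" "nplus k b" "x = \<omega> a \<oplus>\<^bsub>G\<^esub> (h c \<oplus>\<^bsub>G\<^esub> b)"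
    by (elim triangularE)
  have "\<omega> x = \<omega> b \<oplus>\<^bsub>G\<^esub> (h (rb_scale R (-1) c) \<oplus>\<^bsub>G\<^esub> a)"
    using x by (simp add: \<omega>.hom_add involution_involutive involution h_scale ac nplus_closed)
  then show ?thesis using x triangularI by metis
qed

lemma triangular_e:
  assumes "i \<in> I" "x \<in> triangular" shows "lbr G (e i) x \<in> triangular"
proof -
  from assms(2) obtain a b c k where x: "nplus k a" "nplus k b" "x = \<omega> a \<oplus>\<^bsub>G\<^esub> (h c \<oplus>\<^bsub>G\<^esub> b)"
    by (elim triangularE)
  obtain d y where y: "nplus (k - 1) y" "lbr G (f i) a = h d \<oplus>\<^bsub>G\<^esub> y"
    using nplus_f[OF assms(1) x(1)] by blast
  have "lbr G (e i) (\<omega> a) = (-1) \<odot>\<^bsub>G\<^esub> \<omega> (lbr G (f i) a)"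
    using x assms(1) by (simp add: \<omega>.hom_bracket involution bracket_scale_left scale_scale scale_one nplus_closed)
  then have "lbr G (e i) (\<omega> a) \<in> triangular"
    unfolding y(2) using y(1) triangular_scale triangular_\<omega> triangular_add triangular_h triangular_pos by metis
  moreover have "lbr G (e i) (h c) \<in> triangular"
    using assms(1) triangular_scale[OF triangular_scale[OF triangular_pos[OF nplus.gen[OF assms(1), of 0]]]]
    by (simp add: bracket_anticomm[of "h c" "e i"] he)
  moreover have "lbr G (e i) b \<in> triangular"
    using x(2) assms(1) triangular_pos[OF nplus.br] by blast
  ultimately show ?thesis
    using x assms(1) by (simp add: bracket_add_right triangular_add nplus_closed)
qed

lemma triangular_f:
  assumes "i \<in> I" "x \<in> triangular" shows "lbr G (f i) x \<in> triangular"
proof -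
  have "lbr G (f i) x = (-1) \<odot>\<^bsub>G\<^esub> \<omega> (lbr G (e i) (\<omega> x))"
    using assms by (simp add: \<omega>.hom_bracket involution involution_involutive bracket_scale_left scale_scale
        scale_one triangular_closed)
  then show ?thesis
    using triangular_scale[OF triangular_\<omega>[OF triangular_e[OF assms(1) triangular_\<omega>[OF assms(2)]]]] by metis
qed

lemma triangular_br_h:
  assumes "x \<in> triangular" shows "lbr G (h d) x \<in> triangular"
proof -
  from assms obtain a b c k where x: "nplus k a" "nplus k b" "x = \<omega> a \<oplus>\<^bsub>G\<^esub> (h c \<oplus>\<^bsub>G\<^esub> b)"
    by (elim triangularE)
  have "lbr G (h d) (\<omega> a) = (-1) \<odot>\<^bsub>G\<^esub> \<omega> (lbr G (h d) a)"
    using x by (simp add: \<omega>.hom_bracket involution bracket_scale_left scale_scale scale_one nplus_closed)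
  then have "lbr G (h d) (\<omega> a) \<in> triangular"
    using triangular_scale[OF triangular_\<omega>[OF triangular_pos[OF nplus_h[OF x(1)]]]] by metis
  then show ?thesis
    using x triangular_pos[OF nplus_h[OF x(2)]]
    by (simp add: bracket_add_right hh zero_add triangular_add nplus_closed)
qed

text \<open>The set contains the generators, and the elements whose adjoint action preserves it form a subalgebra that
  also contains them.\<close>

lemma triangular_decomposition: "triangular = lcarrier G"
proof
  show "lcarrier G \<subseteq> triangular"
  proof
    fix x assume "x \<in> lcarrier G"
    then obtain t where t: "gens t \<subseteq> rb_gens R"
      "x = leval G (\<lambda>x. pcls (rb_gens R) (fcls (rb_gens R) ` km_terms A R) (Gen x)) t"
      using km.cls_eq_leval[of _ R A] by (auto simp: km_eq km.carrier_P)
    let ?q = "leval G (\<lambda>x. pcls (rb_gens R) (fcls (rb_gens R) ` km_terms A R) (Gen x))"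
    have "?q t \<in> triangular \<and> (\<forall>y\<in>triangular. lbr G (?q t) y \<in> triangular)" using t(1)
    proof (induction t)
      case (Gen g)
      then consider c where "g = Cart c" | i where "g = Root 1 i" "i \<in> I" | i where "g = Root (-1) i" "i \<in> I"
        by (auto simp: rb_gens_def)
      then show ?case
      proof cases
        case 1
        then show ?thesis using triangular_h[of c] triangular_br_h[of _ c] by (simp add: km_gens_eq)
      next
        case 2
        then show ?thesis using triangular_pos[OF nplus.gen[of i 0]] triangular_e[of i] by (simp add: km_gens_eq)
      next
        case 3
        have "f i = (-1) \<odot>\<^bsub>G\<^esub> \<omega> (e i)" using 3 by (simp add: involution scale_scale scale_one)
        then have "f i \<in> triangular"
          using triangular_scale[OF triangular_\<omega>[OF triangular_pos[OF nplus.gen[of i 0]]]] 3 by metis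
        then show ?thesis using 3 triangular_f[of i] by (simp add: km_gens_eq)
      qed
    next
      case Zero
      then show ?case using triangular_h[of 0] by (simp add: h_0 bracket_zero_left triangular_closed)
    next
      case (Add s t)
      then show ?case by (simp add: triangular_add bracket_add_left triangular_closed)
    next
      case (Scale c s)
      then show ?case by (simp add: triangular_scale bracket_scale_left triangular_closed)
    next
      case (Br s t)
      then have st: "?q s \<in> lcarrier G" "?q t \<in> lcarrier G" by (simp_all add: triangular_closed)
      show ?case
      proof (intro conjI ballI)
        fix y assume y: "y \<in> triangular"
        have "lbr G (lbr G (?q s) (?q t)) y =
          lbr G (?q s) (lbr G (?q t) y) \<oplus>\<^bsub>G\<^esub> (-1) \<odot>\<^bsub>G\<^esub> lbr G (?q t) (lbr G (?q s) y)"
          using st triangular_closed[OF y]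
          by (simp add: bracket_leibniz[of "?q s" "?q t" y] add_assoc add_neg add_zero)
        then show "lbr G (?q (Br s t)) y \<in> triangular"
          using Br y by (simp add: triangular_add triangular_scale)
      qed (use Br in simp)
    qed
    then show "x \<in> triangular" using t(2) by simp
  qed
qed (auto intro: triangular_closed)

text \<open>In \<open>[x\<^sub>i, u + \<omega>(u)]\<close> the parts \<open>[\<ee>\<^sub>i, u]\<close> and \<open>[\<ff>\<^sub>i, u]\<close> appear symmetrized, with opposite signs. The second has the form
  \<open>h + v\<close> with \<open>v\<close> of smaller height, and \<open>h + \<omega>(h) = 0\<close>; so the symmetrization of \<open>[\<ee>\<^sub>i, u]\<close> reduces to
  those of \<open>u\<close> and \<open>v\<close>.\<close>

lemma symmetrized_in_subalgebra:
  assumes S: "lie_subalgebra G S" and x: "\<And>i. i \<in> I \<Longrightarrow> berman A R i \<in> S"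
  shows "nplus k y \<Longrightarrow> y \<oplus>\<^bsub>G\<^esub> \<omega> y \<in> S"
proof (induction k arbitrary: y rule: less_induct)
  case (less n)
  have S_zero: "\<zero>\<^bsub>G\<^esub> \<in> S"
    and S_add: "\<And>x y. x \<in> S \<Longrightarrow> y \<in> S \<Longrightarrow> x \<oplus>\<^bsub>G\<^esub> y \<in> S"
    and S_scale: "\<And>c x. x \<in> S \<Longrightarrow> c \<odot>\<^bsub>G\<^esub> x \<in> S"
    and S_br: "\<And>x y. x \<in> S \<Longrightarrow> y \<in> S \<Longrightarrow> lbr G x y \<in> S"
    using S by (auto simp: lie_subalgebra_def lie_subspace_def)
  from less.prems less.IH show ?case
  proof (induction rule: nplus.induct)
    case (zero k)
    show ?case using S_zero by (simp add: \<omega>.hom_zero add_zero)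
  next
    case (gen i k)
    then show ?case using x[of i] by (simp add: involution berman_def lminus_def)
  next
    case (br i k u)
    obtain a v where v: "nplus (k - 1) v" "lbr G (f i) u = h a \<oplus>\<^bsub>G\<^esub> v"
      using nplus_f[OF br.hyps] by blast
    have v_S: "v \<oplus>\<^bsub>G\<^esub> \<omega> v \<in> S" using br.prems[OF _ v(1)] by simp
    have u_S: "u \<oplus>\<^bsub>G\<^esub> \<omega> u \<in> S"
      by (rule br.IH, rule br.prems[OF less_SucI])
    note cl = nplus_closed[OF v(1)] nplus_closed[OF br.hyps(2)] br.hyps(1)
    have "lbr G (e i) u \<oplus>\<^bsub>G\<^esub> \<omega> (lbr G (e i) u) =
      lbr G (berman A R i) (u \<oplus>\<^bsub>G\<^esub> \<omega> u) \<oplus>\<^bsub>G\<^esub> (lbr G (f i) u \<oplus>\<^bsub>G\<^esub> \<omega> (lbr G (f i) u))"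
      using cl by (simp add: \<omega>.hom_bracket involution bracket_linear berman_def lminus_def scale_add_right ac
          add_neg_cancel add_neg add_neg_left add_zero)
    also have "lbr G (f i) u \<oplus>\<^bsub>G\<^esub> \<omega> (lbr G (f i) u) = v \<oplus>\<^bsub>G\<^esub> \<omega> v"
      using cl by (simp add: v(2) \<omega>.hom_add involution ac add_neg add_zero)
    finally show ?case
      using S_add[OF S_br[OF x[OF br.hyps(1)] u_S] v_S] by simp
  next
    case (add k u v)
    have "(u \<oplus>\<^bsub>G\<^esub> v) \<oplus>\<^bsub>G\<^esub> \<omega> (u \<oplus>\<^bsub>G\<^esub> v) = (u \<oplus>\<^bsub>G\<^esub> \<omega> u) \<oplus>\<^bsub>G\<^esub> (v \<oplus>\<^bsub>G\<^esub> \<omega> v)"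
      using add.hyps by (simp add: \<omega>.hom_add ac nplus_closed)
    then show ?case using add by (simp add: S_add)
  next
    case (scale k u c)
    have "c \<odot>\<^bsub>G\<^esub> u \<oplus>\<^bsub>G\<^esub> \<omega> (c \<odot>\<^bsub>G\<^esub> u) = c \<odot>\<^bsub>G\<^esub> (u \<oplus>\<^bsub>G\<^esub> \<omega> u)"
      using scale.hyps by (simp add: \<omega>.hom_scale scale_add_right nplus_closed)
    then show ?case using scale by (simp add: S_scale)
  qed
qed

text \<open>Berman's theorem: a fixed point \<open>z\<close> with triangular decomposition \<open>\<omega>(a) + h + b\<close> satisfies
  \<open>2 z = z + \<omega>(z) = (a + \<omega>(a)) + (b + \<omega>(b))\<close>.\<close>

theorem fixed_points_generated:
  assumes S: "lie_subalgebra G S" and x: "\<And>i. i \<in> I \<Longrightarrow> berman A R i \<in> S"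
  shows "lcarrier (km_fixed A R) \<subseteq> S"
proof
  fix z assume "z \<in> lcarrier (km_fixed A R)"
  then have z: "z \<in> lcarrier G" "\<omega> z = z" by (simp_all add: km_fixed_def)
  then obtain a b c k where t: "nplus k a" "nplus k b" "z = \<omega> a \<oplus>\<^bsub>G\<^esub> (h c \<oplus>\<^bsub>G\<^esub> b)"
    using triangular_decomposition triangularE by metis
  note cl = nplus_closed[OF t(1)] nplus_closed[OF t(2)]
  have "(1 + 1) \<odot>\<^bsub>G\<^esub> z = \<omega> z \<oplus>\<^bsub>G\<^esub> z" using z by (simp only: scale_add_left scale_one)
  also have "\<dots> = (a \<oplus>\<^bsub>G\<^esub> \<omega> a) \<oplus>\<^bsub>G\<^esub> (b \<oplus>\<^bsub>G\<^esub> \<omega> b)"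
    using cl by (simp add: t(3) \<omega>.hom_add involution involution_involutive ac add_neg add_zero)
  also have "\<dots> \<in> S"
    using S symmetrized_in_subalgebra[OF S x t(1)] symmetrized_in_subalgebra[OF S x t(2)]
    by (simp add: lie_subalgebra_def lie_subspace_def)
  finally have "(1/2) \<odot>\<^bsub>G\<^esub> 2 \<odot>\<^bsub>G\<^esub> z \<in> S"
    using S by (simp add: lie_subalgebra_def lie_subspace_def)
  then show "z \<in> S" using z(1) by (simp add: scale_scale scale_one)
qed

lemma berman_closed: "i \<in> I \<Longrightarrow> berman A R i \<in> lcarrier G"
  by (simp add: berman_def)

lemma fixed_subalgebra: "lie_subalgebra G (lcarrier (km_fixed A R))"
  unfolding lie_subalgebra_def lie_subspace_def
  by (auto simp: km_fixed_def \<omega>.hom_zero \<omega>.hom_add \<omega>.hom_scale \<omega>.hom_bracket)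

lemma berman_fixed: "i \<in> I \<Longrightarrow> berman A R i \<in> lcarrier (km_fixed A R)"
  by (simp add: km_fixed_def berman_closed) (simp add: berman_def lminus_def \<omega>.hom_add \<omega>.hom_scale
      involution scale_scale scale_one add_commute)

lemma berman_commute:
  assumes ij: "i \<in> I" "j \<in> I" "i \<noteq> j" and A: "A i j = 0"
  shows "lbr G (berman A R i) (berman A R j) = \<zero>\<^bsub>G\<^esub>"
  using ij km_serre[OF ij] A
  by (simp add: berman_def lminus_def bracket_linear ef_zero fe scale_zero_right add_zero)

lemma berman_joined:
  assumes ij: "i \<in> I" "j \<in> I" "i \<noteq> j" and A: "A i j = -1" "rb_root R j (rb_coroot R i) = -1"
  shows "lbr G (berman A R i) (lbr G (berman A R i) (berman A R j)) \<oplus>\<^bsub>G\<^esub> berman A R j = \<zero>\<^bsub>G\<^esub>"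
proof -
  have s: "lbr G (e i) (lbr G (e i) (e j)) = \<zero>\<^bsub>G\<^esub>" "lbr G (f i) (lbr G (f i) (f j)) = \<zero>\<^bsub>G\<^esub>"
    using km_serre[OF ij] A by (simp_all add: numeral_2_eq_2)
  have eff: "lbr G (e i) (lbr G (f i) (f j)) = f j"
    using ij A by (simp add: bracket_leibniz[of "e i" "f i" "f j"] ef ef_zero hf bracket_zero_right add_zero scale_one)
  have fee: "lbr G (f i) (lbr G (e i) (e j)) = e j"
    using ij A by (simp add: bracket_leibniz[of "f i" "e i" "e j"] fe he bracket_zero_right bracket_scale_left
        add_zero scale_scale scale_one)
  have "lbr G (berman A R i) (berman A R j) = lbr G (e i) (e j) \<oplus>\<^bsub>G\<^esub> lbr G (f i) (f j)"
    using ij by (simp add: berman_def lminus_def bracket_linear ef_zero fe scale_zero_right add_zero zero_add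
        scale_scale scale_one)
  then show ?thesis
    using ij by (simp add: berman_def lminus_def bracket_linear s eff fee scale_zero_right add_zero zero_add
        ac add_neg add_neg_left add_neg_cancel)
qed

end


section \<open>The homomorphism onto the fixed points\<close>

lemma (in lie_hom) hom_B4:
  assumes xy: "\<forall>i\<in>{1..9}. x i \<in> lcarrier L \<and> \<phi> (x i) = y i"
  shows "\<phi> (x_plus L x) = x_plus M y" "\<phi> (x_minus L x) = x_minus M y"
    and "j \<in> {1..4} \<Longrightarrow> \<phi> (H_L L x j) = H_L M y j"
    and "j \<in> {1..4} \<Longrightarrow> \<phi> (B4_e L x j) = B4_e M y j"
    and "j \<in> {1..4} \<Longrightarrow> \<phi> (B4_f L x j) = B4_f M y j"
    and "j \<in> {1..4} \<Longrightarrow> \<phi> (B4_h L x j) = B4_h M y j"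
proof -
  note [simp] = xy[rule_format, THEN conjunct1] xy[rule_format, THEN conjunct2] hom_scale hom_add hom_minus hom_bracket
  have j: "j = 1 \<or> j = 2 \<or> j = 3 \<or> j = 4" if "j \<in> {1..4}" using that by auto
  show "\<phi> (x_plus L x) = x_plus M y" "\<phi> (x_minus L x) = x_minus M y"
    by (simp_all add: x_plus_def x_minus_def)
  show "\<phi> (H_L L x j) = H_L M y j" if "j \<in> {1..4}"
    using j[OF that] by (elim disjE) (simp_all add: H_L_def)
  show "\<phi> (B4_e L x j) = B4_e M y j" if "j \<in> {1..4}"
    using j[OF that] by (elim disjE) (simp_all add: B4_e_def e_L_def e_LL_def upt_conv_Cons)
  show "\<phi> (B4_f L x j) = B4_f M y j" if "j \<in> {1..4}"
    using j[OF that] by (elim disjE) (simp_all add: B4_f_def e_L_def e_LL_def upt_conv_Cons)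
  show "\<phi> (B4_h L x j) = B4_h M y j" if "j \<in> {1..4}"
    using j[OF that] by (elim disjE) (simp_all add: B4_h_def H_L_def)
qed

text \<open>The subalgebra of fixed points inherits the Berman relations from the Kac--Moody algebra, where they follow
  from the Serre relations.\<close>

lemma berman_to_fixed:
  fixes Q :: "'k::ab_group_add root_basis"
  assumes Q: "is_free_realisation {1..9} E9_cartan Q"
  obtains \<rho> where "lie_hom type_lie (km_fixed E9_cartan Q) \<rho>"
    "\<And>i. i \<in> {1..9} \<Longrightarrow> \<rho> (node i) = berman E9_cartan Q i"
proof -
  let ?G = "kac_moody E9_cartan Q" and ?K = "km_fixed E9_cartan Q"
  interpret km9: kac_moody_presentation E9_cartan Q .
  have I: "rb_index Q = {1..9}" using Q by (simp add: is_free_realisation_def)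
  have root: "rb_root Q j (rb_coroot Q i) = of_int (E9_cartan i j)" if "i \<in> {1..9}" "j \<in> {1..9}" for i j
    using Q that by (simp add: is_free_realisation_def)
  have K: "?K = lie_restrict ?G (lcarrier ?K)" by (simp add: km_fixed_def lie_restrict_def)
  have algK: "lie_algebra ?K"
    using lie_algebra_restrict[OF km9.lie_algebra_km km9.fixed_subalgebra] K by metis
  have ops: "lzero ?K = lzero ?G" "ladd ?K = ladd ?G" "lbr ?K = lbr ?G"
    by (simp_all add: km_fixed_def)
  define g where "g = case_berman_gen (\<lambda>i. if i \<in> {1..9} then berman E9_cartan Q i else lzero ?K)"
  have g: "g n \<in> lcarrier ?K" for n
    using km9.berman_fixed lie_algebra.zero_closed[OF algK]
    by (cases n) (simp add: g_def I)
  have rel: "leval ?K g r = lzero ?K" if r: "r \<in> relators" for r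
    using r unfolding relators_berman_gen_def
  proof (elim UnE CollectE exE conjE)
    fix i j assume ij: "i \<in> {1..9}" "j \<in> {1..9}" "i \<noteq> j" "{i, j} \<notin> E9_edges"
      and r: "r = Br (Gen (Node i)) (Gen (Node j))"
    have "E9_cartan i j = 0" using ij by (simp add: E9_cartan_def)
    then show ?thesis
      unfolding r using km9.berman_commute[of i j] ij by (simp add: g_def ops I)
  next
    fix i j assume ij: "i \<in> {1..9}" "j \<in> {1..9}" "{i, j} \<in> E9_edges"
      and r: "r = Add (Br (Gen (Node i)) (Br (Gen (Node i)) (Gen (Node j)))) (Gen (Node j))"
    have ne: "i \<noteq> j" using ij(3) by (auto simp: E9_edges_iff)
    then have "E9_cartan i j = - 1" using ij by (simp add: E9_cartan_def)
    then show ?thesis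
      unfolding r using km9.berman_joined[of i j] root[OF ij(1,2)] ij ne by (simp add: g_def ops I)
  qed
  show ?thesis
    using that[OF plie_eval_hom(1)[OF algK g rel]] plie_eval_hom(2)[OF algK g rel]
    by (simp add: node_def g_def)
qed

theorem proposition27:
  fixes R :: "'h::ab_group_add root_basis" and Q :: "'k::ab_group_add root_basis"
  assumes R: "is_free_realisation {0..4} B4_diamond R"
    and Q: "is_free_realisation {1..9} E9_cartan Q"
  defines "K \<equiv> km_fixed E9_cartan Q" and "x \<equiv> berman E9_cartan Q"
  shows "\<exists>\<phi>. lie_hom (gim_chevalley B4_diamond R) K \<phi> \<and>
    \<phi> ` lcarrier (gim_chevalley B4_diamond R) = lcarrier K \<and>
    \<phi> (gim_E B4_diamond R 0) = x_plus K x \<and>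
    \<phi> (gim_F B4_diamond R 0) = x_minus K x \<and>
    \<phi> (gim_H B4_diamond R 0) = lscale K 2 (H_L K x 2) \<and>
    lscale K 2 (H_L K x 2) =
      ladd K (ladd K (lscale K 2 (B4_h K x 2)) (lscale K 2 (B4_h K x 3))) (B4_h K x 4) \<and>
    (\<forall>i\<in>{1..4}. \<phi> (gim_E B4_diamond R i) = B4_e K x i \<and>
                 \<phi> (gim_F B4_diamond R i) = B4_f K x i \<and>
                 \<phi> (gim_H B4_diamond R i) = B4_h K x i)"
proof -
  interpret km9: kac_moody_presentation E9_cartan Q .
  obtain \<psi> where \<psi>: "lie_hom (gim_chevalley B4_diamond R) type_lie \<psi>"
    "\<And>i. i \<le> 4 \<Longrightarrow> \<psi> (gim_E B4_diamond R i) = root_vec 1 i"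
    "\<And>i. i \<le> 4 \<Longrightarrow> \<psi> (gim_F B4_diamond R i) = root_vec (- 1) i"
    "\<And>i. i \<le> 4 \<Longrightarrow> \<psi> (gim_H B4_diamond R i) = coroot i"
    "\<And>k. k \<in> {1..9} \<Longrightarrow> node k \<in> \<psi> ` lcarrier (gim_chevalley B4_diamond R)"
    using gim_chevalley_to_berman[OF R] by blast
  obtain \<rho> where \<rho>: "lie_hom type_lie K \<rho>" "\<And>i. i \<in> {1..9} \<Longrightarrow> \<rho> (node i) = x i"
    using berman_to_fixed[OF Q] unfolding K_def x_def by blast
  interpret \<rho>: lie_hom type_lie K \<rho> by (rule \<rho>)
  have hom: "lie_hom (gim_chevalley B4_diamond R) K (\<rho> \<circ> \<psi>)"
    by (rule lie_hom_comp[OF \<psi>(1) \<rho>(1)])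
  interpret \<phi>: lie_hom "gim_chevalley B4_diamond R" K "\<rho> \<circ> \<psi>" by (rule hom)
  let ?S = "(\<rho> \<circ> \<psi>) ` lcarrier (gim_chevalley B4_diamond R)"
  have K: "K = lie_restrict (kac_moody E9_cartan Q) (lcarrier K)"
    by (simp add: K_def km_fixed_def lie_restrict_def)
  have fix_sub: "lie_subalgebra (kac_moody E9_cartan Q) (lcarrier K)"
    unfolding K_def by (rule km9.fixed_subalgebra)
  have "lie_subalgebra K ?S" by (rule lie_subalgebra_image[OF hom])
  then have "lie_subalgebra (lie_restrict (kac_moody E9_cartan Q) (lcarrier K)) ?S"
    using K by simp
  then have sub: "lie_subalgebra (kac_moody E9_cartan Q) ?S"
    using fix_sub by (auto simp: lie_subalgebra_def lie_subspace_def)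
  have "x i \<in> ?S" if "i \<in> {1..9}" for i
    using \<psi>(5)[OF that] \<rho>(2)[OF that, symmetric] unfolding image_comp[symmetric] by (auto intro: imageI)
  moreover have "rb_index Q = {1..9}" using Q by (simp add: is_free_realisation_def)
  ultimately have "lcarrier K \<subseteq> ?S"
    unfolding K_def x_def by (intro km9.fixed_points_generated sub[unfolded K_def]) auto
  then have surj: "?S = lcarrier K" by auto
  have "\<forall>i\<in>{1..9}. node i \<in> lcarrier type_lie \<and> \<rho> (node i) = x i" using \<rho>(2) by simp
  note \<rho>_B4 = \<rho>.hom_B4[OF this]
  have image_0: "(\<rho> \<circ> \<psi>) (gim_E B4_diamond R 0) = x_plus K x"
    "(\<rho> \<circ> \<psi>) (gim_F B4_diamond R 0) = x_minus K x"
    using \<rho>_B4(1,2) by (simp_all add: \<psi> x_plus_minus_eq)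
  have \<rho>_H: "\<rho> (torus 2) = H_L K x 2" "\<rho> (coroot i) = B4_h K x i" if "i \<in> {1..4}" for i
    using \<rho>_B4(3)[of 2] \<rho>_B4(6)[OF that] that by (simp_all add: B4_h_eq)
  have image_i: "(\<rho> \<circ> \<psi>) (gim_E B4_diamond R i) = B4_e K x i"
    "(\<rho> \<circ> \<psi>) (gim_F B4_diamond R i) = B4_f K x i"
    "(\<rho> \<circ> \<psi>) (gim_H B4_diamond R i) = B4_h K x i" if "i \<in> {1..4}" for i
    using \<rho>_B4(4,5)[OF that] \<rho>_H(2)[OF that] that by (simp_all add: \<psi> B4_ef_eq)
  have H0: "lscale K 2 (H_L K x 2) = \<rho> (coroot 0)"
    using \<rho>.hom_scale[of "torus 2" 2] \<rho>_H(1)[of 2] by (simp add: coroot_def)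
  have "(\<rho> \<circ> \<psi>) (gim_H B4_diamond R 0) = lscale K 2 (H_L K x 2)"
    by (simp add: \<psi> H0)
  moreover have "lscale K 2 (H_L K x 2) =
      ladd K (ladd K (lscale K 2 (B4_h K x 2)) (lscale K 2 (B4_h K x 3))) (B4_h K x 4)"
    unfolding H0 coroot_0_eq using \<rho>_H(2) \<rho>.hom_add \<rho>.hom_scale by simp
  ultimately show ?thesis
    by (intro exI[of _ "\<rho> \<circ> \<psi>"] conjI ballI hom surj image_0 image_i)
qed

end
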